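(* Fix an integer $q\ge2$ and suppose $d=d(N)\to\infty$ with $d=o(N)$ as $N\to\infty$ (integers $1\le d\le N$). Then: (i) if $\log N=o(d)$, then $$R_{N,q}^{(d)}=(1+o(1))\sqrt{\frac{d}{e(q-1)N}};$$ (ii) if $d\sim\tau\log N$ for some $0<\tau<\infty$, then $$R_{N,q}^{(d)}=(1+o(1))\,e^{1/(2\tau)}\sqrt{\frac{d}{e(q-1)N}}.$$ In particular, if $d\sim\log N$, then $$R_{N,q}^{(d)}=(1+o(1))\sqrt{\frac{\log N}{(q-1)N}}.$$
   Context: Let $C_q=\{1,\omega,\dots,\omega^{q-1}\}\subset\mathbb C$, $\omega=e^{2\pi i/q}$. Every $f:C_q^N\to\mathbb C$ has a unique Fourier expansion $f(x)=\sum_{\alpha\in\{0,\dots,q-1\}^N}\widehat f(\alpha)x^\alpha$, where $x^\alpha=x_1^{\alpha_1}\cdots x_N^{\alpha_N}$ and $\widehat f(\alpha)=q^{-N}\sum_{x\in C_q^N}f(x)\overline{x^\alpha}$. Put $\|f\|_\infty=\max_{x\in C_q^N}|f(x)|$ and $\operatorname{supp}(\alpha)=\{j\in\{1,\dots,N\}:\alpha_j\ne0\}$. For $1\le d\le N$ let $\mathcal H_{N,q}^{(d)}$ be the set of $f:C_q^N\to\mathbb C$ with $\widehat f(\alpha)=0$ whenever $|\operatorname{supp}(\alpha)|\ne d$. The interaction Bohr radius of the $d$th layer is $$R_{N,q}^{(d)}=\sup\left\{0\le r\le1:\ r^d\sum_{|\operatorname{supp}(\alpha)|=d}|\widehat f(\alpha)|\le\|f\|_\infty\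 \text{for every } f\in\mathcal H_{N,q}^{(d)}\right\}.$$ All asymptotics are as $N\to\infty$; $d\sim g(N)$ means $d/g(N)\to1$. *)

theory Defs
  imports "HOL-Analysis.Analysis" "HOL-Library.Landau_Symbols"
begin

unbundle asymp_equiv_syntax

text \<open>
  Points of \<open>C\<^sub>q\<^sup>N\<close> and multi-indices are extensional functions on the coordinate set \<open>{1..N}\<close>.
  A function \<open>C\<^sub>q\<^sup>N \<rightarrow> \<complex>\<close> is represented by a total HOL function; all notions below depend only on
  its values on \<open>cube q N\<close>.
\<close>

definition roots_unity :: "nat \<Rightarrow> complex set" where
  "roots_unity q = (\<lambda>k. exp (2 * of_real pi * \<i> / of_nat q) ^ k) ` {0..<q}"

definition cube :: "nat \<Rightarrow> nat \<Rightarrow> (nat \<Rightarrow> complex) set" where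
  "cube q N = {1..N} \<rightarrow>\<^sub>E roots_unity q"

definition multi_indices :: "nat \<Rightarrow> nat \<Rightarrow> (nat \<Rightarrow> nat) set" where
  "multi_indices q N = {1..N} \<rightarrow>\<^sub>E {0..<q}"

definition monomial :: "nat \<Rightarrow> (nat \<Rightarrow> nat) \<Rightarrow> (nat \<Rightarrow> complex) \<Rightarrow> complex" where
  "monomial N \<alpha> x = (\<Prod>j\<in>{1..N}. x j ^ \<alpha> j)"

definition fourier_coeff ::
  "nat \<Rightarrow> nat \<Rightarrow> ((nat \<Rightarrow> complex) \<Rightarrow> complex) \<Rightarrow> (nat \<Rightarrow> nat) \<Rightarrow> complex" where
  "fourier_coeff q N f \<alpha> = (\<Sum>x\<in>cube q N. f x * cnj (monomial N \<alpha> x)) / of_nat q ^ N"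

definition sup_norm :: "nat \<Rightarrow> nat \<Rightarrow> ((nat \<Rightarrow> complex) \<Rightarrow> complex) \<Rightarrow> real" where
  "sup_norm q N f = Max ((\<lambda>x. cmod (f x)) ` cube q N)"

definition index_supp :: "nat \<Rightarrow> (nat \<Rightarrow> nat) \<Rightarrow> nat set" where
  "index_supp N \<alpha> = {j\<in>{1..N}. \<alpha> j \<noteq> 0}"

definition layer :: "nat \<Rightarrow> nat \<Rightarrow> nat \<Rightarrow> ((nat \<Rightarrow> complex) \<Rightarrow> complex) set" where
  "layer q N d = {f. \<forall>\<alpha>\<in>multi_indices q N. card (index_supp N \<alpha>) \<noteq> d \<longrightarrow> fourier_coeff q N f \<alpha> = 0}"

definition interaction_bohr_radius :: "nat \<Rightarrow> nat \<Rightarrow> nat \<Rightarrow> real" where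
  "interaction_bohr_radius q N d =
     Sup {r. 0 \<le> r \<and> r \<le> 1 \<and>
       (\<forall>f\<in>layer q N d.
          r ^ d * (\<Sum>\<alpha> | \<alpha> \<in> multi_indices q N \<and> card (index_supp N \<alpha>) = d.
                     cmod (fourier_coeff q N f \<alpha>))
            \<le> sup_norm q N f)}"

end

theory Submission
  imports Defs
begin

text \<open>
  Write \<open>M = (N choose d) (q - 1)\<^sup>d\<close> for the number of characters in the layer; \<open>R\<^sup>d\<close> is the inverse
  of the Sidon constant of the layer. Cauchy-Schwarz and Parseval bound that constant by \<open>sqrt M\<close>,
  and a random choice of signs gives a polynomial with unimodular coefficients and sup norm
  \<open>O(sqrt (N M))\<close>, so the constant is at least of order \<open>sqrt (M / N)\<close>. As \<open>M\<^sup>1\<^sup>/\<^sup>d\<close> is asymptotic to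
  \<open>e (q - 1) N / d\<close>, the two bounds agree to first order when \<open>ln N = o(d)\<close>.

  When \<open>d\<close> is comparable to \<open>ln N\<close> the factor \<open>sqrt N\<close> matters, and the Sidon constant must be shown
  to be at most \<open>sqrt (M / N) e\<^sup>o\<^sup>(\<^sup>d\<^sup>)\<close>. For a fixed \<open>m\<close>, colour the coordinates at random and project
  onto the characters with exactly one support point in each of \<open>m\<close> blocks; the projection costs
  only a power of \<open>d\<close>, since it extracts linear coefficients of polynomials in the noise parameter
  on \<open>[0, 1]\<close>. The projected function is \<open>m\<close>-linear in the blocks, so the argument of
  Bohnenblust-Hille applies pointwise in the remaining variables with exponent
  \<open>p = 2 m / (m + 1)\<close>, and hypercontractivity replaces \<open>L\<^sup>p\<close> means by \<open>L\<^sup>2\<close> means at the cost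
  \<open>(4 q)\<^sup>d\<^sup>/\<^sup>m\<close>. Finally \<open>m\<close> tends to infinity.
\<close>

section \<open>Fourier analysis on the cube\<close>

text \<open>Only the d-th root of the Sidon constant matters, so factors e^(o(d)) are free, and this
  fixes the form of the argument. Treating all d variables as blocks (m = d) would lose d^(5 d) and
  (4 q)^d, far too much. With m fixed, the losses are a constant depending on m, the power d^(5 m),
  and (4 q)^(d/m). The last is the only one exponential in d; its d-th root (4 q)^(1/m) tends to 1
  once m grows after N. The gain sqrt N comes from the Hoelder step over the block parts of the
  multi-indices. There are at most n^m of them, with n = N (q - 1), and Hoelder from exponent p to
  exponent 1 costs their number to the power (m - 1)/(2 m), that is n^((m - 1)/2), where
  Cauchy-Schwarz would cost n^(m/2). The missing half power, after the d-th root, is N^(1/(2 d)),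
  hence e^(1/(2 \<tau>)). The other d - m support points are handled by Cauchy-Schwarz. Since
  constants to the power d/m are harmless, a crude bound between fourth and second moments replaces
  sharp hypercontractivity. The cube is never written as a product: variables are separated by
  multiplying chosen coordinates by an independent point.\<close>

definition mean :: "nat \<Rightarrow> nat \<Rightarrow> ((nat \<Rightarrow> complex) \<Rightarrow> 'a::field_char_0) \<Rightarrow> 'a" where
  "mean q N F = (\<Sum>x\<in>cube q N. F x) / of_nat q ^ N"

definition trig_poly ::
  "nat \<Rightarrow> (nat \<Rightarrow> nat) set \<Rightarrow> ((nat \<Rightarrow> nat) \<Rightarrow> complex) \<Rightarrow> (nat \<Rightarrow> complex) \<Rightarrow> complex" where
  "trig_poly N A a x = (\<Sum>\<alpha>\<in>A. a \<alpha> * monomial N \<alpha> x)"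

definition primitive_root :: "nat \<Rightarrow> complex" where
  "primitive_root q = exp (2 * of_real pi * \<i> / of_nat q)"

text \<open>A group action on the cube with all monomials as eigenfunctions. It serves both to show
  that means vanish and to introduce a second, independent set of variables on the coordinates in
  \<open>U\<close>.\<close>

definition rotate_on :: "nat set \<Rightarrow> (nat \<Rightarrow> complex) \<Rightarrow> (nat \<Rightarrow> complex) \<Rightarrow> nat \<Rightarrow> complex" where
  "rotate_on U y x = (\<lambda>j. if j \<in> U then x j * y j else x j)"

text \<open>Exponents off \<open>U\<close> become 0 instead of being removed, so the result is again
  a multi-index on \<open>{1..N}\<close> and all orthogonality relations apply to it
  unchanged.\<close>

definition restr :: "nat \<Rightarrow> nat set \<Rightarrow> (nat \<Rightarrow> nat) \<Rightarrow> nat \<Rightarrow> nat" where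
  "restr N U \<alpha> = (\<lambda>j\<in>{1..N}. if j \<in> U then \<alpha> j else 0)"

lemma roots_unity_eq:
  assumes "q \<ge> 1"
  shows "roots_unity q = {z. z ^ q = 1}"
proof -
  have "exp (2 * of_real pi * \<i> / of_nat q) ^ k = exp (2 * of_real pi * \<i> * of_nat k / of_nat q)" for k
    by (simp flip: exp_of_nat_mult add: mult_ac)
  then show ?thesis
    using complex_roots_unity[OF assms] by (auto simp: roots_unity_def)
qed

lemma card_roots_unity_set: "q \<ge> 1 \<Longrightarrow> card (roots_unity q) = q"
  using card_roots_unity_eq[of q] by (simp add: roots_unity_eq)

lemma finite_roots_unity_set [simp]: "finite (roots_unity q)"
  by (simp add: roots_unity_def)

lemma root_unity_mult:
  "q \<ge> 1 \<Longrightarrow> z \<in> roots_unity q \<Longrightarrow> w \<in> roots_unity q \<Longrightarrow> z * w \<in> roots_unity q"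
  by (simp add: roots_unity_eq power_mult_distrib)

lemma root_unity_cnj:
  "q \<ge> 1 \<Longrightarrow> z \<in> roots_unity q \<Longrightarrow> cnj z \<in> roots_unity q"
  by (simp add: roots_unity_eq flip: complex_cnj_power)

lemma one_root_unity [simp]: "q \<ge> 1 \<Longrightarrow> 1 \<in> roots_unity q"
  by (simp add: roots_unity_eq)

lemma norm_root_unity:
  assumes "z \<in> roots_unity q" shows "cmod z = 1"
proof (cases "q \<ge> 1")
  case True
  then have "cmod z ^ q = 1"
    using assms by (simp add: roots_unity_eq flip: norm_power)
  then show ?thesis
    using True power_eq_1_iff[of "cmod z" q] by simp
qed (use assms in \<open>auto simp: roots_unity_def\<close>)

lemma root_unity_mult_cnj: "z \<in> roots_unity q \<Longrightarrow> z * cnj z = 1"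
  using norm_root_unity[of z q] by (simp add: complex_norm_square[symmetric])

lemma root_unity_eq_iff_mult_cnj:
  assumes "z \<in> roots_unity q" "w \<in> roots_unity q"
  shows "z * cnj w = 1 \<longleftrightarrow> z = w"
  by (metis assms(2) mult.assoc mult.commute mult.right_neutral root_unity_mult_cnj)

lemma primitive_root_in [simp]: "q \<ge> 1 \<Longrightarrow> primitive_root q \<in> roots_unity q"
  by (auto simp: roots_unity_eq primitive_root_def simp flip: exp_of_nat_mult)

lemma primitive_root_power_eq_iff:
  assumes "a < q" "b < q"
  shows "primitive_root q ^ a = primitive_root q ^ b \<longleftrightarrow> a = b"
proof -
  have "primitive_root q ^ k = exp (2 * of_real pi * \<i> * of_nat k / of_nat q)" for k
    by (simp add: primitive_root_def mult_ac flip: exp_of_nat_mult)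
  then show ?thesis
    using complex_root_unity_eq[of q a b] assms by simp
qed

lemma bij_betw_mult_root_unity:
  assumes "q \<ge> 1" "w \<in> roots_unity q"
  shows "bij_betw (\<lambda>z. z * w) (roots_unity q) (roots_unity q)"
proof (rule bij_betwI[where g = "\<lambda>z. z * cnj w"])
  show "z * w * cnj w = z" for z
    using root_unity_mult_cnj[OF assms(2)] by (simp add: mult.assoc)
  show "z * cnj w * w = z" for z
    using root_unity_mult_cnj[OF assms(2)] by (simp add: mult.assoc mult.commute[of "cnj w"])
qed (use assms root_unity_mult root_unity_cnj in auto)

text \<open>For a \<noteq> b, multiplication by the primitive root permutes the summation set and
  multiplies the sum by a number other than 1. The conjugate stands for the inverse, so that
  exponents stay natural numbers.\<close>

lemma sum_root_unity_powers:
  assumes "a < q" "b < q"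
  shows "(\<Sum>z\<in>roots_unity q. z ^ a * cnj z ^ b) = (if a = b then of_nat q else 0)"
proof (cases "a = b")
  case True
  have "z ^ b * cnj z ^ b = 1" if "z \<in> roots_unity q" for z
    using root_unity_mult_cnj[OF that] by (simp flip: power_mult_distrib)
  then show ?thesis
    using True assms card_roots_unity_set[of q] by simp
next
  case False
  define w where "w = primitive_root q"
  have q: "q \<ge> 1" and w: "w \<in> roots_unity q" using assms by (auto simp: w_def)
  let ?s = "\<Sum>z\<in>roots_unity q. z ^ a * cnj z ^ b"
  have "?s = (\<Sum>z\<in>roots_unity q. (z * w) ^ a * cnj (z * w) ^ b)"
    by (rule sum.reindex_bij_betw[OF bij_betw_mult_root_unity[OF q w], symmetric])
  also have "\<dots> = (w ^ a * cnj w ^ b) * ?s"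
    by (simp add: sum_distrib_left power_mult_distrib mult_ac)
  finally have "(1 - w ^ a * cnj w ^ b) * ?s = 0"
    by (simp add: algebra_simps)
  moreover have "w ^ a * cnj w ^ b \<noteq> 1"
  proof
    assume *: "w ^ a * cnj w ^ b = 1"
    have "w ^ b = w ^ a * (cnj w ^ b * w ^ b)"
      using * by (simp flip: mult.assoc)
    also have "cnj w ^ b * w ^ b = 1"
      using root_unity_mult_cnj[OF w] by (simp add: mult.commute flip: power_mult_distrib)
    finally show False
      using False assms primitive_root_power_eq_iff[of a q b] by (simp add: w_def)
  qed
  ultimately show ?thesis using False by simp
qed

text \<open>The dual orthogonality, summed over exponents: a geometric sum whose ratio
  \<open>z * cnj w\<close> is itself a q-th root of unity.\<close>

lemma sum_powers_root_unity:
  assumes "q \<ge> 1" "z \<in> roots_unity q" "w \<in> roots_unity q"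
  shows "(\<Sum>k\<in>{0..<q}. z ^ k * cnj w ^ k) = (if z = w then of_nat q else 0)"
proof -
  have eq: "(\<Sum>k\<in>{0..<q}. z ^ k * cnj w ^ k) = (\<Sum>k<q. (z * cnj w) ^ k)"
    by (simp add: power_mult_distrib atLeast0LessThan)
  have "(z * cnj w) ^ q = 1"
    using assms root_unity_mult[OF assms(1,2) root_unity_cnj] by (simp add: roots_unity_eq)
  then show ?thesis
    unfolding eq using root_unity_eq_iff_mult_cnj[OF assms(2,3)] sum_gp_strict[of "z * cnj w" q] by auto
qed

section \<open>Orthogonality of monomials and Fourier inversion\<close>

lemma finite_cube [simp]: "finite (cube q N)"
  by (auto simp: cube_def intro: finite_PiE)

lemma card_cube: "q \<ge> 1 \<Longrightarrow> card (cube q N) = q ^ N"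
  by (simp add: cube_def card_PiE card_roots_unity_set)

lemma finite_multi_indices [simp]: "finite (multi_indices q N)"
  by (auto simp: multi_indices_def intro: finite_PiE)

lemma ones_in_cube: "q \<ge> 1 \<Longrightarrow> (\<lambda>j\<in>{1..N}. 1) \<in> cube q N"
  by (auto simp: cube_def)

lemma cube_nonempty: "q \<ge> 1 \<Longrightarrow> cube q N \<noteq> {}"
  using ones_in_cube by blast

lemma cubeD: "x \<in> cube q N \<Longrightarrow> j \<in> {1..N} \<Longrightarrow> x j \<in> roots_unity q"
  by (auto simp: cube_def)

lemma multi_indexD: "\<alpha> \<in> multi_indices q N \<Longrightarrow> j \<in> {1..N} \<Longrightarrow> \<alpha> j < q"
  by (auto simp: multi_indices_def)

lemma multi_index_eqI:
  assumes "\<alpha> \<in> multi_indices q N" "\<beta> \<in> multi_indices q N" "\<And>j. j \<in> {1..N} \<Longrightarrow> \<alpha> j = \<beta> j"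
  shows "\<alpha> = \<beta>"
  using assms unfolding multi_indices_def by (rule PiE_ext)

lemma norm_monomial: "x \<in> cube q N \<Longrightarrow> cmod (monomial N \<alpha> x) = 1"
  by (simp add: monomial_def norm_power norm_root_unity[OF cubeD] flip: prod_norm)

lemma sup_norm_ge: "x \<in> cube q N \<Longrightarrow> cmod (f x) \<le> sup_norm q N f"
  by (simp add: sup_norm_def)

lemma sup_norm_le:
  "q \<ge> 1 \<Longrightarrow> (\<And>x. x \<in> cube q N \<Longrightarrow> cmod (f x) \<le> S) \<Longrightarrow> sup_norm q N f \<le> S"
  by (simp add: sup_norm_def cube_nonempty)

lemma sum_monomial_cube:
  assumes "\<alpha> \<in> multi_indices q N" "\<beta> \<in> multi_indices q N"
  shows "(\<Sum>x\<in>cube q N. monomial N \<alpha> x * cnj (monomial N \<beta> x)) = (if \<alpha> = \<beta> then of_nat q ^ N else 0)"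
proof -
  have "(\<Sum>x\<in>cube q N. monomial N \<alpha> x * cnj (monomial N \<beta> x)) =
      (\<Sum>x\<in>cube q N. \<Prod>j\<in>{1..N}. x j ^ \<alpha> j * cnj (x j) ^ \<beta> j)"
    by (simp add: monomial_def prod.distrib)
  also have "\<dots> = (\<Prod>j\<in>{1..N}. \<Sum>z\<in>roots_unity q. z ^ \<alpha> j * cnj z ^ \<beta> j)"
    unfolding cube_def by (rule prod_sum_PiE[symmetric]) auto
  also have "\<dots> = (\<Prod>j\<in>{1..N}. if \<alpha> j = \<beta> j then of_nat q else 0)"
    using assms by (intro prod.cong refl sum_root_unity_powers) (auto dest: multi_indexD)
  also have "\<dots> = (if \<alpha> = \<beta> then of_nat q ^ N else 0)"
  proof (cases "\<alpha> = \<beta>")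
    case False
    then obtain j where "j \<in> {1..N}" "\<alpha> j \<noteq> \<beta> j"
      using multi_index_eqI[OF assms] by blast
    then show ?thesis using False by (auto intro!: prod_zero bexI[of _ j])
  qed simp
  finally show ?thesis .
qed

lemma sum_monomial_multi_indices:
  assumes "q \<ge> 1" "x \<in> cube q N" "y \<in> cube q N"
  shows "(\<Sum>\<alpha>\<in>multi_indices q N. monomial N \<alpha> x * cnj (monomial N \<alpha> y)) = (if x = y then of_nat q ^ N else 0)"
proof -
  have "(\<Sum>\<alpha>\<in>multi_indices q N. monomial N \<alpha> x * cnj (monomial N \<alpha> y)) =
      (\<Sum>\<alpha>\<in>multi_indices q N. \<Prod>j\<in>{1..N}. x j ^ \<alpha> j * cnj (y j) ^ \<alpha> j)"
    by (simp add: monomial_def prod.distrib)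
  also have "\<dots> = (\<Prod>j\<in>{1..N}. \<Sum>k\<in>{0..<q}. x j ^ k * cnj (y j) ^ k)"
    unfolding multi_indices_def by (rule prod_sum_PiE[symmetric]) auto
  also have "\<dots> = (\<Prod>j\<in>{1..N}. if x j = y j then of_nat q else 0)"
    using assms by (intro prod.cong refl sum_powers_root_unity) (auto dest: cubeD)
  also have "\<dots> = (if x = y then of_nat q ^ N else 0)"
  proof (cases "x = y")
    case False
    then obtain j where "j \<in> {1..N}" "x j \<noteq> y j"
      using assms PiE_ext[of x "{1..N}" "\<lambda>_. roots_unity q" y] unfolding cube_def by blast
    then show ?thesis using False by (auto intro!: prod_zero bexI[of _ j])
  qed simp
  finally show ?thesis .
qed

lemma fourier_inversion:
  assumes "q \<ge> 1" "x \<in> cube q N"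
  shows "f x = trig_poly N (multi_indices q N) (fourier_coeff q N f) x"
proof -
  have "trig_poly N (multi_indices q N) (fourier_coeff q N f) x =
     (\<Sum>\<alpha>\<in>multi_indices q N. \<Sum>y\<in>cube q N. f y * (monomial N \<alpha> x * cnj (monomial N \<alpha> y))) / of_nat q ^ N"
    unfolding trig_poly_def fourier_coeff_def sum_divide_distrib sum_distrib_right
    by (intro sum.cong refl) simp
  also have "\<dots> = (\<Sum>y\<in>cube q N. f y * (\<Sum>\<alpha>\<in>multi_indices q N. monomial N \<alpha> x * cnj (monomial N \<alpha> y))) / of_nat q ^ N"
    by (subst sum.swap) (simp add: sum_distrib_left)
  also have "(\<Sum>y\<in>cube q N. f y * (\<Sum>\<alpha>\<in>multi_indices q N. monomial N \<alpha> x * cnj (monomial N \<alpha> y))) =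
      (\<Sum>y\<in>cube q N. f y * (if x = y then of_nat q ^ N else 0))"
    using assms by (intro sum.cong refl) (simp add: sum_monomial_multi_indices)
  also have "\<dots> = (\<Sum>y\<in>cube q N. if y = x then f y * of_nat q ^ N else 0)"
    by (intro sum.cong) auto
  finally show ?thesis using assms by (simp add: sum.delta)
qed

lemma fourier_coeff_trig_poly:
  assumes "q \<ge> 1" "A \<subseteq> multi_indices q N" "\<beta> \<in> multi_indices q N"
  shows "fourier_coeff q N (trig_poly N A a) \<beta> = (if \<beta> \<in> A then a \<beta> else 0)"
proof -
  have fin: "finite A" using assms(2) finite_multi_indices finite_subset by blast
  have "fourier_coeff q N (trig_poly N A a) \<beta> =
      (\<Sum>x\<in>cube q N. \<Sum>\<alpha>\<in>A. a \<alpha> * (monomial N \<alpha> x * cnj (monomial N \<beta> x))) / of_nat q ^ N"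
    unfolding trig_poly_def fourier_coeff_def sum_distrib_right by (simp only: mult.assoc)
  also have "\<dots> = (\<Sum>\<alpha>\<in>A. a \<alpha> * (\<Sum>x\<in>cube q N. monomial N \<alpha> x * cnj (monomial N \<beta> x))) / of_nat q ^ N"
    by (subst sum.swap) (simp add: sum_distrib_left)
  also have "(\<Sum>\<alpha>\<in>A. a \<alpha> * (\<Sum>x\<in>cube q N. monomial N \<alpha> x * cnj (monomial N \<beta> x))) =
      (\<Sum>\<alpha>\<in>A. if \<alpha> = \<beta> then a \<alpha> * of_nat q ^ N else 0)"
    using assms by (intro sum.cong refl) (auto simp: sum_monomial_cube subset_iff)
  finally show ?thesis using assms fin by (simp add: sum.delta)
qed

section \<open>Normalised means and Parseval's identity\<close>

lemma mean_add: "mean q N (\<lambda>x. F x + G x) = mean q N F + mean q N G"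
  by (simp add: mean_def sum.distrib add_divide_distrib)

lemma mean_sum: "mean q N (\<lambda>x. \<Sum>i\<in>I. F i x) = (\<Sum>i\<in>I. mean q N (F i))"
  by (simp add: mean_def sum.swap[of _ I] sum_divide_distrib)

lemma mean_cmult: "mean q N (\<lambda>x. c * F x) = c * mean q N F"
  by (simp add: mean_def flip: sum_distrib_left)

lemma mean_const: "q \<ge> 1 \<Longrightarrow> mean q N (\<lambda>x. c) = c"
  by (simp add: mean_def card_cube)

lemma mean_cong: "(\<And>x. x \<in> cube q N \<Longrightarrow> F x = G x) \<Longrightarrow> mean q N F = mean q N G"
  by (simp add: mean_def)

lemma mean_mono:
  fixes F G :: "_ \<Rightarrow> real"
  shows "(\<And>x. x \<in> cube q N \<Longrightarrow> F x \<le> G x) \<Longrightarrow> mean q N F \<le> mean q N G"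
  by (simp add: mean_def divide_right_mono sum_mono)

lemma mean_nonneg:
  fixes F :: "_ \<Rightarrow> real"
  shows "(\<And>x. x \<in> cube q N \<Longrightarrow> 0 \<le> F x) \<Longrightarrow> 0 \<le> mean q N F"
  by (simp add: mean_def sum_nonneg)

lemma mean_Re: "mean q N (\<lambda>x. Re (F x)) = Re (mean q N F)"
proof -
  have "of_nat q ^ N = complex_of_real (real q ^ N)" by simp
  then show ?thesis unfolding mean_def by (simp only: Re_divide_of_real Re_sum)
qed

lemma mean_of_real: "mean q N (\<lambda>x. complex_of_real (F x)) = complex_of_real (mean q N F)"
  by (simp add: mean_def)

lemma mean_Cauchy_Schwarz:
  fixes F G :: "_ \<Rightarrow> real"
  shows "(mean q N (\<lambda>x. F x * G x))\<^sup>2 \<le> mean q N (\<lambda>x. (F x)\<^sup>2) * mean q N (\<lambda>x. (G x)\<^sup>2)"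
  using Cauchy_Schwarz_ineq_sum[of F G "cube q N"]
  by (simp add: mean_def power_divide power2_eq_square divide_right_mono)

lemma parseval:
  assumes "q \<ge> 1" "A \<subseteq> multi_indices q N"
  shows "mean q N (\<lambda>x. (cmod (trig_poly N A a x))\<^sup>2) = (\<Sum>\<alpha>\<in>A. (cmod (a \<alpha>))\<^sup>2)"
proof -
  have fin: "finite A" using assms(2) finite_multi_indices finite_subset by blast
  have "complex_of_real (mean q N (\<lambda>x. (cmod (trig_poly N A a x))\<^sup>2)) =
      mean q N (\<lambda>x. trig_poly N A a x * cnj (trig_poly N A a x))"
    unfolding mean_of_real[symmetric] complex_norm_square[symmetric] by simp
  also have "\<dots> = mean q N (\<lambda>x. \<Sum>\<beta>\<in>A. cnj (a \<beta>) * (trig_poly N A a x * cnj (monomial N \<beta> x)))"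
    by (intro mean_cong, subst (2) trig_poly_def) (simp add: sum_distrib_left mult_ac)
  also have "\<dots> = (\<Sum>\<beta>\<in>A. cnj (a \<beta>) * fourier_coeff q N (trig_poly N A a) \<beta>)"
    by (simp add: mean_sum mean_cmult) (simp add: mean_def fourier_coeff_def)
  also have "\<dots> = (\<Sum>\<beta>\<in>A. cnj (a \<beta>) * a \<beta>)"
    using assms by (intro sum.cong refl) (auto simp: fourier_coeff_trig_poly subset_iff)
  also have "\<dots> = complex_of_real (\<Sum>\<alpha>\<in>A. (cmod (a \<alpha>))\<^sup>2)"
    unfolding of_real_sum complex_norm_square by (simp add: mult.commute)
  finally show ?thesis unfolding of_real_eq_iff .
qed

section \<open>Rotations of coordinates\<close>

lemma rotate_on_in_cube:
  assumes "q \<ge> 1" "x \<in> cube q N" "y \<in> cube q N" "U \<subseteq> {1..N}"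
  shows "rotate_on U y x \<in> cube q N"
  using assms unfolding cube_def rotate_on_def PiE_iff extensional_def
  by (auto intro: root_unity_mult)

lemma restr_in_multi_indices:
  assumes "q \<ge> 1" "\<alpha> \<in> multi_indices q N"
  shows "restr N U \<alpha> \<in> multi_indices q N"
  using assms by (auto simp: restr_def multi_indices_def)


lemma index_supp_restr: "index_supp N (restr N U \<alpha>) = index_supp N \<alpha> \<inter> U"
  by (auto simp: index_supp_def restr_def)

lemma restr_restr: "restr N V (restr N U \<alpha>) = restr N (U \<inter> V) \<alpha>"
  by (auto simp: restr_def)

lemma monomial_rotate_on:
  "monomial N \<alpha> (rotate_on U y x) = monomial N \<alpha> x * monomial N (restr N U \<alpha>) y"
  unfolding monomial_def prod.distrib[symmetric]
  by (rule prod.cong) (auto simp: rotate_on_def restr_def power_mult_distrib)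

lemma mean_rotate_on:
  assumes "q \<ge> 1" "w \<in> cube q N" "U \<subseteq> {1..N}"
  shows "mean q N (\<lambda>x. F (rotate_on U w x)) = mean q N F"
proof -
  have "bij_betw (rotate_on U w) (cube q N) (cube q N)"
  proof (rule bij_betwI[where g = "rotate_on U (\<lambda>j\<in>{1..N}. cnj (w j))"])
    have c: "(\<lambda>j\<in>{1..N}. cnj (w j)) \<in> cube q N"
      using assms by (auto simp: cube_def intro: root_unity_cnj)
    show "rotate_on U w \<in> cube q N \<rightarrow> cube q N"
      and "rotate_on U (\<lambda>j\<in>{1..N}. cnj (w j)) \<in> cube q N \<rightarrow> cube q N"
      using rotate_on_in_cube[OF assms(1) _ _ assms(3)] assms(2) c by auto
    have *: "w j * cnj (w j) = 1" "cnj (w j) * w j = 1" "Suc 0 \<le> j \<and> j \<le> N" if "j \<in> U" for j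
      using that assms root_unity_mult_cnj[OF cubeD[OF assms(2), of j]] by (auto simp: mult.commute)
    show "rotate_on U (\<lambda>j\<in>{1..N}. cnj (w j)) (rotate_on U w x) = x"
      and "rotate_on U w (rotate_on U (\<lambda>j\<in>{1..N}. cnj (w j)) x) = x" for x
      by (auto simp: rotate_on_def fun_eq_iff mult.assoc *)
  qed
  then show ?thesis
    unfolding mean_def using sum.reindex_bij_betw[of _ "cube q N" "cube q N" F] by simp
qed

section \<open>Hypercontractivity and the Blei inequality\<close>

text \<open>Expand the square of F + H + 2 R with R = Re (cnj f * h). The terms R^2 and H R are
  absorbed by R^2 \<le> F H and 4 H R \<le> 2 H^2 + 2 R^2. Only F R, linear in \<open>h\<close>, is
  kept exactly, because its mean will vanish.\<close>

lemma norm_add_power4_le: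
  fixes f h :: complex
  shows "cmod (f + h) ^ 4 \<le> cmod f ^ 4 + 8 * ((cmod f)\<^sup>2 * (cmod h)\<^sup>2) + 3 * cmod h ^ 4
           + 4 * Re (of_real ((cmod f)\<^sup>2) * cnj f * h)"
proof -
  define F H R where "F = (cmod f)\<^sup>2" and "H = (cmod h)\<^sup>2" and "R = Re (cnj f * h)"
  have sq: "(cmod (f + h))\<^sup>2 = F + H + 2 * R"
    unfolding F_def H_def R_def cmod_power2 by (simp add: power2_eq_square algebra_simps)
  have "Re (of_real F * cnj f * h) = F * R"
    unfolding R_def mult.assoc by simp
  moreover have "R\<^sup>2 \<le> F * H"
  proof -
    have "\<bar>R\<bar> \<le> cmod f * cmod h"
      using abs_Re_le_cmod[of "cnj f * h"] by (simp add: R_def norm_mult)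
    then have "\<bar>R\<bar>\<^sup>2 \<le> (cmod f * cmod h)\<^sup>2" by (intro power_mono) auto
    then show ?thesis by (simp add: F_def H_def power_mult_distrib)
  qed
  moreover have "4 * (H * R) \<le> 2 * H\<^sup>2 + 2 * R\<^sup>2"
    using zero_le_power2[of "H - R"] by (simp add: power2_diff algebra_simps)
  moreover have "(F + H + 2 * R)\<^sup>2 = F\<^sup>2 + H\<^sup>2 + 2 * (F * H) + 4 * R\<^sup>2 + 4 * (F * R) + 4 * (H * R)"
    by (simp add: power2_eq_square algebra_simps)
  moreover have "cmod f ^ 4 = F\<^sup>2" "cmod h ^ 4 = H\<^sup>2"
    by (simp_all add: F_def H_def)
  moreover have "cmod (f + h) ^ 4 = (F + H + 2 * R)\<^sup>2"
    unfolding sq[symmetric] by simp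
  ultimately show ?thesis
    unfolding F_def[symmetric] H_def[symmetric] by linarith
qed

lemma mean_eq_0_if_rotate:
  assumes "q \<ge> 1" "w \<in> cube q N" "U \<subseteq> {1..N}" "c \<noteq> 1"
    and "\<And>x. x \<in> cube q N \<Longrightarrow> G (rotate_on U w x) = c * G x"
  shows "mean q N G = 0"
proof -
  have "mean q N G = mean q N (\<lambda>x. G (rotate_on U w x))"
    using mean_rotate_on[OF assms(1-3), of G] by simp
  also have "\<dots> = mean q N (\<lambda>x. c * G x)"
    using assms(5) by (rule mean_cong)
  finally show ?thesis using assms(4) by (simp add: mean_cmult)
qed

text \<open>Fixing the values of the exponents outside \<open>S\<close>, instead of assuming that they vanish
  there, lets the induction on \<open>S\<close> pass to subsets of \<open>A\<close> without shifting exponents.\<close>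

lemma hypercontractivity_aux:
  assumes "q \<ge> 1" "finite S" "S \<subseteq> {1..N}" "A \<subseteq> multi_indices q N"
    and "\<And>\<alpha> \<beta> j. \<alpha> \<in> A \<Longrightarrow> \<beta> \<in> A \<Longrightarrow> j \<in> {1..N} - S \<Longrightarrow> \<alpha> j = \<beta> j"
  shows "mean q N (\<lambda>x. cmod (trig_poly N A a x) ^ 4)
    \<le> (\<Sum>\<alpha>\<in>A. (4 * real q) ^ card (index_supp N \<alpha> \<inter> S) * (cmod (a \<alpha>))\<^sup>2)\<^sup>2"
  using assms(2-5)
proof (induction S arbitrary: A rule: finite_induct)
  case empty
  have "\<alpha> = \<beta>" if "\<alpha> \<in> A" "\<beta> \<in> A" for \<alpha> \<beta>
    using that empty by (intro multi_index_eqI[of \<alpha> q N \<beta>]) auto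
  then consider "A = {}" | \<alpha> where "A = {\<alpha>}" by blast
  then show ?case
  proof cases
    case 1
    then show ?thesis by (simp add: trig_poly_def mean_def)
  next
    case 2
    have "mean q N (\<lambda>x. cmod (trig_poly N A a x) ^ 4) = mean q N (\<lambda>x. cmod (a \<alpha>) ^ 4)"
      by (rule mean_cong) (simp add: 2 trig_poly_def norm_mult norm_monomial)
    then show ?thesis using 2 assms(1) by (simp add: mean_const)
  qed
next
  case (insert j S)
  define L where "L = 4 * real q"
  \<comment> \<open>Splitting by the exponent at \<open>j\<close>: \<open>P 0\<close> does not
    depend on the coordinate j, while every part \<open>P c\<close> of \<open>h\<close> is
    multiplied by a nontrivial root of unity when that coordinate is rotated.\<close>
  define B where "B c = {\<alpha>\<in>A. \<alpha> j = c}" for c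
  define P where "P c = trig_poly N (B c) a" for c
  define W where "W c = (\<Sum>\<alpha>\<in>B c. L ^ card (index_supp N \<alpha> \<inter> S) * (cmod (a \<alpha>))\<^sup>2)" for c
  define h where "h x = (\<Sum>c\<in>{1..<q}. P c x)" for x
  define V where "V = (\<Sum>c\<in>{1..<q}. W c)"
  have finA: "finite A" using insert.prems(2) finite_multi_indices finite_subset by blast
  have j: "j \<in> {1..N}" using insert.prems(1) by simp
  have W0: "W c \<ge> 0" for c unfolding W_def L_def by (intro sum_nonneg) auto
  have V0: "V \<ge> 0" unfolding V_def using W0 by (intro sum_nonneg) auto
  have val: "\<alpha> j \<in> {0..<q}" if "\<alpha> \<in> A" for \<alpha>
    using multi_indexD[of \<alpha> q N j] that insert.prems(2) j by auto
  have split0: "{0..<q} = insert 0 {1..<q}" using assms(1) by auto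
  have group: "(\<Sum>\<alpha>\<in>A. g \<alpha>) = (\<Sum>\<alpha>\<in>B 0. g \<alpha>) + (\<Sum>c\<in>{1..<q}. \<Sum>\<alpha>\<in>B c. g \<alpha>)" for g :: "_ \<Rightarrow> 'z::comm_monoid_add"
  proof -
    have "(\<Sum>\<alpha>\<in>A. g \<alpha>) = (\<Sum>c\<in>{0..<q}. \<Sum>\<alpha>\<in>B c. g \<alpha>)"
      unfolding B_def by (rule sum.group[symmetric]) (use finA val in auto)
    then show ?thesis unfolding split0 by simp
  qed
  have poly: "trig_poly N A a x = P 0 x + h x" for x
    unfolding P_def h_def trig_poly_def by (rule group)
  have IH: "mean q N (\<lambda>x. cmod (P c x) ^ 4) \<le> (W c)\<^sup>2" for c
    unfolding P_def W_def L_def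
  proof (intro insert.IH)
    show "\<alpha> i = \<beta> i" if "\<alpha> \<in> B c" "\<beta> \<in> B c" "i \<in> {1..N} - S" for \<alpha> \<beta> i
      using that insert.prems(3)[of \<alpha> \<beta> i] by (cases "i = j") (auto simp: B_def)
  qed (use insert.prems in \<open>auto simp: B_def\<close>)
  have mixed: "mean q N (\<lambda>x. (cmod (P c x))\<^sup>2 * (cmod (P c' x))\<^sup>2) \<le> W c * W c'" for c c'
  proof (rule power2_le_imp_le)
    have "(mean q N (\<lambda>x. (cmod (P c x))\<^sup>2 * (cmod (P c' x))\<^sup>2))\<^sup>2
        \<le> mean q N (\<lambda>x. cmod (P c x) ^ 4) * mean q N (\<lambda>x. cmod (P c' x) ^ 4)"
      using mean_Cauchy_Schwarz[of q N "\<lambda>x. (cmod (P c x))\<^sup>2" "\<lambda>x. (cmod (P c' x))\<^sup>2"] by simp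
    also have "\<dots> \<le> (W c)\<^sup>2 * (W c')\<^sup>2"
      by (intro mult_mono IH mean_nonneg) auto
    finally show "(mean q N (\<lambda>x. (cmod (P c x))\<^sup>2 * (cmod (P c' x))\<^sup>2))\<^sup>2 \<le> (W c * W c')\<^sup>2"
      by (simp add: power_mult_distrib)
  qed (use W0 in simp)
  have h_le: "(cmod (h x))\<^sup>2 \<le> q * (\<Sum>c\<in>{1..<q}. (cmod (P c x))\<^sup>2)" for x
  proof -
    have "(cmod (h x))\<^sup>2 \<le> (\<Sum>c\<in>{1..<q}. cmod (P c x) * 1)\<^sup>2"
      unfolding h_def by (intro power_mono) (auto intro: norm_sum)
    also have "\<dots> \<le> (\<Sum>c\<in>{1..<q}. (cmod (P c x))\<^sup>2) * (\<Sum>c\<in>{1..<q}. 1\<^sup>2)"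
      by (rule Cauchy_Schwarz_ineq_sum)
    also have "\<dots> \<le> (\<Sum>c\<in>{1..<q}. (cmod (P c x))\<^sup>2) * q"
      by (intro mult_left_mono sum_nonneg) auto
    finally show ?thesis by (simp add: mult.commute)
  qed
  have fh: "mean q N (\<lambda>x. (cmod (P 0 x))\<^sup>2 * (cmod (h x))\<^sup>2) \<le> q * (W 0 * V)"
  proof -
    have "mean q N (\<lambda>x. (cmod (P 0 x))\<^sup>2 * (cmod (h x))\<^sup>2)
        \<le> mean q N (\<lambda>x. q * (\<Sum>c\<in>{1..<q}. (cmod (P 0 x))\<^sup>2 * (cmod (P c x))\<^sup>2))"
    proof (rule mean_mono)
      fix x
      show "(cmod (P 0 x))\<^sup>2 * (cmod (h x))\<^sup>2 \<le> q * (\<Sum>c\<in>{1..<q}. (cmod (P 0 x))\<^sup>2 * (cmod (P c x))\<^sup>2)"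
        using mult_left_mono[OF h_le[of x], of "(cmod (P 0 x))\<^sup>2"]
        by (simp add: sum_distrib_left[symmetric] mult.left_commute)
    qed
    also have "\<dots> = q * (\<Sum>c\<in>{1..<q}. mean q N (\<lambda>x. (cmod (P 0 x))\<^sup>2 * (cmod (P c x))\<^sup>2))"
      by (simp only: mean_cmult mean_sum)
    also have "\<dots> \<le> q * (\<Sum>c\<in>{1..<q}. W 0 * W c)"
      by (intro mult_left_mono sum_mono mixed) auto
    finally show ?thesis by (simp add: V_def sum_distrib_left)
  qed
  have hh: "mean q N (\<lambda>x. cmod (h x) ^ 4) \<le> q\<^sup>2 * V\<^sup>2"
  proof -
    have "mean q N (\<lambda>x. cmod (h x) ^ 4)
        \<le> mean q N (\<lambda>x. q\<^sup>2 * (\<Sum>c\<in>{1..<q}. \<Sum>c'\<in>{1..<q}. (cmod (P c x))\<^sup>2 * (cmod (P c' x))\<^sup>2))"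
    proof (rule mean_mono)
      fix x
      have "cmod (h x) ^ 4 = ((cmod (h x))\<^sup>2)\<^sup>2" by simp
      also have "\<dots> \<le> (q * (\<Sum>c\<in>{1..<q}. (cmod (P c x))\<^sup>2))\<^sup>2"
        by (intro power_mono h_le) auto
      also have "\<dots> = q\<^sup>2 * (\<Sum>c\<in>{1..<q}. \<Sum>c'\<in>{1..<q}. (cmod (P c x))\<^sup>2 * (cmod (P c' x))\<^sup>2)"
        unfolding power_mult_distrib power2_eq_square[of "sum _ _"] sum_product by simp
      finally show "cmod (h x) ^ 4 \<le> \<dots>" .
    qed
    also have "\<dots> = q\<^sup>2 * (\<Sum>c\<in>{1..<q}. \<Sum>c'\<in>{1..<q}. mean q N (\<lambda>x. (cmod (P c x))\<^sup>2 * (cmod (P c' x))\<^sup>2))"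
      by (simp only: mean_cmult mean_sum)
    also have "\<dots> \<le> q\<^sup>2 * (\<Sum>c\<in>{1..<q}. \<Sum>c'\<in>{1..<q}. W c * W c')"
      by (intro mult_left_mono sum_mono mixed) auto
    also have "\<dots> = q\<^sup>2 * V\<^sup>2"
      by (simp add: V_def power2_eq_square sum_product)
    finally show ?thesis .
  qed
  \<comment> \<open>Rotating coordinate j by the primitive root multiplies the summand with
    \<open>P c\<close> by its c-th power, which is not 1 for 0 < c < q; an invariant mean must then
    be 0.\<close>
  have cross: "mean q N (\<lambda>x. Re (of_real ((cmod (P 0 x))\<^sup>2) * cnj (P 0 x) * h x)) = 0"
  proof -
    define w where "w = (\<lambda>i\<in>{1..N}. primitive_root q)"
    have w: "w \<in> cube q N" using assms(1) by (auto simp: w_def cube_def)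
    have rot: "P c (rotate_on {j} w x) = primitive_root q ^ c * P c x" for c x
    proof -
      have "monomial N (restr N {j} \<alpha>) w = primitive_root q ^ c" if "\<alpha> \<in> B c" for \<alpha>
      proof -
        have "monomial N (restr N {j} \<alpha>) w = (\<Prod>i\<in>{1..N}. if i = j then primitive_root q ^ c else 1)"
          unfolding monomial_def using that by (intro prod.cong) (auto simp: w_def restr_def B_def)
        then show ?thesis using j by (simp add: prod.delta)
      qed
      then show ?thesis
        by (simp add: P_def trig_poly_def monomial_rotate_on sum_distrib_left mult_ac)
    qed
    have "mean q N (\<lambda>x. of_real ((cmod (P 0 x))\<^sup>2) * cnj (P 0 x) * P c x) = 0" if "c \<in> {1..<q}" for c
      by (rule mean_eq_0_if_rotate[OF assms(1) w, of "{j}" "primitive_root q ^ c"])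
        (use that j assms(1) primitive_root_power_eq_iff[of c q 0] rot[of 0] in \<open>auto simp: rot mult_ac\<close>)
    then have "mean q N (\<lambda>x. of_real ((cmod (P 0 x))\<^sup>2) * cnj (P 0 x) * h x) = 0"
      unfolding h_def sum_distrib_left mean_sum by (intro sum.neutral) auto
    then show ?thesis unfolding mean_Re by simp
  qed
  have "mean q N (\<lambda>x. cmod (trig_poly N A a x) ^ 4) \<le>
      mean q N (\<lambda>x. cmod (P 0 x) ^ 4 + 8 * ((cmod (P 0 x))\<^sup>2 * (cmod (h x))\<^sup>2) + 3 * cmod (h x) ^ 4
        + 4 * Re (of_real ((cmod (P 0 x))\<^sup>2) * cnj (P 0 x) * h x))"
    unfolding poly by (intro mean_mono norm_add_power4_le)
  also have "\<dots> = mean q N (\<lambda>x. cmod (P 0 x) ^ 4) + 8 * mean q N (\<lambda>x. (cmod (P 0 x))\<^sup>2 * (cmod (h x))\<^sup>2)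
      + 3 * mean q N (\<lambda>x. cmod (h x) ^ 4)"
    unfolding mean_add mean_cmult cross by simp
  also have "\<dots> \<le> (W 0)\<^sup>2 + 8 * (q * (W 0 * V)) + 3 * (q\<^sup>2 * V\<^sup>2)"
    using IH[of 0] fh hh by (intro add_mono mult_left_mono) auto
  \<comment> \<open>This fixes the constant 4 q: 2 L = 8 q matches the mixed term, and L^2 = 16 q^2
    leaves room for 3 q^2.\<close>
  also have "\<dots> \<le> (W 0 + L * V)\<^sup>2"
    using zero_le_power2[of "V * q"] unfolding L_def power2_eq_square by (simp add: algebra_simps)
  also have "W 0 + L * V = (\<Sum>\<alpha>\<in>A. L ^ card (index_supp N \<alpha> \<inter> insert j S) * (cmod (a \<alpha>))\<^sup>2)"
  proof -
    have "index_supp N \<alpha> \<inter> insert j S = index_supp N \<alpha> \<inter> S" if "\<alpha> \<in> B 0" for \<alpha>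
      using that by (auto simp: B_def index_supp_def)
    moreover have "card (index_supp N \<alpha> \<inter> insert j S) = Suc (card (index_supp N \<alpha> \<inter> S))"
      if "\<alpha> \<in> B c" "c \<in> {1..<q}" for \<alpha> c
    proof -
      have "index_supp N \<alpha> \<inter> insert j S = insert j (index_supp N \<alpha> \<inter> S)"
        using that j by (auto simp: B_def index_supp_def)
      then show ?thesis using insert.hyps by simp
    qed
    ultimately show ?thesis
      unfolding group V_def W_def sum_distrib_left by (simp add: mult.assoc)
  qed
  finally show ?case unfolding L_def .
qed

lemma hypercontractivity:
  assumes "q \<ge> 1" "A \<subseteq> multi_indices q N" "\<And>\<alpha>. \<alpha> \<in> A \<Longrightarrow> card (index_supp N \<alpha>) \<le> d"
  shows "mean q N (\<lambda>x. cmod (trig_poly N A a x) ^ 4)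
    \<le> (4 * real q) ^ (2 * d) * (mean q N (\<lambda>x. (cmod (trig_poly N A a x))\<^sup>2))\<^sup>2"
proof -
  have "mean q N (\<lambda>x. cmod (trig_poly N A a x) ^ 4)
      \<le> (\<Sum>\<alpha>\<in>A. (4 * real q) ^ card (index_supp N \<alpha> \<inter> {1..N}) * (cmod (a \<alpha>))\<^sup>2)\<^sup>2"
    using assms by (intro hypercontractivity_aux) auto
  also have "\<dots> \<le> (\<Sum>\<alpha>\<in>A. (4 * real q) ^ d * (cmod (a \<alpha>))\<^sup>2)\<^sup>2"
  proof (intro power_mono sum_mono mult_right_mono power_increasing sum_nonneg)
    fix \<alpha> assume "\<alpha> \<in> A"
    have "index_supp N \<alpha> \<inter> {1..N} = index_supp N \<alpha>" by (auto simp: index_supp_def)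
    then show "card (index_supp N \<alpha> \<inter> {1..N}) \<le> d" using assms(3)[OF \<open>\<alpha> \<in> A\<close>] by simp
  qed (use assms(1) in auto)
  also have "\<dots> = (4 * real q) ^ (2 * d) * (\<Sum>\<alpha>\<in>A. (cmod (a \<alpha>))\<^sup>2)\<^sup>2"
    by (simp only: sum_distrib_left[symmetric] power_mult_distrib power_mult[symmetric] mult.commute[of d])
  finally show ?thesis unfolding parseval[OF assms(1,2)] .
qed

text \<open>Interpolation: the second moment lies between the p-th and the fourth, and the fourth is
  controlled by the second. Hoelder's inequality is carried out pointwise, as Young's inequality
  with the exponents u and v determined by u + v = 1 and p u + 4 v = 2.\<close>

lemma mean_square_le_mean_powr:
  fixes t :: "_ \<Rightarrow> real"
  assumes p: "0 < p" "p < 2" and t0: "\<And>x. x \<in> cube q N \<Longrightarrow> 0 \<le> t x"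
    and Q: "Q > 0" "mean q N (\<lambda>x. t x ^ 4) \<le> Q * (mean q N (\<lambda>x. (t x)\<^sup>2))\<^sup>2"
  shows "mean q N (\<lambda>x. (t x)\<^sup>2) powr (p / 2) \<le> Q powr ((2 - p) / 2) * mean q N (\<lambda>x. t x powr p)"
proof (cases "mean q N (\<lambda>x. (t x)\<^sup>2) = 0")
  case True
  then show ?thesis by (simp add: mean_nonneg)
next
  case False
  define \<sigma> where "\<sigma> = mean q N (\<lambda>x. (t x)\<^sup>2)"
  have \<sigma>: "\<sigma> > 0" using False mean_nonneg[of q N "\<lambda>x. (t x)\<^sup>2"] by (simp add: \<sigma>_def)
  define u v where "u = 2 / (4 - p)" and "v = (2 - p) / (4 - p)"
  have "4 - p \<noteq> 0" using p by simp
  then have uv: "u > 0" "v > 0" "u + v = 1" "v / u = (2 - p) / 2"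
    using p unfolding u_def v_def by (auto simp flip: add_divide_distrib)
  have "p * u + 4 * v = (p * 2 + 4 * (2 - p)) / (4 - p)"
    unfolding u_def v_def add_divide_distrib by simp
  also have "\<dots> = 2" using \<open>4 - p \<noteq> 0\<close> by (simp add: field_simps)
  finally have uv4: "p * u + 4 * v = 2" .
  \<comment> \<open>\<open>\<mu>\<close> scales the fourth-moment bound Q \<sigma>^2 down to
    \<sigma>, so that its share v \<sigma> can be moved to the left side; \<open>l\<close> is then
    forced by \<open>l powr u * \<mu> powr v = 1\<close>, which makes the Young product exactly
    t^2.\<close>
  define \<mu> l where "\<mu> = 1 / (Q * \<sigma>)" and "l = (Q * \<sigma>) powr (v / u)"
  have pos: "\<mu> > 0" "l > 0" using Q \<sigma> by (auto simp: \<mu>_def l_def)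
  have lm: "l powr u * \<mu> powr v = 1"
    using Q \<sigma> uv by (simp add: l_def \<mu>_def powr_powr powr_divide)
  have young: "(t x)\<^sup>2 \<le> u * (l * t x powr p) + v * (\<mu> * t x ^ 4)" if x: "x \<in> cube q N" for x
  proof (cases "t x = 0")
    case False
    then have tx: "t x > 0" using t0[OF x] by simp
    have "(l * t x powr p) powr u * (\<mu> * t x ^ 4) powr v
        = (l powr u * \<mu> powr v) * (t x powr (p * u) * t x powr (4 * v))"
      using tx pos by (simp add: powr_mult powr_powr flip: powr_numeral)
    also have "\<dots> = t x powr 2"
      unfolding lm powr_add[symmetric] uv4 by simp
    finally have "(t x)\<^sup>2 = (l * t x powr p) powr u * (\<mu> * t x ^ 4) powr v"
      using tx by (simp add: powr_numeral)
    also have "\<dots> \<le> u * (l * t x powr p) + v * (\<mu> * t x ^ 4)"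
      using uv pos tx by (intro Youngs_inequality_0) auto
    finally show ?thesis .
  qed simp
  have "\<sigma> \<le> mean q N (\<lambda>x. u * (l * t x powr p) + v * (\<mu> * t x ^ 4))"
    unfolding \<sigma>_def by (intro mean_mono young)
  also have "\<dots> = u * (l * mean q N (\<lambda>x. t x powr p)) + v * (\<mu> * mean q N (\<lambda>x. t x ^ 4))"
    by (simp only: mean_add mean_cmult)
  also have "\<dots> \<le> u * (l * mean q N (\<lambda>x. t x powr p)) + v * (\<mu> * (Q * \<sigma>\<^sup>2))"
    using Q uv pos unfolding \<sigma>_def by (intro add_mono mult_left_mono) auto
  also have "\<mu> * (Q * \<sigma>\<^sup>2) = \<sigma>" using Q \<sigma> by (simp add: \<mu>_def power2_eq_square)
  finally have "\<sigma> \<le> u * (l * mean q N (\<lambda>x. t x powr p)) + v * \<sigma>" .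
  moreover have "\<sigma> = u * \<sigma> + v * \<sigma>"
    by (simp only: distrib_right[symmetric] uv(3) mult_1)
  ultimately have "u * \<sigma> \<le> u * (l * mean q N (\<lambda>x. t x powr p))" by linarith
  then have "\<sigma> \<le> l * mean q N (\<lambda>x. t x powr p)" using uv by simp
  also have "l = Q powr ((2 - p) / 2) * \<sigma> powr ((2 - p) / 2)"
    using Q \<sigma> unfolding l_def uv(4) by (simp add: powr_mult)
  finally have "\<sigma> \<le> \<sigma> powr ((2 - p) / 2) * (Q powr ((2 - p) / 2) * mean q N (\<lambda>x. t x powr p))"
    by (simp add: mult_ac)
  moreover have "\<sigma> powr ((2 - p) / 2) * \<sigma> powr (p / 2) = \<sigma>"
    using \<sigma> unfolding powr_add[symmetric] by (simp flip: add_divide_distrib)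
  ultimately have "\<sigma> powr ((2 - p) / 2) * \<sigma> powr (p / 2)
      \<le> \<sigma> powr ((2 - p) / 2) * (Q powr ((2 - p) / 2) * mean q N (\<lambda>x. t x powr p))"
    by linarith
  then show ?thesis
    unfolding \<sigma>_def[symmetric] using \<sigma> by (simp add: mult_le_cancel_left_pos)
qed

text \<open>Used in two ways: with p = 1 for polynomials of the fixed degree m, and with p = 2 m /
  (m + 1) for degree d, where 2 - p is small enough to make the loss (4 q)^(d/m) after the p-th
  root.\<close>

lemma trig_poly_square_le_powr:
  assumes "q \<ge> 1" "A \<subseteq> multi_indices q N" "\<And>\<alpha>. \<alpha> \<in> A \<Longrightarrow> card (index_supp N \<alpha>) \<le> d" "0 < p" "p < 2"
  shows "(\<Sum>\<alpha>\<in>A. (cmod (a \<alpha>))\<^sup>2) powr (p / 2)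
    \<le> (4 * real q) powr (d * (2 - p)) * mean q N (\<lambda>x. cmod (trig_poly N A a x) powr p)"
proof -
  have "((4 * real q) ^ (2 * d)) powr ((2 - p) / 2) = (4 * real q) powr (real (2 * d) * ((2 - p) / 2))"
    using assms(1) powr_realpow[of "4 * real q" "2 * d", symmetric] by (simp only: powr_powr)
  also have "real (2 * d) * ((2 - p) / 2) = d * (2 - p)" by simp
  finally show ?thesis
    using mean_square_le_mean_powr[OF assms(4,5) _ _ hypercontractivity[OF assms(1-3)], of a] assms(1)
    by (simp add: parseval[OF assms(1,2)])
qed


text \<open>The numbers \<open>(a \<beta>)\<^sup>2 / b k (\<rho> k \<beta>)\<close> for \<open>k < m\<close> together with \<open>\<Prod>k<m. b k (\<rho> k \<beta>)\<close> have product
  \<open>a \<beta> ^ (2 * m)\<close>, so a single application of AM-GM to these \<open>m + 1\<close> numbers suffices.\<close>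

lemma Blei_inequality_1:
  fixes a :: "'b \<Rightarrow> real" and \<rho> :: "nat \<Rightarrow> 'b \<Rightarrow> 'c" and m :: nat
  assumes B: "finite B" and m: "m \<ge> 1"
    and inj: "\<And>\<beta> \<gamma>. \<beta> \<in> B \<Longrightarrow> \<gamma> \<in> B \<Longrightarrow> (\<And>k. k < m \<Longrightarrow> \<rho> k \<beta> = \<rho> k \<gamma>) \<Longrightarrow> \<beta> = \<gamma>"
    and a0: "\<And>\<beta>. \<beta> \<in> B \<Longrightarrow> a \<beta> \<ge> 0"
    and le: "\<And>k. k < m \<Longrightarrow> (\<Sum>\<iota>\<in>\<rho> k ` B. sqrt (\<Sum>\<beta>\<in>{\<beta>\<in>B. \<rho> k \<beta> = \<iota>}. (a \<beta>)\<^sup>2)) \<le> 1"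
  shows "(\<Sum>\<beta>\<in>B. a \<beta> powr (2 * m / (m + 1))) \<le> 1"
proof -
  define b where "b k \<iota> = sqrt (\<Sum>\<beta>\<in>{\<beta>\<in>B. \<rho> k \<beta> = \<iota>}. (a \<beta>)\<^sup>2)" for k \<iota>
  have b0: "b k \<iota> \<ge> 0" for k \<iota> unfolding b_def by (intro real_sqrt_ge_zero sum_nonneg) auto
  have b2: "(b k \<iota>)\<^sup>2 = (\<Sum>\<beta>\<in>{\<beta>\<in>B. \<rho> k \<beta> = \<iota>}. (a \<beta>)\<^sup>2)" for k \<iota>
    unfolding b_def by (simp add: sum_nonneg)
  have a_le_b: "a \<beta> \<le> b k (\<rho> k \<beta>)" if "\<beta> \<in> B" for \<beta> k
  proof (rule power2_le_imp_le)
    show "(a \<beta>)\<^sup>2 \<le> (b k (\<rho> k \<beta>))\<^sup>2"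
      unfolding b2 using B that by (intro member_le_sum) auto
  qed (rule b0)
  have amgm: "a \<beta> powr (2 * m / (m + 1))
      \<le> ((\<Sum>k<m. (a \<beta>)\<^sup>2 / b k (\<rho> k \<beta>)) + (\<Prod>k<m. b k (\<rho> k \<beta>))) / (m + 1)" if \<beta>: "\<beta> \<in> B" for \<beta>
  proof (cases "a \<beta> = 0")
    case True
    then show ?thesis using b0 by (simp add: prod_nonneg)
  next
    case False
    then have apos: "a \<beta> > 0" using a0[OF \<beta>] by simp
    have bpos: "b k (\<rho> k \<beta>) > 0" for k using apos a_le_b[OF \<beta>, of k] by linarith
    define x where "x i = (if i < m then (a \<beta>)\<^sup>2 / b i (\<rho> i \<beta>) else (\<Prod>k<m. b k (\<rho> k \<beta>)))" for i
    have "(\<Prod>i\<in>{..<Suc m}. x i) = (\<Prod>i<m. (a \<beta>)\<^sup>2 / b i (\<rho> i \<beta>)) * (\<Prod>k<m. b k (\<rho> k \<beta>))"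
      unfolding prod.lessThan_Suc by (simp add: x_def)
    also have "\<dots> = (\<Prod>i<m. (a \<beta>)\<^sup>2)"
      using bpos by (simp add: less_imp_neq[THEN not_sym] flip: prod.distrib)
    also have "\<dots> = a \<beta> ^ (2 * m)" by (simp add: power_mult)
    also have "\<dots> = a \<beta> powr real (2 * m)" by (rule powr_realpow[OF apos, symmetric])
    finally have "a \<beta> powr (2 * m / (m + 1)) = (\<Prod>i\<in>{..<Suc m}. x i) powr (1 / card {..<Suc m})"
      by (simp add: powr_powr add.commute)
    also have "\<dots> \<le> (\<Sum>i\<in>{..<Suc m}. x i / card {..<Suc m})"
      using b0 by (intro arith_geom_mean) (auto simp: x_def intro: prod_nonneg)
    also have "\<dots> = ((\<Sum>k<m. (a \<beta>)\<^sup>2 / b k (\<rho> k \<beta>)) + (\<Prod>k<m. b k (\<rho> k \<beta>))) / (m + 1)"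
      unfolding sum_divide_distrib[symmetric] sum.lessThan_Suc by (simp add: x_def add.commute)
    finally show ?thesis .
  qed
  have single: "(\<Sum>\<beta>\<in>B. (a \<beta>)\<^sup>2 / b k (\<rho> k \<beta>)) \<le> 1" if "k < m" for k
  proof -
    have "(\<Sum>\<beta>\<in>B. (a \<beta>)\<^sup>2 / b k (\<rho> k \<beta>)) = (\<Sum>\<iota>\<in>\<rho> k ` B. \<Sum>\<beta>\<in>{\<beta>\<in>B. \<rho> k \<beta> = \<iota>}. (a \<beta>)\<^sup>2 / b k (\<rho> k \<beta>))"
      using B by (intro sum.group[symmetric]) auto
    also have "\<dots> = (\<Sum>\<iota>\<in>\<rho> k ` B. (b k \<iota>)\<^sup>2 / b k \<iota>)"
      unfolding b2 sum_divide_distrib by (intro sum.cong) auto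
    \<comment> \<open>As division by 0 gives 0, b^2 / b = b holds also where b vanishes.\<close>
    also have "\<dots> = (\<Sum>\<iota>\<in>\<rho> k ` B. b k \<iota>)"
      by (intro sum.cong refl) (simp add: power2_eq_square)
    finally show ?thesis using le[OF that] by (simp add: b_def)
  qed
  \<comment> \<open>By \<open>inj\<close>, \<beta> may be replaced by the tuple of its m
    projections. Enlarging the set of tuples to the full product makes the sum factor into m sums,
    each at most 1.\<close>
  have "(\<Sum>\<beta>\<in>B. \<Prod>k<m. b k (\<rho> k \<beta>)) = (\<Sum>\<beta>\<in>B. \<Prod>k<m. b k ((\<lambda>k\<in>{..<m}. \<rho> k \<beta>) k))"
    by (intro sum.cong prod.cong) auto
  also have "\<dots> = (\<Sum>g\<in>(\<lambda>\<beta>. \<lambda>k\<in>{..<m}. \<rho> k \<beta>) ` B. \<Prod>k<m. b k (g k))"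
  proof (subst sum.reindex)
    show "inj_on (\<lambda>\<beta>. \<lambda>k\<in>{..<m}. \<rho> k \<beta>) B"
    proof (rule inj_onI)
      fix \<beta> \<gamma> assume *: "\<beta> \<in> B" "\<gamma> \<in> B" "(\<lambda>k\<in>{..<m}. \<rho> k \<beta>) = (\<lambda>k\<in>{..<m}. \<rho> k \<gamma>)"
      have "\<rho> k \<beta> = \<rho> k \<gamma>" if "k < m" for k
        using fun_cong[OF *(3), of k] that by simp
      then show "\<beta> = \<gamma>" using inj *(1,2) by blast
    qed
  qed simp
  also have "\<dots> \<le> (\<Sum>g\<in>(\<Pi>\<^sub>E k\<in>{..<m}. \<rho> k ` B). \<Prod>k<m. b k (g k))"
    using B b0 by (intro sum_mono2 finite_PiE) (auto intro: prod_nonneg split: if_splits)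
  also have "\<dots> = (\<Prod>k<m. \<Sum>\<iota>\<in>\<rho> k ` B. b k \<iota>)"
    using B by (intro prod_sum_PiE[symmetric]) auto
  also have "\<dots> \<le> (\<Prod>k<m. 1)"
    using le b0 by (intro prod_mono) (auto simp: b_def intro!: sum_nonneg)
  finally have product: "(\<Sum>\<beta>\<in>B. \<Prod>k<m. b k (\<rho> k \<beta>)) \<le> 1" by simp
  have "(\<Sum>\<beta>\<in>B. a \<beta> powr (2 * m / (m + 1)))
      \<le> (\<Sum>\<beta>\<in>B. ((\<Sum>k<m. (a \<beta>)\<^sup>2 / b k (\<rho> k \<beta>)) + (\<Prod>k<m. b k (\<rho> k \<beta>))) / (m + 1))"
    by (intro sum_mono amgm)
  also have "\<dots> = ((\<Sum>k<m. \<Sum>\<beta>\<in>B. (a \<beta>)\<^sup>2 / b k (\<rho> k \<beta>)) + (\<Sum>\<beta>\<in>B. \<Prod>k<m. b k (\<rho> k \<beta>))) / (m + 1)"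
    unfolding sum_divide_distrib[symmetric] sum.distrib by (subst sum.swap) simp
  also have "\<dots> \<le> ((\<Sum>k<m. 1) + 1) / (m + 1)"
    using single product by (intro divide_right_mono add_mono sum_mono) auto
  finally show ?thesis by (simp add: add.commute)
qed

lemma Blei_inequality:
  fixes a :: "'b \<Rightarrow> real" and \<rho> :: "nat \<Rightarrow> 'b \<Rightarrow> 'c" and m :: nat
  assumes B: "finite B" and m: "m \<ge> 1" and \<Lambda>: "\<Lambda> > 0"
    and inj: "\<And>\<beta> \<gamma>. \<beta> \<in> B \<Longrightarrow> \<gamma> \<in> B \<Longrightarrow> (\<And>k. k < m \<Longrightarrow> \<rho> k \<beta> = \<rho> k \<gamma>) \<Longrightarrow> \<beta> = \<gamma>"
    and a0: "\<And>\<beta>. \<beta> \<in> B \<Longrightarrow> a \<beta> \<ge> 0"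
    and le: "\<And>k. k < m \<Longrightarrow> (\<Sum>\<iota>\<in>\<rho> k ` B. sqrt (\<Sum>\<beta>\<in>{\<beta>\<in>B. \<rho> k \<beta> = \<iota>}. (a \<beta>)\<^sup>2)) \<le> \<Lambda>"
  shows "(\<Sum>\<beta>\<in>B. a \<beta> powr (2 * m / (m + 1))) \<le> \<Lambda> powr (2 * m / (m + 1))"
proof -
  have "(\<Sum>\<beta>\<in>B. (a \<beta> / \<Lambda>) powr (2 * m / (m + 1))) \<le> 1"
  proof (rule Blei_inequality_1[OF B m inj])
    show "(\<Sum>\<iota>\<in>\<rho> k ` B. sqrt (\<Sum>\<beta>\<in>{\<beta>\<in>B. \<rho> k \<beta> = \<iota>}. (a \<beta> / \<Lambda>)\<^sup>2)) \<le> 1" if "k < m" for k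
      using le[OF that] \<Lambda>
      by (simp add: power_divide real_sqrt_divide flip: sum_divide_distrib)
  qed (use a0 \<Lambda> in auto)
  then show ?thesis
    using \<Lambda> a0 by (simp add: powr_divide flip: sum_divide_distrib)
qed

section \<open>Noise and projection onto blocks\<close>

text \<open>At 1 a term of the Leibniz rule survives only if the power of z - 1 has been
  differentiated away completely, which takes at least two derivatives.\<close>

lemma poly_pderiv_pderiv_power_1:
  fixes p :: "'a::idom poly"
  shows "poly (pderiv (pderiv ([:-1, 1:] ^ Suc (Suc r) * p))) 1 = (if r = 0 then 2 * poly p 1 else 0)"
  by (cases r) (simp_all add: pderiv_mult pderiv_add pderiv_smult pderiv_diff pderiv_power_Suc pderiv_pCons del: power_Suc)


text \<open>With \<open>t = (1 - Re z) / 2 = - (z - 1)\<^sup>2 / (4 z)\<close> on the unit circle, \<open>z ^ d * p t\<close> is a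
  polynomial \<open>Q\<close> in \<open>z\<close> of degree at most \<open>2 d\<close> whose coefficients are bounded by \<open>S\<close>, and the
  linear coefficient of \<open>p\<close> can be read off the second derivative of \<open>Q\<close> at 1.\<close>

lemma linear_coeff_bound:
  fixes c :: "nat \<Rightarrow> complex"
  assumes d: "d \<ge> 1" and S: "\<And>t. 0 \<le> t \<Longrightarrow> t \<le> 1 \<Longrightarrow> cmod (\<Sum>k\<le>d. c k * of_real t ^ k) \<le> S"
  shows "cmod (c 1) \<le> 26 * real d ^ 3 * S"
proof -
  define T where "T k = ([:-1, 1:] ^ (2 * k) * monom 1 (d - k) :: complex poly)" for k
  define Q where "Q = (\<Sum>k\<le>d. smult (c k * (-1/4) ^ k) (T k))"
  have S0: "S \<ge> 0" by (rule order.trans[OF norm_ge_zero S[of 0]]) simp_all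
  have "degree (smult (c k * (-1/4) ^ k) (T k)) \<le> 2 * d" if "k \<le> d" for k
  proof -
    have "degree (T k) \<le> degree ([:-1, 1:] ^ (2 * k) :: complex poly) + degree (monom 1 (d - k) :: complex poly)"
      unfolding T_def by (rule degree_mult_le)
    also have "\<dots> \<le> 2 * d" using that by (simp add: degree_linear_power degree_monom_eq)
    finally show ?thesis using degree_smult_le le_trans by blast
  qed
  then have degQ: "degree Q \<le> 2 * d" unfolding Q_def by (intro degree_sum_le) auto
  define n where "n = 2 * d + 1"
  have polyQ: "poly Q z = (\<Sum>i<n. coeff Q i * z ^ i)" for z
    unfolding poly_altdef n_def
    by (intro sum.mono_neutral_left) (use degQ in \<open>auto simp: coeff_eq_0 not_le\<close>)
  have Q_le: "cmod (poly Q z) \<le> S" if z: "z \<in> roots_unity n" for z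
  proof -
    define t where "t = (1 - Re z) / 2"
    have nz: "cmod z = 1" using norm_root_unity[OF z] .
    then have t: "0 \<le> t" "t \<le> 1" using abs_Re_le_cmod[of z] by (auto simp: t_def)
    have "of_real t = (2 - (z + cnj z)) / 4"
      by (simp add: t_def complex_eq_iff field_simps)
    then have "of_real t * z = (2 - (z + cnj z)) / 4 * z" by simp
    also have "\<dots> = (2 * z - z\<^sup>2 - z * cnj z) / 4"
      by (simp add: power2_eq_square algebra_simps)
    finally have "of_real t * z = (2 * z - z\<^sup>2 - z * cnj z) / 4" .
    then have tz: "of_real t * z = - (z - 1)\<^sup>2 / 4"
      using root_unity_mult_cnj[OF z] by (simp add: power2_eq_square algebra_simps)
    have "(- (z - 1)\<^sup>2 / 4) ^ k = (-1/4) ^ k * (z - 1) ^ (2 * k)" for k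
      unfolding power_mult power_mult_distrib[symmetric] by simp
    moreover have "poly (T k) z = (z - 1) ^ (2 * k) * z ^ (d - k)" for k
      by (simp add: T_def poly_monom)
    ultimately have "poly Q z = (\<Sum>k\<le>d. c k * (- (z - 1)\<^sup>2 / 4) ^ k * z ^ (d - k))"
      unfolding Q_def poly_sum by (simp only: poly_smult mult.assoc)
    also have "\<dots> = (\<Sum>k\<le>d. z ^ d * (c k * of_real t ^ k))"
      unfolding tz[symmetric]
      by (intro sum.cong refl) (simp add: power_mult_distrib power_add[symmetric])
    finally show ?thesis
      using S[OF t] nz by (simp add: sum_distrib_left[symmetric] norm_mult norm_power)
  qed
  have coeff_le: "cmod (coeff Q i) \<le> S" if "i < n" for i
  proof -
    have "(\<Sum>z\<in>roots_unity n. poly Q z * cnj z ^ i)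
        = (\<Sum>z\<in>roots_unity n. \<Sum>j<n. coeff Q j * (z ^ j * cnj z ^ i))"
      by (simp add: polyQ sum_distrib_right mult.assoc)
    also have "\<dots> = (\<Sum>j<n. coeff Q j * (\<Sum>z\<in>roots_unity n. z ^ j * cnj z ^ i))"
      by (subst sum.swap) (simp add: sum_distrib_left)
    also have "\<dots> = (\<Sum>j<n. if j = i then coeff Q j * n else 0)"
      using that by (intro sum.cong refl) (auto simp: sum_root_unity_powers)
    also have "\<dots> = n * coeff Q i" using that by (simp add: sum.delta')
    finally have "n * cmod (coeff Q i) = cmod (\<Sum>z\<in>roots_unity n. poly Q z * cnj z ^ i)"
      by (simp add: norm_mult)
    also have "\<dots> \<le> (\<Sum>z\<in>roots_unity n. S)"
      by (rule sum_norm_le) (simp add: norm_mult norm_power norm_root_unity Q_le)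
    also have "\<dots> = n * S" using card_roots_unity_set[of n] by (simp add: n_def)
    finally show ?thesis by (simp add: n_def)
  qed
  \<comment> \<open>For k \<ge> 2 the factor (z - 1)^(2 k) vanishes at 1 to order at least 4, so
    only \<open>c 0\<close>, through z^d, and \<open>c 1\<close>, through (z - 1)^2, contribute: E =
    d (d - 1) c_0 - c_1 / 2.\<close>
  define E where "E = poly (pderiv (pderiv Q)) 1"
  have "E = (\<Sum>i\<le>2 * d. coeff (pderiv (pderiv Q)) i)"
    unfolding E_def poly_altdef
    by (simp, intro sum.mono_neutral_left)
      (use degQ in \<open>auto simp: coeff_eq_0 not_le degree_pderiv\<close>)
  also have "cmod \<dots> \<le> (\<Sum>i\<le>2 * d. 4 * real d ^ 2 * S)"
  proof (rule sum_norm_le)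
    fix i
    have *: "cmod (coeff (pderiv (pderiv Q)) i) = real (Suc i) * (real (Suc (Suc i)) * cmod (coeff Q (Suc (Suc i))))"
      by (simp only: coeff_pderiv norm_mult norm_of_nat)
    show "cmod (coeff (pderiv (pderiv Q)) i) \<le> 4 * real d ^ 2 * S"
    proof (cases "Suc (Suc i) \<le> 2 * d")
      case True
      have "real (Suc i) * (real (Suc (Suc i)) * cmod (coeff Q (Suc (Suc i)))) \<le> real (2 * d) * (real (2 * d) * S)"
        using True by (intro mult_mono coeff_le) (auto simp: n_def S0)
      then show ?thesis unfolding * by (simp add: power2_eq_square)
    next
      case False
      then have "coeff Q (Suc (Suc i)) = 0" using degQ by (intro coeff_eq_0) simp
      then show ?thesis unfolding * using S0 by simp
    qed
  qed
  also have "\<dots> = (2 * real d + 1) * (4 * real d ^ 2 * S)" by simp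
  also have "\<dots> \<le> (3 * real d) * (4 * real d ^ 2 * S)"
    using d S0 by (intro mult_right_mono) auto
  finally have E_le: "cmod E \<le> 12 * real d ^ 3 * S" by (simp add: power2_eq_square power3_eq_cube)
  have "poly (pderiv (pderiv (T k))) 1 = (if k = 0 then of_nat (d * (d - 1)) else if k = 1 then 2 else 0)" for k
  proof -
    consider "k = 0" | "k = 1" | r where "k = Suc (Suc r)" by (metis One_nat_def not0_implies_Suc)
    then show ?thesis
    proof cases
      case 1
      then show ?thesis by (simp add: T_def pderiv_monom poly_monom)
    next
      case 2
      have e: "2 * (1::nat) = Suc (Suc 0)" by simp
      have "poly (pderiv (pderiv (T k))) 1 = 2"
        unfolding T_def 2 e poly_pderiv_pderiv_power_1 poly_monom by simp
      then show ?thesis using 2 by simp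
    next
      case 3
      have e: "2 * k = Suc (Suc (Suc (Suc (2 * r))))" using 3 by simp
      have "poly (pderiv (pderiv (T k))) 1 = 0"
        unfolding T_def e poly_pderiv_pderiv_power_1 by simp
      then show ?thesis using 3 by simp
    qed
  qed
  note T_deriv = this
  have "pderiv (pderiv Q) = (\<Sum>k\<le>d. smult (c k * (-1/4) ^ k) (pderiv (pderiv (T k))))"
    using higher_pderiv_sum[of "Suc (Suc 0)" "\<lambda>k. smult (c k * (-1/4) ^ k) (T k)" "{..d}"]
    unfolding Q_def funpow.simps comp_def id_def pderiv_smult .
  then have "E = (\<Sum>k\<le>d. c k * (-1/4) ^ k * (if k = 0 then of_nat (d * (d - 1)) else if k = 1 then 2 else 0))"
    by (simp only: E_def poly_sum poly_smult T_deriv)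
  also have "\<dots> = (\<Sum>k\<in>{0, 1}. c k * (-1/4) ^ k * (if k = 0 then of_nat (d * (d - 1)) else if k = 1 then 2 else 0))"
    using d by (intro sum.mono_neutral_right) auto
  finally have "E = c 0 * of_nat (d * (d - 1)) - c 1 / 2" by simp
  then have "c 1 = 2 * (of_nat (d * (d - 1)) * c 0 - E)" by (simp add: field_simps)
  then have "cmod (c 1) = 2 * cmod (of_nat (d * (d - 1)) * c 0 - E)"
    by (simp only: norm_mult norm_numeral)
  also have "\<dots> \<le> 2 * (cmod (of_nat (d * (d - 1)) * c 0) + cmod E)"
    by (intro mult_left_mono norm_triangle_ineq4) auto
  \<comment> \<open>\<open>c 0\<close> is the value at t = 0, hence at most \<open>S\<close>, and
    its factor d (d - 1) is at most d^3. This gives the constant 26 = 2 (1 + 12).\<close>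
  also have "\<dots> \<le> 2 * (real d ^ 3 * S + 12 * real d ^ 3 * S)"
  proof (intro mult_left_mono add_mono E_le)
    have "(\<Sum>k\<le>d. c k * of_real 0 ^ k) = c 0"
      by (subst sum.mono_neutral_right[of _ "{0}"]) auto
    then have "cmod (c 0) \<le> S" using S[of 0] by simp
    moreover have "real (d * (d - 1)) \<le> real d ^ 3"
    proof -
      have "d \<le> d * d" using d by simp
      then have "d * (d - 1) \<le> d * (d * d)" by (intro mult_le_mono order.refl) linarith
      then have "real (d * (d - 1)) \<le> real (d * (d * d))" by (simp only: of_nat_le_iff)
      then show ?thesis by (simp only: of_nat_mult power3_eq_cube mult.assoc)
    qed
    ultimately show "cmod (of_nat (d * (d - 1)) * c 0) \<le> real d ^ 3 * S"
      unfolding norm_mult norm_of_nat by (intro mult_mono) auto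
  qed simp
  finally show ?thesis by (simp add: algebra_simps)
qed

text \<open>The modified polynomial is a convex combination: \<rho> times the original plus 1 -
  \<rho> times its average over coordinate j, which deletes all monomials containing that
  coordinate. Neither part exceeds the original sup norm.\<close>

lemma trig_poly_noise_step:
  assumes q: "q \<ge> 1" and A: "A \<subseteq> multi_indices q N" and j: "j \<in> {1..N}" and \<rho>: "0 \<le> \<rho>" "\<rho> \<le> 1"
    and S: "\<And>x. x \<in> cube q N \<Longrightarrow> cmod (trig_poly N A a x) \<le> S" and x: "x \<in> cube q N"
  shows "cmod (trig_poly N A (\<lambda>\<alpha>. (if \<alpha> j = 0 then 1 else of_real \<rho>) * a \<alpha>) x) \<le> S"
proof -
  define R where "R z = trig_poly N A a (rotate_on {j} (\<lambda>i\<in>{1..N}. z) x)" for z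
  have R: "R z = (\<Sum>\<alpha>\<in>A. a \<alpha> * monomial N \<alpha> x * z ^ \<alpha> j)" for z
  proof -
    have "monomial N (restr N {j} \<alpha>) (\<lambda>i\<in>{1..N}. z) = z ^ \<alpha> j" for \<alpha>
    proof -
      have "monomial N (restr N {j} \<alpha>) (\<lambda>i\<in>{1..N}. z) = (\<Prod>i\<in>{1..N}. if i = j then z ^ \<alpha> j else 1)"
        unfolding monomial_def by (intro prod.cong) (auto simp: restr_def)
      then show ?thesis using j by (simp add: prod.delta)
    qed
    then show ?thesis by (simp add: R_def trig_poly_def monomial_rotate_on mult.assoc)
  qed
  have "(\<Sum>z\<in>roots_unity q. R z) = (\<Sum>\<alpha>\<in>A. a \<alpha> * monomial N \<alpha> x * (\<Sum>z\<in>roots_unity q. z ^ \<alpha> j * cnj z ^ 0))"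
    unfolding R by (subst sum.swap) (simp add: sum_distrib_left)
  also have "\<dots> = (\<Sum>\<alpha>\<in>A. a \<alpha> * monomial N \<alpha> x * (if \<alpha> j = 0 then of_nat q else 0))"
  proof (intro sum.cong refl)
    fix \<alpha> assume "\<alpha> \<in> A"
    then have "\<alpha> j < q" using A j multi_indexD by blast
    then show "a \<alpha> * monomial N \<alpha> x * (\<Sum>z\<in>roots_unity q. z ^ \<alpha> j * cnj z ^ 0)
      = a \<alpha> * monomial N \<alpha> x * (if \<alpha> j = 0 then of_nat q else 0)"
      using sum_root_unity_powers[of "\<alpha> j" q 0] q by simp
  qed
  finally have sR: "(\<Sum>z\<in>roots_unity q. R z) = (\<Sum>\<alpha>\<in>A. a \<alpha> * monomial N \<alpha> x * (if \<alpha> j = 0 then of_nat q else 0))" .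
  have sumR: "(\<Sum>z\<in>roots_unity q. R z) / of_nat q = (\<Sum>\<alpha>\<in>A. a \<alpha> * monomial N \<alpha> x * (if \<alpha> j = 0 then 1 else 0))"
    using q unfolding sR sum_divide_distrib by (auto intro!: sum.cong)
  have "trig_poly N A (\<lambda>\<alpha>. (if \<alpha> j = 0 then 1 else of_real \<rho>) * a \<alpha>) x
      = of_real \<rho> * trig_poly N A a x + of_real (1 - \<rho>) * ((\<Sum>z\<in>roots_unity q. R z) / of_nat q)"
    unfolding sumR trig_poly_def sum_distrib_left sum.distrib[symmetric]
    by (intro sum.cong) (auto simp: algebra_simps)
  also have "cmod \<dots> \<le> cmod (of_real \<rho> * trig_poly N A a x) + cmod (of_real (1 - \<rho>) * ((\<Sum>z\<in>roots_unity q. R z) / of_nat q))"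
    by (rule norm_triangle_ineq)
  also have "\<dots> \<le> \<rho> * S + (1 - \<rho>) * S"
  proof (intro add_mono)
    show "cmod (of_real \<rho> * trig_poly N A a x) \<le> \<rho> * S"
      using \<rho> S[OF x] by (simp add: norm_mult mult_left_mono)
    have "cmod (\<Sum>z\<in>roots_unity q. R z) \<le> (\<Sum>z\<in>roots_unity q. S)"
    proof (rule sum_norm_le)
      fix z assume "z \<in> roots_unity q"
      then have "(\<lambda>i\<in>{1..N}. z) \<in> cube q N" by (auto simp: cube_def)
      then show "cmod (R z) \<le> S"
        unfolding R_def using q x j by (intro S rotate_on_in_cube) auto
    qed
    then have "cmod ((\<Sum>z\<in>roots_unity q. R z) / of_nat q) \<le> S"
      using q by (simp add: norm_divide card_roots_unity_set field_simps)
    then show "cmod (of_real (1 - \<rho>) * ((\<Sum>z\<in>roots_unity q. R z) / of_nat q)) \<le> (1 - \<rho>) * S"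
      unfolding norm_mult norm_of_real using \<rho> by (intro mult_mono) auto
  qed
  finally show ?thesis by (simp add: algebra_simps)
qed

lemma trig_poly_noise:
  assumes q: "q \<ge> 1" and A: "A \<subseteq> multi_indices q N" and \<rho>: "0 \<le> \<rho>" "\<rho> \<le> 1"
    and U: "U \<subseteq> {1..N}"
    and S: "\<And>x. x \<in> cube q N \<Longrightarrow> cmod (trig_poly N A a x) \<le> S" and x: "x \<in> cube q N"
  shows "cmod (trig_poly N A (\<lambda>\<alpha>. of_real \<rho> ^ card (index_supp N \<alpha> \<inter> U) * a \<alpha>) x) \<le> S"
proof -
  have "finite U" using U finite_subset by blast
  then show ?thesis using U x
  proof (induction U arbitrary: x rule: finite_induct)
    case empty
    then show ?case using S by simp
  next
    case (insert j U)
    have "card (index_supp N \<alpha> \<inter> insert j U) = (if \<alpha> j = 0 then 0 else 1) + card (index_supp N \<alpha> \<inter> U)" for \<alpha>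
    proof (cases "\<alpha> j = 0")
      case True
      then have "index_supp N \<alpha> \<inter> insert j U = index_supp N \<alpha> \<inter> U" by (auto simp: index_supp_def)
      then show ?thesis using True by simp
    next
      case False
      then have "index_supp N \<alpha> \<inter> insert j U = insert j (index_supp N \<alpha> \<inter> U)"
        using insert.prems by (auto simp: index_supp_def)
      then show ?thesis using False insert.hyps by simp
    qed
    then have "of_real \<rho> ^ card (index_supp N \<alpha> \<inter> insert j U) * a \<alpha> =
        (if \<alpha> j = 0 then 1 else of_real \<rho>) * (of_real \<rho> ^ card (index_supp N \<alpha> \<inter> U) * a \<alpha>)" for \<alpha>
      by simp
    then show ?case
      using insert.prems by (simp only:) (intro trig_poly_noise_step[OF q A _ \<rho>] insert.IH, auto)
  qed
qed

lemma trig_poly_one_in_block: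
  assumes q: "q \<ge> 1" and A: "A \<subseteq> multi_indices q N" and U: "U \<subseteq> {1..N}"
    and d: "d \<ge> 1" "\<And>\<alpha>. \<alpha> \<in> A \<Longrightarrow> card (index_supp N \<alpha>) \<le> d"
    and S: "\<And>x. x \<in> cube q N \<Longrightarrow> cmod (trig_poly N A a x) \<le> S" and x: "x \<in> cube q N"
  shows "cmod (trig_poly N {\<alpha>\<in>A. card (index_supp N \<alpha> \<inter> U) = 1} a x) \<le> 26 * real d ^ 3 * S"
proof -
  define c where "c k = trig_poly N {\<alpha>\<in>A. card (index_supp N \<alpha> \<inter> U) = k} a x" for k
  have fin: "finite A" using A finite_multi_indices finite_subset by blast
  have "cmod (\<Sum>k\<le>d. c k * of_real t ^ k) \<le> S" if t: "0 \<le> t" "t \<le> 1" for t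
  proof -
    have card_le: "card (index_supp N \<alpha> \<inter> U) \<le> d" if "\<alpha> \<in> A" for \<alpha>
      using d(2)[OF that] card_mono[of "index_supp N \<alpha>" "index_supp N \<alpha> \<inter> U"]
      by (simp add: index_supp_def)
    have "trig_poly N A (\<lambda>\<alpha>. of_real t ^ card (index_supp N \<alpha> \<inter> U) * a \<alpha>) x
       = (\<Sum>k\<le>d. \<Sum>\<alpha>\<in>{\<alpha>\<in>A. card (index_supp N \<alpha> \<inter> U) = k}. of_real t ^ card (index_supp N \<alpha> \<inter> U) * a \<alpha> * monomial N \<alpha> x)"
      unfolding trig_poly_def using fin card_le by (intro sum.group[symmetric]) auto
    also have "\<dots> = (\<Sum>k\<le>d. c k * of_real t ^ k)"
      unfolding c_def trig_poly_def sum_distrib_right by (intro sum.cong refl) auto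
    finally show ?thesis using trig_poly_noise[OF q A t U S x] by simp
  qed
  from linear_coeff_bound[OF d(1) this] show ?thesis unfolding c_def .
qed

lemma trig_poly_one_in_blocks:
  assumes q: "q \<ge> 1" and A: "A \<subseteq> multi_indices q N" and U: "\<And>k. k < m \<Longrightarrow> U k \<subseteq> {1..N}"
    and d: "d \<ge> 1" "\<And>\<alpha>. \<alpha> \<in> A \<Longrightarrow> card (index_supp N \<alpha>) \<le> d"
    and S: "\<And>x. x \<in> cube q N \<Longrightarrow> cmod (trig_poly N A a x) \<le> S" and x: "x \<in> cube q N"
  shows "cmod (trig_poly N {\<alpha>\<in>A. \<forall>k<m. card (index_supp N \<alpha> \<inter> U k) = 1} a x) \<le> (26 * real d ^ 3) ^ m * S"
  using U x
proof (induction m arbitrary: x)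
  case 0
  then show ?case using S by simp
next
  case (Suc m)
  have "{\<alpha>\<in>A. \<forall>k<Suc m. card (index_supp N \<alpha> \<inter> U k) = 1}
      = {\<alpha>\<in>{\<alpha>\<in>A. \<forall>k<m. card (index_supp N \<alpha> \<inter> U k) = 1}. card (index_supp N \<alpha> \<inter> U m) = 1}"
    by (auto simp: less_Suc_eq)
  moreover have "cmod (trig_poly N \<dots> a x) \<le> 26 * real d ^ 3 * ((26 * real d ^ 3) ^ m * S)"
    using Suc.prems A d by (intro trig_poly_one_in_block[OF q] Suc.IH) auto
  ultimately show ?case by (simp add: mult.assoc)
qed

text \<open>Each \<open>y j\<close> is chosen to maximise the real (or imaginary) part of the mean-zero function
  \<open>u j\<close> formed by the terms supported at \<open>j\<close>; a maximum bounds the coefficients because constants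
  are orthogonal to the nontrivial powers.\<close>

lemma sum_coeffs_single_support:
  assumes q: "q \<ge> 1" and I: "I \<subseteq> multi_indices q N" "\<And>\<iota>. \<iota> \<in> I \<Longrightarrow> card (index_supp N \<iota>) = 1"
    and S: "\<And>y. y \<in> cube q N \<Longrightarrow> cmod (trig_poly N I w y) \<le> S"
  shows "(\<Sum>\<iota>\<in>I. cmod (w \<iota>)) \<le> 2 * q * S"
proof -
  have fin: "finite I" using I(1) finite_multi_indices finite_subset by blast
  define J where "J j = {\<iota>\<in>I. \<iota> j \<noteq> 0}" for j
  define u where "u j z = (\<Sum>\<iota>\<in>J j. w \<iota> * z ^ \<iota> j)" for j z
  define M where "M \<theta> j = Max ((\<lambda>z. Re (\<theta> * u j z)) ` roots_unity q)" for \<theta> j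
  have single: "\<exists>j\<in>{1..N}. index_supp N \<iota> = {j}" if "\<iota> \<in> I" for \<iota>
    using I(2)[OF that] by (auto simp: card_1_singleton_iff index_supp_def)
  have suppD: "\<iota> i = 0" if "\<iota> \<in> J j" "i \<in> {1..N}" "j \<in> {1..N}" "i \<noteq> j" for \<iota> i j
  proof -
    from that(1) obtain k where k: "index_supp N \<iota> = {k}" using single[of \<iota>] by (auto simp: J_def)
    have "j \<in> index_supp N \<iota>" using that by (auto simp: J_def index_supp_def)
    then have "i \<notin> index_supp N \<iota>" using that k by auto
    then show ?thesis using that by (auto simp: index_supp_def)
  qed
  have J_sum: "(\<Sum>\<iota>\<in>I. g \<iota>) = (\<Sum>j\<in>{1..N}. \<Sum>\<iota>\<in>J j. g \<iota>)" for g :: "_ \<Rightarrow> 'z::comm_monoid_add"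
  proof -
    have "(\<Sum>j\<in>{1..N}. \<Sum>\<iota>\<in>J j. g \<iota>) = (\<Sum>j\<in>{1..N}. \<Sum>\<iota>\<in>I. if \<iota> j \<noteq> 0 then g \<iota> else 0)"
      unfolding J_def using fin by (intro sum.cong refl sum.inter_filter) auto
    also have "\<dots> = (\<Sum>\<iota>\<in>I. \<Sum>j\<in>{1..N}. if \<iota> j \<noteq> 0 then g \<iota> else 0)"
      by (rule sum.swap)
    also have "\<dots> = (\<Sum>\<iota>\<in>I. g \<iota>)"
    proof (rule sum.cong[OF refl])
      fix \<iota> assume "\<iota> \<in> I"
      then obtain j where j: "j \<in> {1..N}" "index_supp N \<iota> = {j}" using single by blast
      have "\<iota> i \<noteq> 0 \<longleftrightarrow> i = j" if "i \<in> {1..N}" for i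
        using j that unfolding index_supp_def by blast
      then have "(\<Sum>i\<in>{1..N}. if \<iota> i \<noteq> 0 then g \<iota> else 0) = (\<Sum>i\<in>{1..N}. if i = j then g \<iota> else 0)"
        by (intro sum.cong) simp_all
      then show "(\<Sum>i\<in>{1..N}. if \<iota> i \<noteq> 0 then g \<iota> else 0) = g \<iota>" using j by simp
    qed
    finally show ?thesis by simp
  qed
  have poly: "trig_poly N I w y = (\<Sum>j\<in>{1..N}. u j (y j))" for y
    unfolding trig_poly_def J_sum u_def
  proof (intro sum.cong refl)
    fix j \<iota> assume j: "j \<in> {1..N}" "\<iota> \<in> J j"
    have "monomial N \<iota> y = (\<Prod>i\<in>{1..N}. if i = j then y j ^ \<iota> j else 1)"
      unfolding monomial_def using suppD[OF j(2) _ j(1)] by (intro prod.cong) auto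
    then show "w \<iota> * monomial N \<iota> y = w \<iota> * y j ^ \<iota> j" using j by (simp add: prod.delta)
  qed
  have M_ge: "Re (\<theta> * u j z) \<le> M \<theta> j" if "z \<in> roots_unity q" for \<theta> j z
    unfolding M_def using that by (intro Max_ge) auto
  have M_sum: "(\<Sum>j\<in>{1..N}. M \<theta> j) \<le> S" if "cmod \<theta> = 1" for \<theta>
  proof -
    have "\<exists>z\<in>roots_unity q. Re (\<theta> * u j z) = M \<theta> j" for j
      using Max_in[of "(\<lambda>z. Re (\<theta> * u j z)) ` roots_unity q"] one_root_unity[OF q]
      unfolding M_def by fastforce
    then obtain y where y: "y j \<in> roots_unity q" "Re (\<theta> * u j (y j)) = M \<theta> j" for j by metis
    define y' where "y' = (\<lambda>j\<in>{1..N}. y j)"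
    have "y' \<in> cube q N" using y by (auto simp: y'_def cube_def)
    then have "cmod (trig_poly N I w y') \<le> S" by (rule S)
    moreover have "Re (\<theta> * trig_poly N I w y') = (\<Sum>j\<in>{1..N}. M \<theta> j)"
      unfolding poly y(2)[symmetric] by (simp add: sum_distrib_left y'_def)
    moreover have "Re (\<theta> * trig_poly N I w y') \<le> cmod (trig_poly N I w y')"
      using complex_Re_le_cmod[of "\<theta> * trig_poly N I w y'"] that by (simp add: norm_mult)
    ultimately show ?thesis by linarith
  qed
  define K where "K j = M 1 j + M (- \<i>) j" for j
  have mean0: "(\<Sum>z\<in>roots_unity q. u j z) = 0" if j: "j \<in> {1..N}" for j
  proof -
    have "(\<Sum>z\<in>roots_unity q. u j z) = (\<Sum>\<iota>\<in>J j. w \<iota> * (\<Sum>z\<in>roots_unity q. z ^ \<iota> j * cnj z ^ 0))"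
      unfolding u_def by (subst sum.swap) (simp add: sum_distrib_left)
    also have "\<dots> = 0"
    proof (intro sum.neutral ballI)
      fix \<iota> assume \<iota>: "\<iota> \<in> J j"
      then have "\<iota> j < q" "\<iota> j \<noteq> 0" using I(1) j multi_indexD by (auto simp: J_def)
      then show "w \<iota> * (\<Sum>z\<in>roots_unity q. z ^ \<iota> j * cnj z ^ 0) = 0"
        using sum_root_unity_powers[of "\<iota> j" q 0] q by simp
    qed
    finally show ?thesis .
  qed
  \<comment> \<open>The constant majorises u in both real and imaginary part (the direction
    \<open>- \<i>\<close> turns Im into Re), so |D| \<le> Re D + Im D, and the sum of the right side
    over z involves only the constant because u has mean 0. At a nontrivial exponent the coefficient
    of D is minus that of u.\<close>
  define D where "D j z = Complex (M 1 j) (M (- \<i>) j) - u j z" for j z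
  have D_sum: "(\<Sum>z\<in>roots_unity q. cmod (D j z)) \<le> q * K j" if j: "j \<in> {1..N}" for j
  proof -
    have "(\<Sum>z\<in>roots_unity q. cmod (D j z)) \<le> (\<Sum>z\<in>roots_unity q. K j - Re (u j z) - Im (u j z))"
    proof (rule sum_mono)
      fix z assume z: "z \<in> roots_unity q"
      have "cmod (D j z) \<le> \<bar>Re (D j z)\<bar> + \<bar>Im (D j z)\<bar>" by (rule cmod_le)
      then show "cmod (D j z) \<le> K j - Re (u j z) - Im (u j z)"
        using M_ge[OF z, of 1 j] M_ge[OF z, of "- \<i>" j] by (simp add: D_def K_def)
    qed
    also have "\<dots> = q * K j - Re (\<Sum>z\<in>roots_unity q. u j z) - Im (\<Sum>z\<in>roots_unity q. u j z)"
      using q by (simp add: sum_subtractf card_roots_unity_set)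
    finally show ?thesis unfolding mean0[OF j] by simp
  qed
  have w_le: "cmod (w \<iota>) \<le> K j" if j: "j \<in> {1..N}" and \<iota>: "\<iota> \<in> J j" for j \<iota>
  proof -
    have \<iota>j: "\<iota> j < q" "\<iota> j \<noteq> 0" using I(1) j \<iota> multi_indexD by (auto simp: J_def)
    have "(\<Sum>z\<in>roots_unity q. u j z * cnj z ^ \<iota> j)
        = (\<Sum>\<kappa>\<in>J j. w \<kappa> * (\<Sum>z\<in>roots_unity q. z ^ \<kappa> j * cnj z ^ \<iota> j))"
      unfolding u_def sum_distrib_right sum_distrib_left
      by (subst sum.swap) (simp add: mult.assoc)
    also have "\<dots> = (\<Sum>\<kappa>\<in>J j. if \<kappa> = \<iota> then w \<kappa> * q else 0)"
    proof (rule sum.cong[OF refl])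
      fix \<kappa> assume \<kappa>: "\<kappa> \<in> J j"
      have "\<kappa> = \<iota>" if "\<kappa> j = \<iota> j"
      proof (rule multi_index_eqI[of _ q N])
        show "\<kappa> i = \<iota> i" if "i \<in> {1..N}" for i
          using suppD[OF \<kappa> that j] suppD[OF \<iota> that j] \<open>\<kappa> j = \<iota> j\<close> by (cases "i = j") auto
      qed (use \<kappa> \<iota> I(1) in \<open>auto simp: J_def\<close>)
      moreover have "\<kappa> j < q" using I(1) j \<kappa> multi_indexD by (auto simp: J_def)
      ultimately show "w \<kappa> * (\<Sum>z\<in>roots_unity q. z ^ \<kappa> j * cnj z ^ \<iota> j) = (if \<kappa> = \<iota> then w \<kappa> * q else 0)"
        using sum_root_unity_powers[of "\<kappa> j" q "\<iota> j"] \<iota>j by auto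
    qed
    also have "\<dots> = w \<iota> * q" using fin \<iota> by (simp add: J_def sum.delta')
    finally have "w \<iota> * q = (\<Sum>z\<in>roots_unity q. u j z * cnj z ^ \<iota> j)" by simp
    also have "\<dots> = (\<Sum>z\<in>roots_unity q. Complex (M 1 j) (M (- \<i>) j) * (z ^ 0 * cnj z ^ \<iota> j) - D j z * cnj z ^ \<iota> j)"
      by (intro sum.cong refl) (simp add: D_def algebra_simps)
    also have "\<dots> = - (\<Sum>z\<in>roots_unity q. D j z * cnj z ^ \<iota> j)"
      using sum_root_unity_powers[of 0 q "\<iota> j"] \<iota>j
      unfolding sum_subtractf sum_distrib_left[symmetric] by simp
    finally have eq: "w \<iota> * q = - (\<Sum>z\<in>roots_unity q. D j z * cnj z ^ \<iota> j)" .
    have "q * cmod (w \<iota>) = cmod (w \<iota> * q)" by (simp add: norm_mult)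
    also have "\<dots> = cmod (\<Sum>z\<in>roots_unity q. D j z * cnj z ^ \<iota> j)"
      unfolding eq by (rule norm_minus_cancel)
    also have "\<dots> \<le> (\<Sum>z\<in>roots_unity q. cmod (D j z))"
      by (rule sum_norm_le) (simp add: norm_mult norm_power norm_root_unity)
    also have "\<dots> \<le> q * K j" by (rule D_sum[OF j])
    finally show ?thesis using q by simp
  qed
  have "(\<Sum>\<iota>\<in>I. cmod (w \<iota>)) = (\<Sum>j\<in>{1..N}. \<Sum>\<iota>\<in>J j. cmod (w \<iota>))" by (rule J_sum)
  also have "\<dots> \<le> (\<Sum>j\<in>{1..N}. q * K j)"
  proof (rule sum_mono)
    fix j assume j: "j \<in> {1..N}"
    have K0: "K j \<ge> 0"
    proof -
      have "0 \<le> (\<Sum>z\<in>roots_unity q. cmod (D j z))" by (intro sum_nonneg) auto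
      then have "0 \<le> q * K j" using D_sum[OF j] by linarith
      then show ?thesis using q by (simp add: zero_le_mult_iff)
    qed
    \<comment> \<open>A multi-index supported at j alone is determined by its exponent
      there.\<close>
    have "card (J j) \<le> card {0..<q}"
    proof (rule card_inj_on_le[of "\<lambda>\<iota>. \<iota> j"])
      show "inj_on (\<lambda>\<iota>. \<iota> j) (J j)"
      proof (rule inj_onI)
        fix \<kappa> \<iota> assume \<kappa>: "\<kappa> \<in> J j" and \<iota>: "\<iota> \<in> J j" and eq: "\<kappa> j = \<iota> j"
        show "\<kappa> = \<iota>"
        proof (rule multi_index_eqI[of _ q N])
          show "\<kappa> i = \<iota> i" if "i \<in> {1..N}" for i
            using suppD[OF \<kappa> that j] suppD[OF \<iota> that j] eq by (cases "i = j") auto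
        qed (use \<kappa> \<iota> I(1) in \<open>auto simp: J_def\<close>)
      qed
      show "(\<lambda>\<iota>. \<iota> j) ` J j \<subseteq> {0..<q}"
        using I(1) j multi_indexD by (auto simp: J_def)
    qed simp
    have "(\<Sum>\<iota>\<in>J j. cmod (w \<iota>)) \<le> (\<Sum>\<iota>\<in>J j. K j)" by (intro sum_mono w_le j)
    also have "\<dots> \<le> q * K j" using \<open>card (J j) \<le> card {0..<q}\<close> K0 by (simp add: mult_right_mono)
    finally show "(\<Sum>\<iota>\<in>J j. cmod (w \<iota>)) \<le> q * K j" .
  qed
  also have "\<dots> = q * ((\<Sum>j\<in>{1..N}. M 1 j) + (\<Sum>j\<in>{1..N}. M (- \<i>) j))"
    by (simp add: K_def sum_distrib_left sum.distrib algebra_simps)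
  also have "\<dots> \<le> q * (S + S)"
    by (intro mult_left_mono add_mono M_sum) auto
  finally show ?thesis by simp
qed

section \<open>The multilinear inequality\<close>

text \<open>With \<open>x\<close> frozen, the rotated polynomial is a polynomial in \<open>y\<close>
  whose spectrum is the set of restrictions to \<open>V\<close>. Its coefficients are still
  functions of \<open>x\<close>, and the original sup bound holds for all pairs (x, y).\<close>

lemma trig_poly_rotate_on:
  assumes "finite A"
  shows "trig_poly N A a (rotate_on V y x)
    = trig_poly N (restr N V ` A) (\<lambda>\<beta>. trig_poly N {\<alpha>\<in>A. restr N V \<alpha> = \<beta>} a x) y"
proof -
  have "trig_poly N A a (rotate_on V y x) = (\<Sum>\<alpha>\<in>A. a \<alpha> * (monomial N \<alpha> x * monomial N (restr N V \<alpha>) y))"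
    by (simp add: trig_poly_def monomial_rotate_on)
  also have "\<dots> = (\<Sum>\<beta>\<in>restr N V ` A. \<Sum>\<alpha>\<in>{\<alpha>\<in>A. restr N V \<alpha> = \<beta>}. a \<alpha> * (monomial N \<alpha> x * monomial N (restr N V \<alpha>) y))"
    using assms by (intro sum.group[symmetric]) auto
  also have "\<dots> = trig_poly N (restr N V ` A) (\<lambda>\<beta>. trig_poly N {\<alpha>\<in>A. restr N V \<alpha> = \<beta>} a x) y"
    unfolding trig_poly_def sum_distrib_right by (intro sum.cong refl) auto
  finally show ?thesis .
qed

text \<open>Hoelder's inequality against the constant 1, again through Young's inequality with both
  factors normalised to total mass at most 1.\<close>

lemma sum_le_of_sum_powr_le:
  fixes s :: "'b \<Rightarrow> real"
  assumes "finite B" "B \<noteq> {}" and s: "\<And>\<beta>. \<beta> \<in> B \<Longrightarrow> s \<beta> \<ge> 0"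
    and p: "p \<ge> 1" and C: "C > 0" "(\<Sum>\<beta>\<in>B. s \<beta> powr p) \<le> C"
  shows "(\<Sum>\<beta>\<in>B. s \<beta>) \<le> card B powr (1 - 1 / p) * C powr (1 / p)"
proof -
  define n where "n = real (card B)"
  have n: "n > 0" using assms(1,2) by (simp add: n_def card_gt_0_iff)
  have young: "s \<beta> \<le> n powr (1 - 1 / p) * C powr (1 / p) * ((1 / p) * (s \<beta> powr p / C) + (1 - 1 / p) * (1 / n))"
    if \<beta>: "\<beta> \<in> B" for \<beta>
  proof (cases "s \<beta> = 0")
    case True
    then show ?thesis using p n C by simp
  next
    case False
    then have pos: "s \<beta> > 0" using s[OF \<beta>] by simp
    have "s \<beta> = n powr (1 - 1 / p) * C powr (1 / p) * ((s \<beta> powr p / C) powr (1 / p) * (1 / n) powr (1 - 1 / p))"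
      using pos C n p by (simp add: powr_divide powr_powr)
    also have "\<dots> \<le> n powr (1 - 1 / p) * C powr (1 / p) * ((1 / p) * (s \<beta> powr p / C) + (1 - 1 / p) * (1 / n))"
      using pos C n p by (intro mult_left_mono Youngs_inequality_0) auto
    finally show ?thesis .
  qed
  have "(\<Sum>\<beta>\<in>B. s \<beta>) \<le> (\<Sum>\<beta>\<in>B. n powr (1 - 1 / p) * C powr (1 / p) * ((1 / p) * (s \<beta> powr p / C) + (1 - 1 / p) * (1 / n)))"
    by (intro sum_mono young)
  also have "\<dots> = n powr (1 - 1 / p) * C powr (1 / p) * ((1 / p) * ((\<Sum>\<beta>\<in>B. s \<beta> powr p) / C) + (1 - 1 / p))"
    using n unfolding sum_distrib_left[symmetric] sum.distrib sum_divide_distrib[symmetric] by (simp add: n_def)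
  also have "\<dots> \<le> n powr (1 - 1 / p) * C powr (1 / p) * ((1 / p) * 1 + (1 - 1 / p))"
    using C p by (intro mult_left_mono add_mono) auto
  finally show ?thesis by (simp add: n_def)
qed

definition joint_block :: "nat \<Rightarrow> (nat \<Rightarrow> nat set) \<Rightarrow> nat set" where
  "joint_block m U = (\<Union>k<m. U k)"

definition traces :: "nat \<Rightarrow> nat set \<Rightarrow> (nat \<Rightarrow> nat) set \<Rightarrow> (nat \<Rightarrow> nat) set" where
  "traces N V A = restr N V ` A"

definition fibre_poly :: "nat \<Rightarrow> nat set \<Rightarrow> (nat \<Rightarrow> nat) set \<Rightarrow> ((nat \<Rightarrow> nat) \<Rightarrow> complex) \<Rightarrow>
    (nat \<Rightarrow> nat) \<Rightarrow> (nat \<Rightarrow> complex) \<Rightarrow> complex" where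
  "fibre_poly N V A a \<beta> = trig_poly N {\<alpha>\<in>A. restr N V \<alpha> = \<beta>} a"

context
  fixes q N m d :: nat and A :: "(nat \<Rightarrow> nat) set" and U :: "nat \<Rightarrow> nat set"
    and a :: "(nat \<Rightarrow> nat) \<Rightarrow> complex" and S :: real
  assumes q: "q \<ge> 1" and m: "m \<ge> 1" and A: "A \<subseteq> multi_indices q N"
    and U: "\<And>k. k < m \<Longrightarrow> U k \<subseteq> {1..N}"
    and disj: "\<And>k l. k < m \<Longrightarrow> l < m \<Longrightarrow> k \<noteq> l \<Longrightarrow> U k \<inter> U l = {}"
    and one: "\<And>\<alpha> k. \<alpha> \<in> A \<Longrightarrow> k < m \<Longrightarrow> card (index_supp N \<alpha> \<inter> U k) = 1"
    and deg: "\<And>\<alpha>. \<alpha> \<in> A \<Longrightarrow> card (index_supp N \<alpha>) = d"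
    and S: "S > 0" "\<And>x. x \<in> cube q N \<Longrightarrow> cmod (trig_poly N A a x) \<le> S"
begin

abbreviation (input) "V \<equiv> joint_block m U"
abbreviation (input) "B \<equiv> traces N V A"
abbreviation (input) "G \<equiv> fibre_poly N V A a"

lemma finite_spectrum: "finite A" using A finite_multi_indices finite_subset by blast
lemma finite_traces: "finite B" using finite_spectrum by (simp add: traces_def)
lemma joint_block_subset: "V \<subseteq> {1..N}" using U by (auto simp: joint_block_def)
lemma traces_subset: "B \<subseteq> multi_indices q N" using A q by (auto simp: traces_def intro: restr_in_multi_indices)

lemma card_supp_joint_block: "\<alpha> \<in> A \<Longrightarrow> card (index_supp N \<alpha> \<inter> V) = m"
proof -
  assume \<alpha>: "\<alpha> \<in> A"
  have "card (\<Union>k<m. index_supp N \<alpha> \<inter> U k) = (\<Sum>k<m. card (index_supp N \<alpha> \<inter> U k))"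
    by (rule card_UN_disjoint) (use disj in \<open>auto simp: index_supp_def\<close>)
  also have "\<dots> = m" using one[OF \<alpha>] by simp
  finally show ?thesis unfolding joint_block_def Int_UN_distrib .
qed

lemma card_supp_traces: "\<beta> \<in> B \<Longrightarrow> card (index_supp N \<beta>) = m"
  using card_supp_joint_block by (auto simp: traces_def index_supp_restr)

lemma restr_restr_joint_block: "k < m \<Longrightarrow> restr N (U k) (restr N V \<alpha>) = restr N (U k) \<alpha>"
proof -
  assume "k < m"
  then have "V \<inter> U k = U k" by (auto simp: joint_block_def)
  then show ?thesis by (simp add: restr_restr)
qed

lemma trig_poly_fibre_poly: "trig_poly N B (\<lambda>\<beta>. G \<beta> x) y = trig_poly N A a (rotate_on V y x)"
  unfolding traces_def fibre_poly_def by (rule trig_poly_rotate_on[OF finite_spectrum, symmetric])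

text \<open>The mixed-norm hypothesis of the Blei inequality for block k. The inner square sum
  becomes the mean over an auxiliary point \<open>y\<close> of |h|; for fixed \<open>y\<close> the
  numbers h are the coefficients of a polynomial with one support point per term, bounded by
  \<open>S\<close>, so their moduli sum to at most 2 q S.\<close>

lemma sum_block_le:
  assumes k: "k < m" and x: "x \<in> cube q N"
  shows "(\<Sum>\<iota>\<in>restr N (U k) ` B. sqrt (\<Sum>\<beta>\<in>{\<beta>\<in>B. restr N (U k) \<beta> = \<iota>}. (cmod (G \<beta> x))\<^sup>2))
    \<le> (4 * real q) ^ m * (2 * real q * S)"
proof -
  define h where "h \<iota> = trig_poly N {\<beta>\<in>B. restr N (U k) \<beta> = \<iota>} (\<lambda>\<beta>. G \<beta> x)" for \<iota>
  have "(\<Sum>\<iota>\<in>restr N (U k) ` B. sqrt (\<Sum>\<beta>\<in>{\<beta>\<in>B. restr N (U k) \<beta> = \<iota>}. (cmod (G \<beta> x))\<^sup>2))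
      \<le> (\<Sum>\<iota>\<in>restr N (U k) ` B. (4 * real q) ^ m * mean q N (\<lambda>y. cmod (h \<iota> y)))"
  proof (rule sum_mono)
    fix \<iota>
    \<comment> \<open>Exponent p = 1 in the variable \<open>y\<close>, where the degree is only m:
      the constant (4 q)^m does not involve d.\<close>
    have "(\<Sum>\<beta>\<in>{\<beta>\<in>B. restr N (U k) \<beta> = \<iota>}. (cmod (G \<beta> x))\<^sup>2) powr (1 / 2)
        \<le> (4 * real q) powr (real m * (2 - 1)) * mean q N (\<lambda>y. cmod (h \<iota> y) powr 1)"
      unfolding h_def using traces_subset card_supp_traces by (intro trig_poly_square_le_powr[OF q]) auto
    then show "sqrt (\<Sum>\<beta>\<in>{\<beta>\<in>B. restr N (U k) \<beta> = \<iota>}. (cmod (G \<beta> x))\<^sup>2)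
        \<le> (4 * real q) ^ m * mean q N (\<lambda>y. cmod (h \<iota> y))"
      using q powr_realpow[of "4 * real q" m] by (simp add: powr_half_sqrt sum_nonneg)
  qed
  also have "\<dots> = (4 * real q) ^ m * mean q N (\<lambda>y. \<Sum>\<iota>\<in>restr N (U k) ` B. cmod (h \<iota> y))"
    by (simp only: mean_sum sum_distrib_left)
  also have "\<dots> \<le> (4 * real q) ^ m * mean q N (\<lambda>y. 2 * real q * S)"
  proof (intro mult_left_mono mean_mono sum_coeffs_single_support)
    fix y assume y: "y \<in> cube q N"
    show "restr N (U k) ` B \<subseteq> multi_indices q N"
      using traces_subset q by (auto intro: restr_in_multi_indices)
    show "card (index_supp N \<iota>) = 1" if "\<iota> \<in> restr N (U k) ` B" for \<iota>
      using that one k by (auto simp: traces_def restr_restr_joint_block[OF k] index_supp_restr)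
    show "cmod (trig_poly N (restr N (U k) ` B) (\<lambda>\<iota>. h \<iota> y) z) \<le> S" if z: "z \<in> cube q N" for z
    proof -
      \<comment> \<open>Rotating block k once more, by \<open>z\<close>, exhibits the numbers h as
        coefficients in \<open>z\<close>; the value stays one of the original polynomial at a point
        of the cube.\<close>
      have "trig_poly N (restr N (U k) ` B) (\<lambda>\<iota>. h \<iota> y) z = trig_poly N A a (rotate_on V (rotate_on (U k) z y) x)"
        unfolding h_def trig_poly_fibre_poly[symmetric] by (rule trig_poly_rotate_on[OF finite_traces, symmetric])
      then show ?thesis using S(2) rotate_on_in_cube[OF q] x y z joint_block_subset U[OF k] by simp
    qed
  qed (use q in auto)
  finally show ?thesis using q by (simp add: mean_const)
qed

lemma sum_fibre_poly_powr_le: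
  assumes x: "x \<in> cube q N"
  shows "(\<Sum>\<beta>\<in>B. cmod (G \<beta> x) powr (2 * m / (m + 1))) \<le> ((4 * real q) ^ m * (2 * real q * S)) powr (2 * m / (m + 1))"
proof (rule Blei_inequality[OF finite_traces m, where \<rho> = "\<lambda>k. restr N (U k)"])
  show "0 < (4 * real q) ^ m * (2 * real q * S)" using S q by simp
  show "\<beta> = \<gamma>" if \<beta>: "\<beta> \<in> B" and \<gamma>: "\<gamma> \<in> B" and eq: "\<And>k. k < m \<Longrightarrow> restr N (U k) \<beta> = restr N (U k) \<gamma>" for \<beta> \<gamma>
  proof (rule multi_index_eqI[of _ q N])
    fix j assume j: "j \<in> {1..N}"
    show "\<beta> j = \<gamma> j"
    proof (cases "j \<in> V")
      case True
      then obtain k where "k < m" "j \<in> U k" by (auto simp: joint_block_def)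
      then show ?thesis using fun_cong[OF eq, of k j] j by (simp add: restr_def)
    next
      case False
      then show ?thesis using \<beta> \<gamma> j by (auto simp: traces_def restr_def)
    qed
  qed (use \<beta> \<gamma> traces_subset in auto)
qed (use sum_block_le[OF _ x] in auto)

text \<open>Cauchy-Schwarz inside each fibre costs sqrt F. The square norm of a fibre is compared
  with the p-th mean of its polynomial, to which the pointwise Blei bound applies after exchanging
  sum and mean; Hoelder over the traces returns from exponent p to 1.\<close>

lemma sum_coeffs_block_le:
  assumes F: "\<And>\<beta>. \<beta> \<in> B \<Longrightarrow> real (card {\<alpha>\<in>A. restr N V \<alpha> = \<beta>}) \<le> F" "F \<ge> 0"
  shows "(\<Sum>\<alpha>\<in>A. cmod (a \<alpha>)) \<le> sqrt F * (card B powr ((m - 1) / (2 * m)) *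
      ((4 * real q) powr (d / m) * ((4 * real q) ^ m * (2 * real q * S))))"
proof (cases "A = {}")
  case True
  then show ?thesis using S F q by simp
next
  case False
  define p where "p = 2 * m / (m + 1)"
  define \<Lambda> where "\<Lambda> = (4 * real q) ^ m * (2 * real q * S)"
  define s where "s \<beta> = sqrt (\<Sum>\<alpha>\<in>{\<alpha>\<in>A. restr N V \<alpha> = \<beta>}. (cmod (a \<alpha>))\<^sup>2)" for \<beta>
  have p: "1 \<le> p" "0 < p" "p < 2" using m by (auto simp: p_def field_simps)
  have \<Lambda>: "\<Lambda> > 0" using S q by (simp add: \<Lambda>_def)
  have s0: "s \<beta> \<ge> 0" for \<beta> by (simp add: s_def sum_nonneg)
  have s_powr: "s \<beta> powr p \<le> (4 * real q) powr (d * (2 - p)) * mean q N (\<lambda>x. cmod (G \<beta> x) powr p)" for \<beta>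
  proof -
    have "s \<beta> powr p = (\<Sum>\<alpha>\<in>{\<alpha>\<in>A. restr N V \<alpha> = \<beta>}. (cmod (a \<alpha>))\<^sup>2) powr (p / 2)"
      unfolding s_def by (simp add: powr_half_sqrt[symmetric] powr_powr sum_nonneg)
    also have "\<dots> \<le> (4 * real q) powr (d * (2 - p)) * mean q N (\<lambda>x. cmod (G \<beta> x) powr p)"
      unfolding fibre_poly_def using A deg p by (intro trig_poly_square_le_powr[OF q]) auto
    finally show ?thesis .
  qed
  have "(\<Sum>\<beta>\<in>B. s \<beta> powr p) \<le> (\<Sum>\<beta>\<in>B. (4 * real q) powr (d * (2 - p)) * mean q N (\<lambda>x. cmod (G \<beta> x) powr p))"
    by (intro sum_mono s_powr)
  also have "\<dots> = (4 * real q) powr (d * (2 - p)) * mean q N (\<lambda>x. \<Sum>\<beta>\<in>B. cmod (G \<beta> x) powr p)"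
    by (simp only: mean_sum sum_distrib_left)
  also have "\<dots> \<le> (4 * real q) powr (d * (2 - p)) * mean q N (\<lambda>x. \<Lambda> powr p)"
    unfolding p_def \<Lambda>_def by (intro mult_left_mono mean_mono sum_fibre_poly_powr_le) auto
  finally have "(\<Sum>\<beta>\<in>B. s \<beta> powr p) \<le> (4 * real q) powr (d * (2 - p)) * \<Lambda> powr p"
    using q by (simp add: mean_const)
  then have "(\<Sum>\<beta>\<in>B. s \<beta>) \<le> card B powr (1 - 1 / p) * ((4 * real q) powr (d * (2 - p)) * \<Lambda> powr p) powr (1 / p)"
    using finite_traces False s0 p \<Lambda> q by (intro sum_le_of_sum_powr_le) (auto simp: traces_def)
  also have "((4 * real q) powr (d * (2 - p)) * \<Lambda> powr p) powr (1 / p) = (4 * real q) powr (d * ((2 - p) / p)) * \<Lambda>"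
    using p \<Lambda> by (simp add: powr_mult powr_powr)
  \<comment> \<open>The identity behind the choice of p: comparing moments in degree d costs only (4
    q)^(d/m).\<close>
  also have "(2 - p) / p = 1 / m"
  proof -
    have "2 - p = 2 / (m + 1)" by (simp add: p_def field_simps)
    then have "(2 - p) * m = p" by (simp only: p_def) simp
    then show ?thesis using m p(2) by (simp add: frac_eq_eq)
  qed
  also have "1 - 1 / p = (m - 1) / (2 * m)" using m by (simp add: p_def field_simps of_nat_diff)
  finally have s_sum: "(\<Sum>\<beta>\<in>B. s \<beta>) \<le> card B powr ((m - 1) / (2 * m)) * ((4 * real q) powr (d / m) * \<Lambda>)"
    by simp
  have "(\<Sum>\<alpha>\<in>A. cmod (a \<alpha>)) = (\<Sum>\<beta>\<in>B. \<Sum>\<alpha>\<in>{\<alpha>\<in>A. restr N V \<alpha> = \<beta>}. cmod (a \<alpha>))"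
    unfolding traces_def using finite_spectrum by (intro sum.group[symmetric]) auto
  also have "\<dots> \<le> (\<Sum>\<beta>\<in>B. sqrt F * s \<beta>)"
  proof (rule sum_mono)
    fix \<beta> assume \<beta>: "\<beta> \<in> B"
    show "(\<Sum>\<alpha>\<in>{\<alpha>\<in>A. restr N V \<alpha> = \<beta>}. cmod (a \<alpha>)) \<le> sqrt F * s \<beta>"
    proof (rule power2_le_imp_le)
      have "(\<Sum>\<alpha>\<in>{\<alpha>\<in>A. restr N V \<alpha> = \<beta>}. 1 * cmod (a \<alpha>))\<^sup>2
          \<le> (\<Sum>\<alpha>\<in>{\<alpha>\<in>A. restr N V \<alpha> = \<beta>}. 1\<^sup>2) * (\<Sum>\<alpha>\<in>{\<alpha>\<in>A. restr N V \<alpha> = \<beta>}. (cmod (a \<alpha>))\<^sup>2)"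
        by (rule Cauchy_Schwarz_ineq_sum)
      also have "\<dots> \<le> F * (\<Sum>\<alpha>\<in>{\<alpha>\<in>A. restr N V \<alpha> = \<beta>}. (cmod (a \<alpha>))\<^sup>2)"
        using F(1)[OF \<beta>] by (intro mult_right_mono sum_nonneg) auto
      finally show "(\<Sum>\<alpha>\<in>{\<alpha>\<in>A. restr N V \<alpha> = \<beta>}. cmod (a \<alpha>))\<^sup>2 \<le> (sqrt F * s \<beta>)\<^sup>2"
        using F(2) by (simp add: power_mult_distrib s_def sum_nonneg)
    qed (use F(2) s0 in auto)
  qed
  also have "\<dots> \<le> sqrt F * (card B powr ((m - 1) / (2 * m)) * ((4 * real q) powr (d / m) * \<Lambda>))"
    unfolding sum_distrib_left[symmetric] using s_sum F(2) by (intro mult_left_mono) auto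
  finally show ?thesis unfolding \<Lambda>_def .
qed

lemma card_traces_le: "card B \<le> card {\<beta>\<in>multi_indices q N. card (index_supp N \<beta>) = m}"
  using traces_subset card_supp_traces by (intro card_mono) auto

text \<open>An element of a fibre is recovered from its part off the blocks, which has d - m support
  points since the blocks take exactly m.\<close>

lemma card_fibre_le:
  "card {\<alpha>\<in>A. restr N V \<alpha> = \<beta>} \<le> card {\<gamma>\<in>multi_indices q N. card (index_supp N \<gamma>) = d - m}"
proof (rule card_inj_on_le[of "restr N (- V)"])
  show "inj_on (restr N (- V)) {\<alpha>\<in>A. restr N V \<alpha> = \<beta>}"
  proof (rule inj_onI)
    fix \<alpha> \<gamma> assume \<alpha>: "\<alpha> \<in> {\<alpha>\<in>A. restr N V \<alpha> = \<beta>}" and \<gamma>: "\<gamma> \<in> {\<alpha>\<in>A. restr N V \<alpha> = \<beta>}"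
      and eq: "restr N (- V) \<alpha> = restr N (- V) \<gamma>"
    have eq': "restr N V \<alpha> = restr N V \<gamma>" using \<alpha> \<gamma> by simp
    show "\<alpha> = \<gamma>"
    proof (rule multi_index_eqI[of _ q N])
      show "\<alpha> j = \<gamma> j" if "j \<in> {1..N}" for j
        using fun_cong[OF eq, of j] fun_cong[OF eq', of j] that by (cases "j \<in> V") (auto simp: restr_def)
    qed (use \<alpha> \<gamma> A in auto)
  qed
  show "restr N (- V) ` {\<alpha>\<in>A. restr N V \<alpha> = \<beta>} \<subseteq> {\<gamma>\<in>multi_indices q N. card (index_supp N \<gamma>) = d - m}"
  proof safe
    fix \<alpha> assume \<alpha>: "\<alpha> \<in> A"
    show "restr N (- V) \<alpha> \<in> multi_indices q N" using \<alpha> A q by (auto intro: restr_in_multi_indices)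
    have fin: "finite (index_supp N \<alpha>)" by (simp add: index_supp_def)
    have "index_supp N \<alpha> \<inter> - V = index_supp N \<alpha> - index_supp N \<alpha> \<inter> V" by auto
    then show "card (index_supp N (restr N (- V) \<alpha>)) = d - m"
      using card_supp_joint_block[OF \<alpha>] deg[OF \<alpha>] fin by (simp add: index_supp_restr card_Diff_subset)
  qed
qed simp

end

lemma card_multi_indices_supp:
  assumes "q \<ge> 1"
  shows "card {\<alpha>\<in>multi_indices q N. card (index_supp N \<alpha>) = k} = (N choose k) * (q - 1) ^ k"
proof -
  define T where "T = {T. T \<subseteq> {1..N} \<and> card T = k}"
  have finT: "finite T" unfolding T_def by simp
  have "card {\<alpha>\<in>multi_indices q N. index_supp N \<alpha> = s} = (q - 1) ^ k" if s: "s \<in> T" for s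
  proof -
    have "{\<alpha>\<in>multi_indices q N. index_supp N \<alpha> = s} = (\<Pi>\<^sub>E j\<in>{1..N}. if j \<in> s then {1..<q} else {0})"
    proof (intro equalityI subsetI)
      fix \<alpha> assume "\<alpha> \<in> {\<alpha>\<in>multi_indices q N. index_supp N \<alpha> = s}"
      then show "\<alpha> \<in> (\<Pi>\<^sub>E j\<in>{1..N}. if j \<in> s then {1..<q} else {0})"
        by (auto simp: multi_indices_def index_supp_def PiE_iff)
    next
      fix \<alpha> assume \<alpha>: "\<alpha> \<in> (\<Pi>\<^sub>E j\<in>{1..N}. if j \<in> s then {1..<q} else {0})"
      have *: "\<alpha> j \<in> (if j \<in> s then {1..<q} else {0})" if "j \<in> {1..N}" for j
        using \<alpha> that by (rule PiE_mem)
      have "\<alpha> \<in> multi_indices q N"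
        using \<alpha> * assms unfolding multi_indices_def PiE_iff by (fastforce split: if_splits)
      moreover have "index_supp N \<alpha> = s"
        using * s by (fastforce simp: index_supp_def T_def split: if_splits)
      ultimately show "\<alpha> \<in> {\<alpha>\<in>multi_indices q N. index_supp N \<alpha> = s}" by simp
    qed
    also have "card \<dots> = (\<Prod>j\<in>{1..N}. card (if j \<in> s then {1..<q} else {0}))"
      by (rule card_PiE) simp
    also have "\<dots> = (\<Prod>j\<in>{1..N}. if j \<in> s then q - 1 else 1)" by (intro prod.cong) auto
    also have "\<dots> = (\<Prod>j\<in>s. q - 1)"
      using s by (subst prod.inter_restrict[symmetric]) (auto simp: T_def Int_absorb1)
    finally show ?thesis using s by (simp add: T_def)
  qed
  moreover have "card {\<alpha>\<in>multi_indices q N. card (index_supp N \<alpha>) = k}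
      = (\<Sum>s\<in>T. card {\<alpha>\<in>multi_indices q N. index_supp N \<alpha> = s})"
  proof -
    have "{\<alpha>\<in>multi_indices q N. card (index_supp N \<alpha>) = k} = (\<Union>s\<in>T. {\<alpha>\<in>multi_indices q N. index_supp N \<alpha> = s})"
      by (auto simp: T_def index_supp_def)
    also have "card \<dots> = (\<Sum>s\<in>T. card {\<alpha>\<in>multi_indices q N. index_supp N \<alpha> = s})"
      using finT by (intro card_UN_disjoint) auto
    finally show ?thesis .
  qed
  moreover have "card T = N choose k" unfolding T_def using n_subsets[of "{1..N}" k] by simp
  ultimately show ?thesis by simp
qed

section \<open>Random colourings and the Sidon inequality\<close>

text \<open>A colouring is good if m chosen points of \<open>T\<close> carry the colours 0, ..., m -
  1 bijectively and the rest of \<open>T\<close> avoids them. Already for one fixed choice this has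
  probability D^(-m) (1 - m/D)^(d - m).\<close>

lemma card_colourings_ge:
  fixes d m N :: nat
  assumes T: "T \<subseteq> {1..N}" "card T = d" and m: "1 \<le> m" "m \<le> d" and D: "D = 2 * d * m"
  shows "real D ^ N \<le> 2 * real D ^ m *
    real (card {s \<in> {1..N} \<rightarrow>\<^sub>E {..<D}. \<forall>k<m. card (T \<inter> {j\<in>{1..N}. s j = k}) = 1})"
proof -
  have finT: "finite T" using T(1) finite_subset by blast
  have mD: "m \<le> D" "D > 0" using m D by (auto intro: le_trans[OF _ mult_le_mono])
  obtain T' where T': "T' \<subseteq> T" "card T' = m" "finite T'"
    using obtain_subset_with_card_n[of m T] m T by auto
  obtain g where g: "bij_betw g T' {0..<m}"
    using ex_bij_betw_finite_nat[OF T'(3)] T'(2) by auto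
  \<comment> \<open>Coordinates outside \<open>T\<close> are unrestricted; writing the event as a
    product set makes its size a product.\<close>
  define P where "P = (\<Pi>\<^sub>E j\<in>{1..N}. if j \<in> T' then {g j} else if j \<in> T then {m..<D} else {..<D})"
  define Z where "Z = {s \<in> {1..N} \<rightarrow>\<^sub>E {..<D}. \<forall>k<m. card (T \<inter> {j\<in>{1..N}. s j = k}) = 1}"
  have finZ: "finite Z"
    unfolding Z_def by (rule finite_subset[of _ "{1..N} \<rightarrow>\<^sub>E {..<D}"]) (auto intro: finite_PiE)
  have "P \<subseteq> Z"
  proof
    fix s assume s: "s \<in> P"
    have sj: "s j \<in> (if j \<in> T' then {g j} else if j \<in> T then {m..<D} else {..<D})" if "j \<in> {1..N}" for j
      using s that unfolding P_def by (rule PiE_mem)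
    have gm: "g j < m" if "j \<in> T'" for j using g that by (auto simp: bij_betw_def)
    have "s j \<in> {..<D}" if "j \<in> {1..N}" for j
      using sj[OF that] gm[of j] mD by (auto split: if_splits)
    then have "s \<in> {1..N} \<rightarrow>\<^sub>E {..<D}" using s unfolding P_def PiE_iff by auto
    moreover have "card (T \<inter> {j\<in>{1..N}. s j = k}) = 1" if k: "k < m" for k
    proof -
      obtain i where i: "i \<in> T'" "g i = k" using bij_betw_apply[OF bij_betw_inv_into[OF g], of k]
        bij_betw_inv_into_right[OF g, of k] k by auto
      have "T \<inter> {j\<in>{1..N}. s j = k} = {i}"
      proof (intro equalityI subsetI)
        fix j assume j: "j \<in> T \<inter> {j\<in>{1..N}. s j = k}"
        then have "j \<in> T'" using sj[of j] k by (auto split: if_splits)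
        then have "g j = g i" using sj[of j] j i by auto
        then show "j \<in> {i}" using g i \<open>j \<in> T'\<close> by (auto simp: bij_betw_def inj_on_def)
      next
        fix j assume "j \<in> {i}"
        then show "j \<in> T \<inter> {j\<in>{1..N}. s j = k}" using i T'(1) T(1) sj[of i] by auto
      qed
      then show ?thesis by simp
    qed
    ultimately show "s \<in> Z" by (simp add: Z_def)
  qed
  then have "card P \<le> card Z" using finZ by (intro card_mono)
  moreover have "card P = (D - m) ^ (d - m) * D ^ (N - d)"
  proof -
    have "card P = (\<Prod>j\<in>{1..N}. card (if j \<in> T' then {g j} else if j \<in> T then {m..<D} else {..<D}))"
      unfolding P_def by (rule card_PiE) simp
    also have "\<dots> = (\<Prod>j\<in>{1..N}. if j \<in> T - T' then D - m else if j \<in> {1..N} - T then D else 1)"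
      using T'(1) T(1) by (intro prod.cong) auto
    also have "\<dots> = (\<Prod>j\<in>{1..N}. (if j \<in> T - T' then D - m else 1) * (if j \<in> {1..N} - T then D else 1))"
      by (intro prod.cong) auto
    also have "\<dots> = (\<Prod>j\<in>{1..N} \<inter> (T - T'). D - m) * (\<Prod>j\<in>{1..N} \<inter> ({1..N} - T). D)"
      by (simp only: prod.distrib prod.inter_restrict[OF finite_atLeastAtMost])
    also have "{1..N} \<inter> (T - T') = T - T'" using T(1) by auto
    also have "{1..N} \<inter> ({1..N} - T) = {1..N} - T" by auto
    finally show ?thesis
      using T T' finT by (simp add: card_Diff_subset)
  qed
  moreover have "real D ^ (d - m) \<le> 2 * real (D - m) ^ (d - m)"
  proof -
    \<comment> \<open>D = 2 d m is chosen for this: (d - m) m / D \<le> 1/2, so Bernoulli's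
      inequality keeps (1 - m/D)^(d - m) at least 1/2.\<close>
    have "1 / 2 \<le> 1 + real (d - m) * (- (m / D))"
    proof -
      have "real (d - m) * real m \<le> real d * real m" by (intro mult_right_mono) auto
      moreover have "real D = 2 * (real d * real m)" unfolding D by simp
      ultimately have "2 * (real (d - m) * real m) \<le> real D" by linarith
      then have "real (d - m) * (m / D) \<le> 1 / 2" using mD(2) by (simp add: field_simps)
      then show ?thesis by linarith
    qed
    also have "\<dots> \<le> (1 + - (m / D)) ^ (d - m)"
      using mD by (intro Bernoulli_inequality) (simp add: field_simps)
    also have "1 + - (m / D) = real (D - m) / real D"
      using mD by (simp add: field_simps of_nat_diff)
    finally show ?thesis using mD by (simp add: power_divide field_simps)
  qed
  moreover have "real D ^ N = real D ^ m * (real D ^ (d - m) * real D ^ (N - d))"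
  proof -
    have "d \<le> N" using T card_mono[of "{1..N}" T] by simp
    then have "N = m + ((d - m) + (N - d))" using m by simp
    then show ?thesis by (metis power_add)
  qed
  ultimately have "real D ^ N \<le> real D ^ m * ((2 * real (D - m) ^ (d - m)) * real D ^ (N - d))"
    by (simp add: mult_left_mono mult_right_mono)
  also have "\<dots> = 2 * real D ^ m * real (card P)"
    unfolding \<open>card P = _\<close> by simp
  also have "\<dots> \<le> 2 * real D ^ m * real (card Z)"
    using \<open>card P \<le> card Z\<close> by (intro mult_left_mono) auto
  finally show ?thesis unfolding Z_def .
qed

text \<open>Double counting of pairs (multi-index, good colouring). Only the first m of the D
  colours serve as blocks; the others hold the leftover coordinates, and the price of this is a
  power of d.\<close>

lemma sum_le_by_colouring:
  fixes d m N :: nat and X :: real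
  assumes A: "finite A" "\<And>\<alpha>. \<alpha> \<in> A \<Longrightarrow> card (index_supp N \<alpha>) = d" and m: "1 \<le> m" "m \<le> d"
    and w: "\<And>\<alpha>. \<alpha> \<in> A \<Longrightarrow> w \<alpha> \<ge> 0"
    and X: "\<And>s. (\<Sum>\<alpha>\<in>{\<alpha>\<in>A. \<forall>k<m. card (index_supp N \<alpha> \<inter> {j\<in>{1..N}. s j = k}) = 1}. w \<alpha>) \<le> X"
  shows "(\<Sum>\<alpha>\<in>A. w \<alpha>) \<le> 2 * real (2 * d * m) ^ m * X"
proof -
  define D where "D = 2 * d * m"
  define Z where "Z = {1..N} \<rightarrow>\<^sub>E {..<D}"
  define good where "good \<alpha> s \<longleftrightarrow> (\<forall>k<m. card (index_supp N \<alpha> \<inter> {j\<in>{1..N}. s j = k}) = 1)" for \<alpha> and s :: "nat \<Rightarrow> nat"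
  have finZ: "finite Z" by (auto simp: Z_def intro: finite_PiE)
  have D: "D > 0" using m by (simp add: D_def)
  have "real D ^ N * (\<Sum>\<alpha>\<in>A. w \<alpha>) \<le> (\<Sum>\<alpha>\<in>A. 2 * real D ^ m * real (card {s\<in>Z. good \<alpha> s}) * w \<alpha>)"
    unfolding sum_distrib_left
  proof (intro sum_mono mult_right_mono w)
    fix \<alpha> assume "\<alpha> \<in> A"
    then show "real D ^ N \<le> 2 * real D ^ m * real (card {s\<in>Z. good \<alpha> s})"
      unfolding Z_def good_def using m A(2) by (intro card_colourings_ge) (auto simp: D_def index_supp_def)
  qed
  also have "\<dots> = 2 * real D ^ m * (\<Sum>\<alpha>\<in>A. \<Sum>s\<in>{s\<in>Z. good \<alpha> s}. w \<alpha>)"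
    by (simp add: sum_distrib_left mult.assoc)
  also have "(\<Sum>\<alpha>\<in>A. \<Sum>s\<in>{s\<in>Z. good \<alpha> s}. w \<alpha>) = (\<Sum>s\<in>Z. \<Sum>\<alpha>\<in>{\<alpha>\<in>A. good \<alpha> s}. w \<alpha>)"
    by (rule sum.swap_restrict[OF A(1) finZ])
  also have "2 * real D ^ m * \<dots> \<le> 2 * real D ^ m * (\<Sum>s\<in>Z. X)"
    unfolding good_def by (intro mult_left_mono sum_mono X) auto
  also have "(\<Sum>s\<in>Z. X) = real D ^ N * X" by (simp add: Z_def card_PiE)
  finally have "real D ^ N * (\<Sum>\<alpha>\<in>A. w \<alpha>) \<le> real D ^ N * (2 * real D ^ m * X)" by (simp add: mult_ac)
  then show ?thesis using D by (simp add: D_def)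
qed

text \<open>Each step from e + 1 down to e multiplies the binomial coefficient by (e + 1)/(N - e),
  and N - e \<ge> N/2.\<close>

lemma binomial_diff_le:
  fixes N d m :: nat
  assumes "m \<le> d" "2 * d \<le> N" "d \<ge> 1"
  shows "real (N choose (d - m)) \<le> real (N choose d) * (2 * real d / real N) ^ m"
  using assms(1)
proof (induction m)
  case (Suc m)
  define e where "e = d - Suc m"
  have e: "d - m = Suc e" "Suc e \<le> d" using Suc.prems by (auto simp: e_def)
  have "Suc e * (N choose Suc e) = (N - e) * (N choose e)"
    using times_binomial_minus1_eq[of "Suc e" N] binomial_absorb_comp[of N e] by simp
  then have "real (Suc e) * real (N choose Suc e) = real (N - e) * real (N choose e)"
    by (metis of_nat_mult)
  then have "real (N choose e) = real (N choose Suc e) * (real (Suc e) / real (N - e))"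
    using e assms by (simp add: field_simps)
  also have "\<dots> \<le> real (N choose Suc e) * (2 * real d / real N)"
  proof (intro mult_left_mono)
    have "real N \<le> 2 * real (N - e)" using e assms by simp
    then have "real (Suc e) * real N \<le> real d * (2 * real (N - e))"
      using e by (intro mult_mono) auto
    then show "real (Suc e) / real (N - e) \<le> 2 * real d / real N"
      using e assms by (simp add: field_simps)
  qed simp
  also have "\<dots> \<le> real (N choose d) * (2 * real d / real N) ^ m * (2 * real d / real N)"
    using Suc e by (intro mult_right_mono) auto
  finally show ?case by (simp add: e_def mult_ac)
qed simp

text \<open>The factors stem, in this order, from the colouring, the \<open>m\<close> projections
  onto one support point per block, hypercontractivity for degree \<open>m\<close>, the bound for one block, and the comparison
  of binomial coefficients.\<close>

definition sidon_const :: "nat \<Rightarrow> nat \<Rightarrow> real" where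
  "sidon_const q m = 2 * (2 * real m) ^ m * 26 ^ m * (4 * real q) ^ m * (2 * real q) * 2 ^ m"

text \<open>Here the gain sqrt N appears. From c \<le> n^m with n = N (q - 1), the power of c is at
  most sqrt (n^m / n). The factor n^m turns the count for d - m support points back into that for d,
  up to (2 d)^m, and 1/n remains.\<close>

lemma layer_weight_le:
  fixes q N d m c :: nat
  assumes q: "q \<ge> 2" and m: "1 \<le> m" "m \<le> d" and N: "2 * d \<le> N"
    and c: "c \<le> (N choose m) * (q - 1) ^ m"
  shows "sqrt (real ((N choose (d - m)) * (q - 1) ^ (d - m))) * real c powr ((m - 1) / (2 * m))
    \<le> sqrt (real ((N choose d) * (q - 1) ^ d) / N) * (2 * real d) ^ m"
proof -
  define n where "n = real N * real (q - 1)"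
  have n: "n \<ge> real N" "n > 0" using q m N by (auto simp: n_def)
  have "(N choose m) \<le> N ^ m" using m N by (intro binomial_le_pow) auto
  then have "c \<le> N ^ m * (q - 1) ^ m" using c by (meson le_trans mult_le_mono1)
  then have cn: "real c \<le> n ^ m"
    unfolding n_def power_mult_distrib by (metis of_nat_le_iff of_nat_mult of_nat_power)
  have "real c powr ((m - 1) / (2 * m)) \<le> (n ^ m) powr ((m - 1) / (2 * m))"
    using cn by (intro powr_mono2) auto
  also have "\<dots> = (n powr (m - 1)) powr (1 / 2)"
  proof -
    have "(n ^ m) powr ((m - 1) / (2 * m)) = n powr (m * ((m - 1) / (2 * m)))"
      using n by (simp add: powr_powr flip: powr_realpow)
    then show ?thesis using m by (simp add: powr_powr)
  qed
  also have "\<dots> = sqrt (n ^ m / n)"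
    using n m by (simp add: powr_half_sqrt powr_realpow power_diff del: of_nat_diff)
  finally have "sqrt (real ((N choose (d - m)) * (q - 1) ^ (d - m))) * real c powr ((m - 1) / (2 * m))
      \<le> sqrt (real ((N choose (d - m)) * (q - 1) ^ (d - m))) * sqrt (n ^ m / n)"
    by (intro mult_left_mono) auto
  also have "\<dots> = sqrt (real (N choose (d - m)) * (real (q - 1) ^ (d - m) * (n ^ m / n)))"
    unfolding real_sqrt_mult[symmetric] by (simp add: mult.assoc)
  also have "\<dots> \<le> sqrt (real (N choose d) * (2 * real d / real N) ^ m * (real (q - 1) ^ (d - m) * (n ^ m / n)))"
    using m N n by (intro real_sqrt_le_mono mult_right_mono binomial_diff_le) auto
  also have "real (N choose d) * (2 * real d / real N) ^ m * (real (q - 1) ^ (d - m) * (n ^ m / n))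
      = real (N choose d) * real (q - 1) ^ d / n * (2 * real d) ^ m"
  proof -
    have Q: "real (q - 1) ^ d = real (q - 1) ^ (d - m) * real (q - 1) ^ m"
      using m by (simp flip: power_add)
    have "2 * real d / real N * n = 2 * real d * real (q - 1)"
      using m N unfolding n_def by simp
    then have P: "(2 * real d / real N) ^ m * n ^ m = (2 * real d) ^ m * real (q - 1) ^ m"
      by (simp only: power_mult_distrib[symmetric])
    have "real (N choose d) * (2 * real d / real N) ^ m * (real (q - 1) ^ (d - m) * (n ^ m / n))
        = real (N choose d) * real (q - 1) ^ (d - m) / n * ((2 * real d / real N) ^ m * n ^ m)"
      by (simp only: times_divide_eq_right times_divide_eq_left mult_ac)
    also have "\<dots> = real (N choose d) * real (q - 1) ^ d / n * (2 * real d) ^ m"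
      unfolding P Q by (simp only: times_divide_eq_right times_divide_eq_left mult_ac)
    finally show ?thesis .
  qed
  also have "sqrt \<dots> \<le> sqrt (real ((N choose d) * (q - 1) ^ d) / N) * sqrt (((2 * real d) ^ m)\<^sup>2)"
    unfolding real_sqrt_mult[symmetric]
  proof (intro real_sqrt_le_mono mult_mono)
    show "real (N choose d) * real (q - 1) ^ d / n \<le> real ((N choose d) * (q - 1) ^ d) / N"
      using n m N by (simp add: divide_left_mono)
    \<comment> \<open>Deliberately wasteful, so that the square root disappears; a power of d is
      free.\<close>
    show "(2 * real d) ^ m \<le> ((2 * real d) ^ m)\<^sup>2"
    proof (rule self_le_power)
      show "1 \<le> (2 * real d) ^ m" using m by (intro one_le_power) simp
    qed simp
  qed auto
  also have "sqrt (((2 * real d) ^ m)\<^sup>2) = (2 * real d) ^ m"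
    unfolding real_sqrt_abs by (rule abs_of_nonneg) simp
  finally show ?thesis .
qed

text \<open>The power d^(5 m) collects d^m from the colouring, d^(3 m) from the projections and d^m
  from comparing binomial coefficients.\<close>

theorem sidon_inequality:
  fixes q N d m :: nat
  assumes q: "q \<ge> 2" and m: "1 \<le> m" "m \<le> d" and N: "2 * d \<le> N"
    and A: "A \<subseteq> multi_indices q N" "\<And>\<alpha>. \<alpha> \<in> A \<Longrightarrow> card (index_supp N \<alpha>) = d"
    and S: "S > 0" "\<And>x. x \<in> cube q N \<Longrightarrow> cmod (trig_poly N A a x) \<le> S"
  shows "(\<Sum>\<alpha>\<in>A. cmod (a \<alpha>)) \<le> sidon_const q m * real d ^ (5 * m) * (4 * real q) powr (d / m) *
     sqrt (real ((N choose d) * (q - 1) ^ d) / N) * S"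
proof -
  have q1: "q \<ge> 1" using q by simp
  have finA: "finite A" using A(1) finite_multi_indices finite_subset by blast
  define W where "W = sqrt (real ((N choose d) * (q - 1) ^ d) / N)"
  define S' where "S' = (26 * real d ^ 3) ^ m * S"
  define X where "X = W * (2 * real d) ^ m * ((4 * real q) powr (d / m) * ((4 * real q) ^ m * (2 * real q * S')))"
  have S': "S' > 0" using S m by (simp add: S'_def)
  have "(\<Sum>\<alpha>\<in>A. cmod (a \<alpha>)) \<le> 2 * real (2 * d * m) ^ m * X"
  proof (rule sum_le_by_colouring[OF finA A(2) m])
    fix s :: "nat \<Rightarrow> nat"
    define U where "U k = {j\<in>{1..N}. s j = k}" for k
    \<comment> \<open>For each colouring the projection onto \<open>A'\<close> keeps a sup bound,
      now \<open>S'\<close>, that is independent of the colouring, as the averaging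
      requires.\<close>
    define A' where "A' = {\<alpha>\<in>A. \<forall>k<m. card (index_supp N \<alpha> \<inter> U k) = 1}"
    have A': "A' \<subseteq> multi_indices q N" using A(1) by (auto simp: A'_def)
    have U: "U k \<subseteq> {1..N}" for k by (auto simp: U_def)
    have disj: "U k \<inter> U l = {}" if "k \<noteq> l" for k l using that by (auto simp: U_def)
    have one: "card (index_supp N \<alpha> \<inter> U k) = 1" if "\<alpha> \<in> A'" "k < m" for \<alpha> k
      using that by (simp add: A'_def)
    have deg: "card (index_supp N \<alpha>) = d" if "\<alpha> \<in> A'" for \<alpha> using that A(2) by (simp add: A'_def)
    have bound: "cmod (trig_poly N A' a x) \<le> S'" if "x \<in> cube q N" for x
      unfolding A'_def S'_def using A S m that U by (intro trig_poly_one_in_blocks[OF q1]) auto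
    define c where "c = card (restr N (\<Union>k<m. U k) ` A')"
    have c_eq: "c = card (traces N (joint_block m U) A')" by (simp add: c_def traces_def joint_block_def)
    have c: "c \<le> (N choose m) * (q - 1) ^ m"
      unfolding c_eq card_multi_indices_supp[OF q1, symmetric]
      by (rule card_traces_le[of q m A' N U d S' a]) (use q1 m(1) A' U disj one deg S' bound in auto)
    have "(\<Sum>\<alpha>\<in>A'. cmod (a \<alpha>))
      \<le> sqrt (real ((N choose (d - m)) * (q - 1) ^ (d - m))) * (c powr ((m - 1) / (2 * m)) *
         ((4 * real q) powr (d / m) * ((4 * real q) ^ m * (2 * real q * S'))))"
      unfolding c_eq
    proof (rule sum_coeffs_block_le[of q m A' N U d S' a])
      show "real (card {\<alpha>\<in>A'. restr N (joint_block m U) \<alpha> = \<beta>}) \<le> real ((N choose (d - m)) * (q - 1) ^ (d - m))" for \<beta>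
        unfolding card_multi_indices_supp[OF q1, symmetric] of_nat_le_iff
        by (rule card_fibre_le[of q m A' N U d S' a]) (use q1 m(1) A' U disj one deg S' bound in auto)
    qed (use q1 m(1) A' U disj one deg S' bound in auto)
    also have "\<dots> \<le> X"
      unfolding X_def W_def mult.assoc[symmetric, of "sqrt _" "real c powr _"]
      using S' by (intro mult_right_mono layer_weight_le q m N c) auto
    finally show "(\<Sum>\<alpha>\<in>{\<alpha>\<in>A. \<forall>k<m. card (index_supp N \<alpha> \<inter> {j\<in>{1..N}. s j = k}) = 1}. cmod (a \<alpha>)) \<le> X"
      unfolding A'_def U_def .
  qed auto
  also have "2 * real (2 * d * m) ^ m * X = sidon_const q m * real d ^ (5 * m) * (4 * real q) powr (d / m) * W * S"
  proof -
    have "real d ^ (5 * m) = real d ^ m * (real d ^ 3) ^ m * real d ^ m"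
      by (simp flip: power_mult power_add)
    then show ?thesis
      unfolding X_def S'_def sidon_const_def of_nat_mult power_mult_distrib by (simp add: mult_ac)
  qed
  finally show ?thesis unfolding W_def .
qed

section \<open>Bounds for the Bohr radius\<close>

text \<open>A weak form of cosh x \<le> exp (x^2 / 2), sufficient for subgaussian tails up to
  constants; quadratic bounds settle |x| \<le> 1, and beyond that both exponentials are at most exp
  (x^2).\<close>

lemma exp_add_exp_minus_le: "exp x + exp (- x) \<le> 2 * exp (x\<^sup>2)" for x :: real
proof -
  have *: "exp y + exp (- y) \<le> 2 * exp (y\<^sup>2)" if y: "y \<ge> 0" for y :: real
  proof (cases "y \<le> 1")
    case True
    have "exp y \<le> 1 + y + y\<^sup>2" using y True by (rule exp_bound)
    moreover have "exp (- y) \<le> 1 - y + y\<^sup>2"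
    proof -
      have "exp (- y) \<le> 1 / (1 + y)"
        using exp_ge_add_one_self[of y] y by (simp add: exp_minus field_simps)
      also have "\<dots> \<le> 1 - y + y\<^sup>2"
        using y by (simp add: field_simps power2_eq_square)
      finally show ?thesis .
    qed
    moreover have "1 + y\<^sup>2 \<le> exp (y\<^sup>2)" by (rule exp_ge_add_one_self)
    ultimately show ?thesis by linarith
  next
    case False
    then have "exp y \<le> exp (y\<^sup>2)" by (simp add: power2_eq_square)
    moreover have "exp (- y) \<le> exp y" using y by simp
    ultimately show ?thesis by linarith
  qed
  show ?thesis using *[of x] *[of "- x"] by (cases "x \<ge> 0") auto
qed

text \<open>Signs are chosen one at a time, so that the exponential moment grows at most as fast as its
  average over both choices.\<close>

lemma signs_exp_moment:
  fixes r :: "'a \<Rightarrow> 't \<Rightarrow> real" and l :: real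
  assumes "finite A" "\<And>\<alpha> t. \<alpha> \<in> A \<Longrightarrow> t \<in> T \<Longrightarrow> \<bar>r \<alpha> t\<bar> \<le> 1"
  shows "\<exists>\<epsilon>. (\<forall>\<alpha>. \<epsilon> \<alpha> \<in> {-1, 1}) \<and>
    (\<Sum>t\<in>T. exp (l * (\<Sum>\<alpha>\<in>A. \<epsilon> \<alpha> * r \<alpha> t))) \<le> card T * exp (l\<^sup>2 * card A)"
  using assms
proof (induction A rule: finite_induct)
  case empty
  show ?case by (rule exI[of _ "\<lambda>_. 1"]) simp
next
  case (insert \<beta> A)
  then obtain \<epsilon> where \<epsilon>: "\<forall>\<alpha>. \<epsilon> \<alpha> \<in> {-1, 1}"
    "(\<Sum>t\<in>T. exp (l * (\<Sum>\<alpha>\<in>A. \<epsilon> \<alpha> * r \<alpha> t))) \<le> card T * exp (l\<^sup>2 * card A)" by auto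
  define s where "s t = exp (l * (\<Sum>\<alpha>\<in>A. \<epsilon> \<alpha> * r \<alpha> t))" for t
  define K where "K = card T * exp (l\<^sup>2 * card (insert \<beta> A))"
  have "(\<Sum>t\<in>T. s t * exp (l * r \<beta> t)) + (\<Sum>t\<in>T. s t * exp (- (l * r \<beta> t)))
      = (\<Sum>t\<in>T. s t * (exp (l * r \<beta> t) + exp (- (l * r \<beta> t))))"
    by (simp add: sum.distrib distrib_left)
  also have "\<dots> \<le> (\<Sum>t\<in>T. s t * (2 * exp (l\<^sup>2)))"
  proof (intro sum_mono mult_left_mono)
    fix t assume t: "t \<in> T"
    have "(r \<beta> t)\<^sup>2 \<le> 1" using insert.prems[of \<beta> t] t by (simp add: abs_square_le_1)
    then have "(l * r \<beta> t)\<^sup>2 \<le> l\<^sup>2" by (simp add: power_mult_distrib mult_left_le)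
    then have "exp ((l * r \<beta> t)\<^sup>2) \<le> exp (l\<^sup>2)" by simp
    then show "exp (l * r \<beta> t) + exp (- (l * r \<beta> t)) \<le> 2 * exp (l\<^sup>2)"
      using exp_add_exp_minus_le[of "l * r \<beta> t"] by linarith
  qed (simp add: s_def)
  also have "\<dots> = 2 * exp (l\<^sup>2) * (\<Sum>t\<in>T. s t)" by (simp flip: sum_distrib_right)
  also have "\<dots> \<le> 2 * exp (l\<^sup>2) * (card T * exp (l\<^sup>2 * card A))"
    using \<epsilon>(2) unfolding s_def by (intro mult_left_mono) auto
  also have "\<dots> = 2 * K"
  proof -
    have "l\<^sup>2 * card (insert \<beta> A) = l\<^sup>2 + l\<^sup>2 * card A"
      using insert.hyps by (simp add: distrib_left)
    then show ?thesis unfolding K_def by (simp add: exp_add)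
  qed
  \<comment> \<open>The two sums add up to at most 2 K, so one of the two signs is
    acceptable.\<close>
  finally have "(\<Sum>t\<in>T. s t * exp (l * r \<beta> t)) \<le> K \<or> (\<Sum>t\<in>T. s t * exp (- (l * r \<beta> t))) \<le> K"
    by linarith
  then obtain \<sigma> :: real where \<sigma>: "\<sigma> \<in> {-1, 1}" "(\<Sum>t\<in>T. s t * exp (\<sigma> * (l * r \<beta> t))) \<le> K"
    by (auto intro: that[of 1] that[of "-1"])
  define \<epsilon>' where "\<epsilon>' = \<epsilon>(\<beta> := \<sigma>)"
  have "(\<Sum>\<alpha>\<in>insert \<beta> A. \<epsilon>' \<alpha> * r \<alpha> t) = \<sigma> * r \<beta> t + (\<Sum>\<alpha>\<in>A. \<epsilon> \<alpha> * r \<alpha> t)" for t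
  proof -
    have "(\<Sum>\<alpha>\<in>A. \<epsilon>' \<alpha> * r \<alpha> t) = (\<Sum>\<alpha>\<in>A. \<epsilon> \<alpha> * r \<alpha> t)"
      using insert.hyps by (intro sum.cong) (auto simp: \<epsilon>'_def)
    then show ?thesis using insert.hyps by (simp add: \<epsilon>'_def)
  qed
  then have "exp (l * (\<Sum>\<alpha>\<in>insert \<beta> A. \<epsilon>' \<alpha> * r \<alpha> t)) = s t * exp (\<sigma> * (l * r \<beta> t))" for t
    unfolding s_def by (simp add: distrib_left mult_ac flip: exp_add)
  then have "(\<Sum>t\<in>T. exp (l * (\<Sum>\<alpha>\<in>insert \<beta> A. \<epsilon>' \<alpha> * r \<alpha> t))) \<le> K"
    using \<sigma>(2) by simp
  moreover have "\<forall>\<alpha>. \<epsilon>' \<alpha> \<in> {-1, 1}" using \<epsilon>(1) \<sigma>(1) by (auto simp: \<epsilon>'_def)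
  ultimately show ?case unfolding K_def by blast
qed

text \<open>A Chernoff bound with the union over all points built in: the sum of the exponentials
  over the test set dominates each single one.\<close>

lemma exists_flat_trig_poly:
  assumes q: "q \<ge> 1" and N: "N \<ge> 1" and A: "A \<subseteq> multi_indices q N" "A \<noteq> {}"
  shows "\<exists>a. (\<forall>\<alpha>. cmod (a \<alpha>) = 1) \<and>
    (\<forall>x\<in>cube q N. cmod (trig_poly N A a x) \<le> 4 * sqrt (card A * (N * ln (4 * real q))))"
proof -
  have finA: "finite A" using A(1) finite_multi_indices finite_subset by blast
  define M where "M = real (card A)"
  have M: "M > 0" using finA A(2) by (simp add: M_def card_gt_0_iff)
  define b where "b = N * ln (4 * real q)"
  have b: "b > 0" using q N by (auto simp: b_def)
  \<comment> \<open>Balances the two contributions: l^2 M = b equals the bound b for the logarithm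
    of the number of tests, which is at most 4 q^N \<le> (4 q)^N.\<close>
  define l where "l = sqrt (b / M)"
  have l: "l > 0" using b M by (simp add: l_def)
  \<comment> \<open>The four directions test plus and minus the real and imaginary parts, so
    one-sided exponential moments bound the modulus.\<close>
  define T where "T = cube q N \<times> {1, -1, \<i>, -\<i>}"
  define r where "r \<alpha> t = Re (snd t * monomial N \<alpha> (fst t))" for \<alpha> and t :: "(nat \<Rightarrow> complex) \<times> complex"
  have "\<bar>r \<alpha> t\<bar> \<le> 1" if "t \<in> T" for \<alpha> t
  proof -
    have "cmod (snd t * monomial N \<alpha> (fst t)) = 1"
      using that by (auto simp: T_def norm_mult norm_monomial)
    then show ?thesis using abs_Re_le_cmod[of "snd t * monomial N \<alpha> (fst t)"] by (simp add: r_def)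
  qed
  then obtain \<epsilon> where \<epsilon>: "\<forall>\<alpha>. \<epsilon> \<alpha> \<in> {-1, 1}"
    "(\<Sum>t\<in>T. exp (l * (\<Sum>\<alpha>\<in>A. \<epsilon> \<alpha> * r \<alpha> t))) \<le> card T * exp (l\<^sup>2 * card A)"
    using signs_exp_moment[OF finA, of T r l] by blast
  define a where "a \<alpha> = complex_of_real (\<epsilon> \<alpha>)" for \<alpha>
  have Re_le: "Re (\<theta> * trig_poly N A a x) \<le> 2 * sqrt (M * b)"
    if x: "x \<in> cube q N" and \<theta>: "\<theta> \<in> {1, -1, \<i>, -\<i>}" for \<theta> x
  proof -
    have t: "(x, \<theta>) \<in> T" using x \<theta> by (simp add: T_def)
    have eq: "(\<Sum>\<alpha>\<in>A. \<epsilon> \<alpha> * r \<alpha> (x, \<theta>)) = Re (\<theta> * trig_poly N A a x)"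
      unfolding trig_poly_def sum_distrib_left Re_sum r_def a_def
      by (intro sum.cong refl) (simp add: mult.left_commute[of \<theta>])
    have "exp (l * Re (\<theta> * trig_poly N A a x)) \<le> (\<Sum>t\<in>T. exp (l * (\<Sum>\<alpha>\<in>A. \<epsilon> \<alpha> * r \<alpha> t)))"
      unfolding eq[symmetric] using t by (intro member_le_sum) (auto simp: T_def)
    also have "\<dots> \<le> card T * exp (l\<^sup>2 * card A)" by (rule \<epsilon>(2))
    also have "\<dots> \<le> exp b * exp b"
    proof (intro mult_mono)
      have "card T = q ^ N * card {1, -1, \<i>, -\<i>}"
        unfolding T_def card_cartesian_product card_cube[OF q] ..
      also have "\<dots> \<le> q ^ N * 4" by (intro mult_left_mono) (auto simp: card_insert_if)
      also have "\<dots> \<le> q ^ N * 4 ^ N" using N self_le_power[of "4::nat" N] by (intro mult_left_mono) auto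
      finally have "real (card T) \<le> (4 * real q) ^ N"
        by (metis mult.commute of_nat_le_iff of_nat_mult of_nat_numeral of_nat_power power_mult_distrib)
      also have "\<dots> = exp b" using q by (simp add: b_def exp_of_nat_mult)
      finally show "real (card T) \<le> exp b" .
      show "exp (l\<^sup>2 * card A) \<le> exp b" using b M by (simp add: l_def M_def[symmetric])
    qed auto
    finally have "l * Re (\<theta> * trig_poly N A a x) \<le> 2 * b" by (simp flip: exp_add)
    also have "2 * b = l * (2 * sqrt (M * b))"
      using b M by (simp add: l_def real_sqrt_mult real_sqrt_divide field_simps)
    finally show ?thesis using l by simp
  qed
  have "cmod (trig_poly N A a x) \<le> 4 * sqrt (M * b)" if x: "x \<in> cube q N" for x
  proof -
    have "\<bar>Re (trig_poly N A a x)\<bar> \<le> 2 * sqrt (M * b)" "\<bar>Im (trig_poly N A a x)\<bar> \<le> 2 * sqrt (M * b)"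
      using Re_le[OF x, of 1] Re_le[OF x, of "-1"] Re_le[OF x, of "\<i>"] Re_le[OF x, of "-\<i>"] by auto
    then show ?thesis using cmod_le[of "trig_poly N A a x"] by linarith
  qed
  moreover have "cmod (a \<alpha>) = 1" for \<alpha> using \<epsilon>(1)[rule_format, of \<alpha>] by (auto simp: a_def)
  ultimately show ?thesis unfolding M_def b_def by blast
qed

section \<open>The Bohr radius as the inverse of a Sidon constant\<close>

definition layer_indices :: "nat \<Rightarrow> nat \<Rightarrow> nat \<Rightarrow> (nat \<Rightarrow> nat) set" where
  "layer_indices q N d = {\<alpha>\<in>multi_indices q N. card (index_supp N \<alpha>) = d}"

lemma layer_indices_subset: "layer_indices q N d \<subseteq> multi_indices q N"
  by (auto simp: layer_indices_def)

lemma card_layer_indices: "q \<ge> 1 \<Longrightarrow> card (layer_indices q N d) = (N choose d) * (q - 1) ^ d"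
  unfolding layer_indices_def by (rule card_multi_indices_supp)

lemma finite_layer_indices: "finite (layer_indices q N d)"
  by (rule finite_subset[OF layer_indices_subset finite_multi_indices])

lemma layer_indices_nonempty:
  assumes "q \<ge> 2" "d \<le> N" shows "layer_indices q N d \<noteq> {}"
proof -
  have "card (layer_indices q N d) > 0" using assms by (simp add: card_layer_indices)
  then show ?thesis by auto
qed

lemma interaction_bohr_radius_eq:
  "interaction_bohr_radius q N d = Sup {r. 0 \<le> r \<and> r \<le> 1 \<and>
     (\<forall>f\<in>layer q N d. r ^ d * (\<Sum>\<alpha>\<in>layer_indices q N d. cmod (fourier_coeff q N f \<alpha>)) \<le> sup_norm q N f)}"
  by (simp add: interaction_bohr_radius_def layer_indices_def)

lemma layer_eq_trig_poly:
  assumes "q \<ge> 1" "f \<in> layer q N d" "x \<in> cube q N"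
  shows "f x = trig_poly N (layer_indices q N d) (fourier_coeff q N f) x"
  unfolding fourier_inversion[OF assms(1,3), of f] trig_poly_def
  using assms(2) by (intro sum.mono_neutral_right) (auto simp: layer_indices_def layer_def)

lemma trig_poly_in_layer:
  assumes "q \<ge> 1" "A \<subseteq> layer_indices q N d"
  shows "trig_poly N A a \<in> layer q N d"
  using assms fourier_coeff_trig_poly[OF assms(1) order.trans[OF assms(2) layer_indices_subset]]
  by (auto simp: layer_def layer_indices_def)

lemma sup_norm_nonneg: "q \<ge> 1 \<Longrightarrow> 0 \<le> sup_norm q N f"
  using ones_in_cube sup_norm_ge norm_ge_zero order.trans by metis

lemma interaction_bohr_radius_ge:
  assumes q: "q \<ge> 2" and d: "1 \<le> d" "d \<le> N" and K: "K > 0"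
    and le: "\<And>f. f \<in> layer q N d \<Longrightarrow>
      (\<Sum>\<alpha>\<in>layer_indices q N d. cmod (fourier_coeff q N f \<alpha>)) \<le> K * sup_norm q N f"
  shows "interaction_bohr_radius q N d \<ge> K powr (- 1 / d)"
  unfolding interaction_bohr_radius_eq
proof (rule cSup_upper)
  have q1: "q \<ge> 1" using q by simp
  obtain \<alpha> where \<alpha>: "\<alpha> \<in> layer_indices q N d" using layer_indices_nonempty[OF q d(2)] by blast
  \<comment> \<open>A single character has coefficient sum and sup norm 1. This forces K \<ge> 1, so
    that the candidate radius respects the constraint r \<le> 1.\<close>
  define f where "f = trig_poly N {\<alpha>} (\<lambda>_. 1)"
  have f: "f \<in> layer q N d" unfolding f_def using \<alpha> q by (intro trig_poly_in_layer) auto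
  have "fourier_coeff q N f \<alpha> = 1"
    using fourier_coeff_trig_poly[OF q1, of "{\<alpha>}" N \<alpha>] \<alpha> by (simp add: f_def layer_indices_def)
  then have "1 \<le> (\<Sum>\<alpha>\<in>layer_indices q N d. cmod (fourier_coeff q N f \<alpha>))"
    using member_le_sum[OF \<alpha>, of "\<lambda>\<alpha>. cmod (fourier_coeff q N f \<alpha>)"] finite_layer_indices by simp
  also have "\<dots> \<le> K * sup_norm q N f" by (rule le[OF f])
  also have "\<dots> \<le> K * 1"
    using q K by (intro mult_left_mono sup_norm_le) (auto simp: f_def trig_poly_def norm_monomial)
  finally have K1: "K \<ge> 1" by simp
  have "(K powr (- 1 / d)) ^ d = (K powr (- 1 / d)) powr d"
    using K by (intro powr_realpow[symmetric]) simp
  also have "\<dots> = K powr (- 1)" using d by (simp only: powr_powr) simp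
  also have "\<dots> = 1 / K" using K by (simp add: powr_minus_divide)
  finally have pow: "(K powr (- 1 / d)) ^ d = 1 / K" .
  show "K powr (- 1 / d) \<in> {r. 0 \<le> r \<and> r \<le> 1 \<and>
     (\<forall>f\<in>layer q N d. r ^ d * (\<Sum>\<alpha>\<in>layer_indices q N d. cmod (fourier_coeff q N f \<alpha>)) \<le> sup_norm q N f)}"
  proof (intro CollectI conjI ballI)
    show "K powr (- 1 / d) \<le> 1" using K1 d powr_mono[of "- 1 / d" 0 K] by simp
    fix f assume "f \<in> layer q N d"
    then show "(K powr (- 1 / d)) ^ d * (\<Sum>\<alpha>\<in>layer_indices q N d. cmod (fourier_coeff q N f \<alpha>)) \<le> sup_norm q N f"
      unfolding pow using le K by (simp add: field_simps)
  qed simp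
  show "bdd_above {r. 0 \<le> r \<and> r \<le> 1 \<and>
     (\<forall>f\<in>layer q N d. r ^ d * (\<Sum>\<alpha>\<in>layer_indices q N d. cmod (fourier_coeff q N f \<alpha>)) \<le> sup_norm q N f)}"
    by (auto simp: bdd_above_def)
qed

lemma interaction_bohr_radius_le:
  assumes q: "q \<ge> 2" and d: "1 \<le> d" "d \<le> N"
  shows "interaction_bohr_radius q N d
    \<le> (4 * sqrt (N * ln (4 * real q) / real ((N choose d) * (q - 1) ^ d))) powr (1 / d)"
  unfolding interaction_bohr_radius_eq
proof (rule cSup_least)
  have q1: "q \<ge> 1" using q by simp
  have "0 \<in> {r. 0 \<le> r \<and> r \<le> 1 \<and>
     (\<forall>f\<in>layer q N d. r ^ d * (\<Sum>\<alpha>\<in>layer_indices q N d. cmod (fourier_coeff q N f \<alpha>)) \<le> sup_norm q N f)}"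
    using d sup_norm_nonneg[OF q1] by (simp add: power_0_left)
  then show "{r. 0 \<le> r \<and> r \<le> 1 \<and>
     (\<forall>f\<in>layer q N d. r ^ d * (\<Sum>\<alpha>\<in>layer_indices q N d. cmod (fourier_coeff q N f \<alpha>)) \<le> sup_norm q N f)} \<noteq> {}"
    by blast
  define A where "A = layer_indices q N d"
  define M where "M = real (card A)"
  have M: "M > 0"
    using layer_indices_nonempty[OF q d(2)] finite_layer_indices by (simp add: M_def A_def card_gt_0_iff)
  define b where "b = N * ln (4 * real q)"
  have b: "b > 0" using q d by (auto simp: b_def)
  fix r assume r: "r \<in> {r. 0 \<le> r \<and> r \<le> 1 \<and>
     (\<forall>f\<in>layer q N d. r ^ d * (\<Sum>\<alpha>\<in>layer_indices q N d. cmod (fourier_coeff q N f \<alpha>)) \<le> sup_norm q N f)}"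
  obtain a where a: "\<forall>\<alpha>. cmod (a \<alpha>) = 1"
    "\<forall>x\<in>cube q N. cmod (trig_poly N A a x) \<le> 4 * sqrt (card A * (N * ln (4 * real q)))"
    using exists_flat_trig_poly[OF q1, of N A] d layer_indices_nonempty[OF q d(2)] layer_indices_subset
    unfolding A_def by auto
  have "fourier_coeff q N (trig_poly N A a) \<alpha> = a \<alpha>" if "\<alpha> \<in> A" for \<alpha>
    using fourier_coeff_trig_poly[OF q1, of A N \<alpha> a] that layer_indices_subset by (auto simp: A_def)
  then have "(\<Sum>\<alpha>\<in>A. cmod (fourier_coeff q N (trig_poly N A a) \<alpha>)) = M"
    using a(1) by (simp add: M_def)
  moreover have "trig_poly N A a \<in> layer q N d"
    unfolding A_def by (rule trig_poly_in_layer[OF q1]) simp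
  ultimately have "r ^ d * M \<le> sup_norm q N (trig_poly N A a)"
    using r unfolding A_def by force
  also have "\<dots> \<le> 4 * sqrt (M * b)"
    using a(2) by (intro sup_norm_le[OF q1]) (simp add: M_def b_def)
  also have "M * b = b / M * M\<^sup>2" using M by (simp add: power2_eq_square)
  also have "4 * sqrt (b / M * M\<^sup>2) = 4 * sqrt (b / M) * M"
    unfolding real_sqrt_mult real_sqrt_abs using M by simp
  finally have "r ^ d \<le> 4 * sqrt (b / M)" using M by simp
  then have "(r ^ d) powr (1 / d) \<le> (4 * sqrt (b / M)) powr (1 / d)"
    using r by (intro powr_mono2) auto
  moreover have "(r ^ d) powr (1 / d) = r"
  proof (cases "r = 0")
    case False
    then have "r > 0" using r by simp
    then show ?thesis using d by (simp add: powr_powr flip: powr_realpow)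
  qed (use d in simp)
  ultimately show "r \<le> (4 * sqrt (N * ln (4 * real q) / real ((N choose d) * (q - 1) ^ d))) powr (1 / d)"
    unfolding b_def M_def A_def card_layer_indices[OF q1] by simp
qed

lemma sum_coeffs_le_sqrt_card:
  assumes q: "q \<ge> 1" and f: "f \<in> layer q N d"
  shows "(\<Sum>\<alpha>\<in>layer_indices q N d. cmod (fourier_coeff q N f \<alpha>))
    \<le> sqrt (real ((N choose d) * (q - 1) ^ d)) * sup_norm q N f"
proof (rule power2_le_imp_le)
  let ?a = "fourier_coeff q N f" and ?A = "layer_indices q N d"
  have "(\<Sum>\<alpha>\<in>?A. 1 * cmod (?a \<alpha>))\<^sup>2 \<le> (\<Sum>\<alpha>\<in>?A. 1\<^sup>2) * (\<Sum>\<alpha>\<in>?A. (cmod (?a \<alpha>))\<^sup>2)"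
    by (rule Cauchy_Schwarz_ineq_sum)
  also have "(\<Sum>\<alpha>\<in>?A. (cmod (?a \<alpha>))\<^sup>2) = mean q N (\<lambda>x. (cmod (trig_poly N ?A ?a x))\<^sup>2)"
    by (rule parseval[OF q layer_indices_subset, symmetric])
  also have "\<dots> \<le> mean q N (\<lambda>x. (sup_norm q N f)\<^sup>2)"
    using layer_eq_trig_poly[OF q f] sup_norm_ge[of _ q N f] by (intro mean_mono power_mono) auto
  finally show "(\<Sum>\<alpha>\<in>?A. cmod (?a \<alpha>))\<^sup>2 \<le> (sqrt (real ((N choose d) * (q - 1) ^ d)) * sup_norm q N f)\<^sup>2"
    by (simp add: mean_const[OF q] card_layer_indices[OF q] power_mult_distrib mult_left_mono del: of_nat_mult)
qed (simp add: sup_norm_nonneg[OF q])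

section \<open>Asymptotics\<close>

lemma interaction_bohr_radius_ge_sidon:
  assumes q: "q \<ge> 2" and m: "1 \<le> m" "m \<le> d" and N: "2 * d \<le> N"
  shows "interaction_bohr_radius q N d \<ge> (sidon_const q m * real d ^ (5 * m) * (4 * real q) powr (d / m) *
     sqrt (real ((N choose d) * (q - 1) ^ d) / N)) powr (- 1 / d)"
proof (rule interaction_bohr_radius_ge[OF q])
  have q1: "q \<ge> 1" using q by simp
  show "0 < sidon_const q m * real d ^ (5 * m) * (4 * real q) powr (d / m) *
     sqrt (real ((N choose d) * (q - 1) ^ d) / N)"
    using q m N by (simp add: sidon_const_def)
  fix f assume f: "f \<in> layer q N d"
  show "(\<Sum>\<alpha>\<in>layer_indices q N d. cmod (fourier_coeff q N f \<alpha>)) \<le> sidon_const q m * real d ^ (5 * m) *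
      (4 * real q) powr (d / m) * sqrt (real ((N choose d) * (q - 1) ^ d) / N) * sup_norm q N f"
  \<comment> \<open>The Sidon inequality is stated for S > 0, so the zero function is handled
    apart.\<close>
  proof (cases "sup_norm q N f = 0")
    case True
    then have "f x = 0" if "x \<in> cube q N" for x using sup_norm_ge[OF that, of f] by simp
    then have "fourier_coeff q N f \<alpha> = 0" for \<alpha> by (simp add: fourier_coeff_def)
    then show ?thesis using True by simp
  next
    case False
    then have "sup_norm q N f > 0" using sup_norm_nonneg[OF q1, of N f] by simp
    then show ?thesis
      using layer_eq_trig_poly[OF q1 f] sup_norm_ge[of _ q N f]
      by (intro sidon_inequality[OF q m N layer_indices_subset]) (auto simp: layer_indices_def)
  qed
qed (use m N in auto)

lemma ln_interaction_bohr_radius_ge: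
  assumes q: "q \<ge> 2" and d: "1 \<le> d" "d \<le> N"
  shows "interaction_bohr_radius q N d > 0"
    and "ln (interaction_bohr_radius q N d) \<ge> - ln (real ((N choose d) * (q - 1) ^ d)) / (2 * d)"
proof -
  define M where "M = real ((N choose d) * (q - 1) ^ d)"
  have M: "M > 0" using q d by (simp add: M_def)
  have ge: "interaction_bohr_radius q N d \<ge> sqrt M powr (- 1 / d)"
    using sum_coeffs_le_sqrt_card[of q _ N d] q M unfolding M_def
    by (intro interaction_bohr_radius_ge[OF q d]) auto
  moreover have "sqrt M powr (- 1 / d) > 0" using M by simp
  ultimately show pos: "interaction_bohr_radius q N d > 0" by linarith
  have "ln (sqrt M powr (- 1 / d)) \<le> ln (interaction_bohr_radius q N d)"
    using ge pos M by (subst ln_le_cancel_iff) auto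
  then show "ln (interaction_bohr_radius q N d) \<ge> - ln (real ((N choose d) * (q - 1) ^ d)) / (2 * d)"
    using M unfolding M_def[symmetric] by (simp add: ln_powr ln_sqrt)
qed

lemma ln_interaction_bohr_radius_le:
  assumes q: "q \<ge> 2" and d: "1 \<le> d" "d \<le> N"
  shows "ln (interaction_bohr_radius q N d) \<le> - ln (real ((N choose d) * (q - 1) ^ d)) / (2 * d)
    + ln N / (2 * d) + (ln 4 + ln (ln (4 * real q)) / 2) / d"
proof -
  define M where "M = real ((N choose d) * (q - 1) ^ d)"
  have M: "M > 0" using q d by (simp add: M_def)
  have l: "ln (4 * real q) > 0" and N: "real N > 0" using q d by auto
  define K where "K = 4 * sqrt (N * ln (4 * real q) / M)"
  have K: "K > 0" using M l N by (simp add: K_def)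
  have "interaction_bohr_radius q N d \<le> K powr (1 / d)"
    unfolding K_def M_def by (rule interaction_bohr_radius_le[OF q d])
  then have "ln (interaction_bohr_radius q N d) \<le> ln (K powr (1 / d))"
    using ln_interaction_bohr_radius_ge(1)[OF q d] K by (subst ln_le_cancel_iff) auto
  also have "\<dots> = ln K / d" using K by (simp add: ln_powr)
  also have "ln K = ln 4 + (ln N + ln (ln (4 * real q)) - ln M) / 2"
    using M l N by (simp add: K_def ln_mult ln_sqrt ln_div)
  finally show ?thesis
    unfolding M_def[symmetric] using d by (simp add: add_divide_distrib diff_divide_distrib)
qed

text \<open>For fixed m the terms with the Sidon constant and with ln d / d vanish in the limit;
  only ln (4 q) / m persists.\<close>

lemma ln_interaction_bohr_radius_ge_sidon:
  assumes q: "q \<ge> 2" and m: "1 \<le> m" "m \<le> d" and N: "2 * d \<le> N"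
  shows "ln (interaction_bohr_radius q N d) \<ge> - ln (real ((N choose d) * (q - 1) ^ d)) / (2 * d)
    + ln N / (2 * d) - ln (sidon_const q m) / d - 5 * m * (ln d / d) - ln (4 * real q) / m"
proof -
  define M where "M = real ((N choose d) * (q - 1) ^ d)"
  have M: "M > 0" using q N by (simp add: M_def)
  have C: "sidon_const q m > 0" using q m by (simp add: sidon_const_def)
  have N0: "real N > 0" and d0: "real d > 0" using m N by auto
  define K where "K = sidon_const q m * real d ^ (5 * m) * (4 * real q) powr (d / m) * sqrt (M / N)"
  have K: "K > 0" using C M N0 d0 q by (simp add: K_def)
  have "K powr (- 1 / d) \<le> interaction_bohr_radius q N d"
    unfolding K_def M_def by (rule interaction_bohr_radius_ge_sidon[OF q m N])
  then have "ln (K powr (- 1 / d)) \<le> ln (interaction_bohr_radius q N d)"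
    using K ln_interaction_bohr_radius_ge(1)[OF q, of d N] m N by (subst ln_le_cancel_iff) auto
  also have "ln (K powr (- 1 / d)) = - ln K / d" using K by (simp add: ln_powr)
  also have "ln K = ln (sidon_const q m) + 5 * m * ln d + d / m * ln (4 * real q) + (ln M - ln N) / 2"
    using C M N0 d0 q by (simp add: K_def ln_mult ln_sqrt ln_div ln_realpow ln_powr)
  finally show ?thesis
    unfolding M_def[symmetric] using d0 m by (simp add: add_divide_distrib diff_divide_distrib)
qed

text \<open>A weak Stirling formula, by induction from (1 + 1/d)^d \<le> e \<le> (1 + 1/d)^(d + 1).
  The gap between the bounds is of order ln d, negligible after division by d.\<close>

lemma ln_fact_bounds:
  assumes "d \<ge> 1"
  shows "real d * ln d - d \<le> ln (fact d :: real)"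
    and "ln (fact d :: real) \<le> (real d + 1) * ln d - d + 1"
proof -
  have step: "real d * (ln (real d + 1) - ln d) \<le> 1" "1 \<le> (real d + 1) * (ln (real d + 1) - ln d)"
    if "d \<ge> 1" for d :: nat
  proof -
    have d: "real d > 0" using that by simp
    have "ln ((real d + 1) / d) \<le> (real d + 1) / d - 1" using d by (intro ln_le_minus_one) simp
    also have "\<dots> = 1 / d" using d by (simp add: field_simps)
    finally have "ln (real d + 1) - ln d \<le> 1 / d" using d by (simp add: ln_div)
    then show "real d * (ln (real d + 1) - ln d) \<le> 1" using d by (simp add: field_simps)
    have "ln (d / (real d + 1)) \<le> d / (real d + 1) - 1" using d by (intro ln_le_minus_one) simp
    also have "\<dots> = - 1 / (real d + 1)" using d by (simp add: field_simps)
    finally have "ln d - ln (real d + 1) \<le> - 1 / (real d + 1)" using d by (simp add: ln_div)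
    then show "1 \<le> (real d + 1) * (ln (real d + 1) - ln d)" using d by (simp add: field_simps)
  qed
  show "real d * ln d - d \<le> ln (fact d :: real)"
    using assms
  proof (induction d rule: dec_induct)
    case (step n)
    have "ln (fact (Suc n) :: real) = ln (real n + 1) + ln (fact n :: real)"
      by (simp add: ln_mult add.commute)
    then show ?case using step.IH \<open>1 \<le> n\<close> \<open>\<And>d. 1 \<le> d \<Longrightarrow> real d * (ln (real d + 1) - ln d) \<le> 1\<close>[of n]
      by (simp add: algebra_simps)
  qed simp
  show "ln (fact d :: real) \<le> (real d + 1) * ln d - d + 1"
    using assms
  proof (induction d rule: dec_induct)
    case (step n)
    have "ln (fact (Suc n) :: real) = ln (real n + 1) + ln (fact n :: real)"
      by (simp add: ln_mult add.commute)
    then show ?case using step.IH \<open>1 \<le> n\<close> \<open>\<And>d. 1 \<le> d \<Longrightarrow> 1 \<le> (real d + 1) * (ln (real d + 1) - ln d)\<close>[of n]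
      by (simp add: algebra_simps)
  qed simp
qed

text \<open>The right side is a falling factorial with d factors, each at least N - d.\<close>

lemma power_le_binomial_mult_fact:
  fixes N d :: nat
  shows "d \<le> N \<Longrightarrow> (N - d) ^ d \<le> (N choose d) * fact d"
proof (induction d)
  case (Suc d)
  have "Suc d * (N choose Suc d) = (N - d) * (N choose d)"
    using times_binomial_minus1_eq[of "Suc d" N] binomial_absorb_comp[of N d] by simp
  then have "(N choose Suc d) * fact (Suc d) = (N - d) * ((N choose d) * fact d)"
    by (simp only: fact_Suc of_nat_id mult_ac)
  moreover have "(N - Suc d) ^ Suc d \<le> (N - d) * (N - d) ^ d"
    unfolding power_Suc by (intro mult_mono power_mono) auto
  ultimately show ?case using Suc by (metis Suc_leD le_trans mult_le_mono2)
qed simp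

text \<open>From (N - d)^d / d! \<le> binomial \<le> N^d / d!, with the bounds for ln d!; the
  discrepancy ln (1 - d/N) is where d = o(N) will enter.\<close>

lemma ln_binomial_bounds:
  fixes N d :: nat
  assumes "1 \<le> d" "d < N"
  shows "ln (real (N choose d)) / d \<le> 1 + ln N - ln d"
    and "ln (1 - d / N) - ln d / d - 1 / d \<le> ln (real (N choose d)) / d - (1 + ln N - ln d)"
proof -
  have d0: "real d > 0" and N0: "real N > 0" using assms by auto
  have C0: "real (N choose d) > 0" using assms by simp
  have "real ((N choose d) * fact d) \<le> real (N ^ d)"
    using binomial_fact_pow[of N d] by (simp only: of_nat_le_iff)
  then have "ln (real (N choose d) * fact d) \<le> ln (real N ^ d)"
    using C0 N0 by (subst ln_le_cancel_iff) auto
  then have "ln (real (N choose d)) + ln (fact d :: real) \<le> d * ln N"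
    using C0 N0 by (simp add: ln_mult ln_realpow)
  then have "ln (real (N choose d)) \<le> d * (1 + ln N - ln d)"
    using ln_fact_bounds(1)[OF assms(1)] by (simp add: algebra_simps)
  then show "ln (real (N choose d)) / d \<le> 1 + ln N - ln d"
    using d0 by (simp add: field_simps)
  have "real ((N - d) ^ d) \<le> real ((N choose d) * fact d)"
    using power_le_binomial_mult_fact[of d N] assms by (simp only: of_nat_le_iff)
  then have "ln (real (N - d) ^ d) \<le> ln (real (N choose d) * fact d)"
    using C0 assms by (subst ln_le_cancel_iff) auto
  then have "d * ln (real (N - d)) \<le> ln (real (N choose d)) + ln (fact d :: real)"
    using C0 assms by (simp add: ln_mult ln_realpow)
  then have *: "d * ln (real (N - d)) - (real d + 1) * ln d + d - 1 \<le> ln (real (N choose d))"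
    using ln_fact_bounds(2)[OF assms(1)] by linarith
  have "1 - d / N = real (N - d) / N" using assms by (simp add: field_simps of_nat_diff)
  then have ln_eq: "ln (1 - d / N) = ln (real (N - d)) - ln N" by (simp only: ln_div) (use assms in simp)
  then have "ln (1 - d / N) - ln d / d - 1 / d + (1 + ln N - ln d)
      = (d * ln (real (N - d)) - (real d + 1) * ln d + d - 1) / d"
    unfolding ln_eq using d0 by (simp add: add_divide_distrib diff_divide_distrib distrib_right)
  also have "\<dots> \<le> ln (real (N choose d)) / d"
    using * d0 by (intro divide_right_mono) auto
  finally show "ln (1 - d / N) - ln d / d - 1 / d \<le> ln (real (N choose d)) / d - (1 + ln N - ln d)"
    by linarith
qed

section \<open>From logarithms to asymptotic equivalence\<close>

lemma asymp_equiv_lnI: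
  fixes f g :: "'a \<Rightarrow> real"
  assumes "eventually (\<lambda>x. f x > 0) F" "eventually (\<lambda>x. g x > 0) F"
    and "((\<lambda>x. ln (f x) - ln (g x)) \<longlongrightarrow> 0) F"
  shows "f \<sim>[F] g"
proof (rule asymp_equivI')
  have "((\<lambda>x. exp (ln (f x) - ln (g x))) \<longlongrightarrow> exp 0) F"
    using assms(3) by (rule tendsto_exp)
  moreover have "eventually (\<lambda>x. exp (ln (f x) - ln (g x)) = f x / g x) F"
    using assms(1,2) by eventually_elim (simp add: exp_diff)
  ultimately show "((\<lambda>x. f x / g x) \<longlongrightarrow> 1) F"
    using tendsto_cong by fastforce
qed

lemma asymp_equiv_sqrt_real:
  fixes f g :: "'a \<Rightarrow> real"
  assumes "f \<sim>[F] g" and f: "eventually (\<lambda>x. 0 \<le> f x) F" and g: "eventually (\<lambda>x. 0 \<le> g x) F"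
  shows "(\<lambda>x. sqrt (f x)) \<sim>[F] (\<lambda>x. sqrt (g x))"
proof -
  have "(\<lambda>x. f x powr (1 / 2)) \<sim>[F] (\<lambda>x. g x powr (1 / 2))"
    using assms by (rule asymp_equiv_powr_real)
  moreover have "eventually (\<lambda>x. f x powr (1 / 2) = sqrt (f x)) F"
    using f by eventually_elim (rule powr_half_sqrt)
  moreover have "eventually (\<lambda>x. g x powr (1 / 2) = sqrt (g x)) F"
    using g by eventually_elim (rule powr_half_sqrt)
  ultimately show ?thesis by (simp add: asymp_equiv_cong)
qed

context
  fixes q :: nat and d :: "nat \<Rightarrow> nat"
  assumes q: "q \<ge> 2" and d: "\<And>N. N \<ge> 1 \<Longrightarrow> 1 \<le> d N \<and> d N \<le> N"
    and d_top: "filterlim d at_top sequentially"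
    and d_small: "(\<lambda>N. real (d N)) \<in> o[sequentially](\<lambda>N. real N)"
begin

abbreviation (input) "R N \<equiv> interaction_bohr_radius q N (d N)"
abbreviation (input) "E N \<equiv> sqrt (real (d N) / (exp 1 * (real q - 1) * real N))"
text \<open>The logarithm of M^(-1/(2 d)), the lower bound for the radius given by
  Cauchy-Schwarz.\<close>

abbreviation (input) "LM N \<equiv> - ln (real ((N choose d N) * (q - 1) ^ d N)) / (2 * d N)"

lemma tendsto_inverse_d: "(\<lambda>N. c / d N) \<longlonglongrightarrow> 0"
  using filterlim_compose[OF filterlim_real_sequentially d_top]
  by (rule tendsto_divide_0[OF tendsto_const filterlim_at_top_imp_at_infinity])

lemma tendsto_ln_d_over_d: "(\<lambda>N. ln (d N) / d N) \<longlonglongrightarrow> 0"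
  using filterlim_compose[OF lim_ln_over_n d_top] .

lemma tendsto_d_over_N: "(\<lambda>N. d N / N) \<longlonglongrightarrow> 0"
  using smalloD_tendsto[OF d_small] .

lemma eventually_d_large: "eventually (\<lambda>N. m \<le> d N \<and> 1 \<le> d N \<and> 2 * d N \<le> N \<and> d N < N) sequentially"
proof -
  have "eventually (\<lambda>N. d N / N < 1 / 2) sequentially"
    using tendsto_d_over_N by (rule order_tendstoD) simp
  moreover have "eventually (\<lambda>N. m \<le> d N) sequentially"
    using d_top by (simp add: filterlim_at_top)
  ultimately show ?thesis
    using eventually_ge_at_top[of 1]
  proof eventually_elim
    case (elim N)
    then have "2 * real (d N) < N" by (simp add: field_simps)
    then show ?case using elim d[of N] by linarith
  qed
qed

text \<open>The difference is -\<delta>/2, with \<delta> the error in ln (binomial) / d = 1 + ln N -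
  ln d + \<delta>; the powers of q - 1 cancel exactly.\<close>

lemma tendsto_LM: "(\<lambda>N. LM N - ln (E N)) \<longlonglongrightarrow> 0"
proof -
  define \<delta> where "\<delta> N = ln (real (N choose d N)) / d N - (1 + ln N - ln (d N))" for N
  have "(\<lambda>N. ln (1 - d N / N) - ln (d N) / d N - 1 / d N) \<longlonglongrightarrow> ln (1 - 0) - 0 - 0"
    by (intro tendsto_intros tendsto_d_over_N tendsto_ln_d_over_d tendsto_inverse_d) simp
  then have lower: "(\<lambda>N. ln (1 - d N / N) - ln (d N) / d N - 1 / d N) \<longlonglongrightarrow> 0" by simp
  have "\<delta> \<longlonglongrightarrow> 0"
  proof (rule tendsto_sandwich[OF _ _ lower tendsto_const])
    show "eventually (\<lambda>N. ln (1 - d N / N) - ln (d N) / d N - 1 / d N \<le> \<delta> N) sequentially"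
      using eventually_d_large[of 1]
      by eventually_elim (auto simp: \<delta>_def intro: ln_binomial_bounds(2))
    show "eventually (\<lambda>N. \<delta> N \<le> 0) sequentially"
      using eventually_d_large[of 1]
    proof eventually_elim
      case (elim N)
      then show ?case using ln_binomial_bounds(1)[of "d N" N] by (simp add: \<delta>_def)
    qed
  qed
  then have "(\<lambda>N. - \<delta> N / 2) \<longlonglongrightarrow> - 0 / 2" by (intro tendsto_intros) simp_all
  moreover have "eventually (\<lambda>N. - \<delta> N / 2 = LM N - ln (E N)) sequentially"
    using eventually_d_large[of 1]
  proof eventually_elim
    case (elim N)
    have pos: "real (d N) > 0" "real N > 0" "real q - 1 > 0" "real (N choose d N) > 0"
      using elim q by auto
    have e1: "ln (real ((N choose d N) * (q - 1) ^ d N)) = ln (real (N choose d N)) + d N * ln (real q - 1)"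
      using pos q by (simp add: ln_mult ln_realpow of_nat_diff)
    have e2: "ln (E N) = (ln (d N) - 1 - ln (real q - 1) - ln N) / 2"
      using pos by (simp add: ln_sqrt ln_div ln_mult)
    show ?case unfolding \<delta>_def e1 e2
      using pos by (simp add: add_divide_distrib diff_divide_distrib)
  qed
  ultimately show ?thesis by (simp add: tendsto_cong)
qed

lemma eventually_R_pos: "eventually (\<lambda>N. R N > 0) sequentially"
  using eventually_d_large[of 1] by eventually_elim (auto intro: ln_interaction_bohr_radius_ge(1)[OF q])

lemma eventually_E_pos: "eventually (\<lambda>N. E N > 0) sequentially"
  using eventually_d_large[of 1] by eventually_elim (use q in auto)

text \<open>One limit for both regimes: \<kappa> is 0 when ln N = o(d) and 1/\<tau> when d is
  asymptotic to \<tau> ln N.\<close>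

lemma tendsto_upper:
  assumes "(\<lambda>N. ln N / d N) \<longlonglongrightarrow> \<kappa>"
  shows "(\<lambda>N. LM N + ln N / (2 * d N) + (ln 4 + ln (ln (4 * real q)) / 2) / d N - ln (E N)) \<longlonglongrightarrow> \<kappa> / 2"
proof -
  have "(\<lambda>N. (LM N - ln (E N)) + (ln N / d N) / 2 + (ln 4 + ln (ln (4 * real q)) / 2) / d N) \<longlonglongrightarrow> 0 + \<kappa> / 2 + 0"
    by (intro tendsto_intros tendsto_LM assms tendsto_inverse_d) simp
  then show ?thesis by (simp add: algebra_simps)
qed

lemma eventually_le_upper:
  "eventually (\<lambda>N. ln (R N) - ln (E N) \<le>
    LM N + ln N / (2 * d N) + (ln 4 + ln (ln (4 * real q)) / 2) / d N - ln (E N)) sequentially"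
  using eventually_d_large[of 1]
proof eventually_elim
  case (elim N)
  then show ?case using ln_interaction_bohr_radius_le[OF q, of "d N" N] by simp
qed

lemma interaction_bohr_radius_ln_small:
  assumes "(\<lambda>N. ln (real N)) \<in> o[sequentially](\<lambda>N. real (d N))"
  shows "(\<lambda>N. R N) \<sim>[sequentially] (\<lambda>N. E N)"
proof (rule asymp_equiv_lnI[OF eventually_R_pos eventually_E_pos])
  have "(\<lambda>N. ln N / d N) \<longlonglongrightarrow> 0" using smalloD_tendsto[OF assms] .
  from tendsto_upper[OF this]
  have upper: "(\<lambda>N. LM N + ln N / (2 * d N) + (ln 4 + ln (ln (4 * real q)) / 2) / d N - ln (E N)) \<longlonglongrightarrow> 0" by simp
  show "(\<lambda>N. ln (R N) - ln (E N)) \<longlonglongrightarrow> 0"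
  proof (rule tendsto_sandwich[OF _ eventually_le_upper tendsto_LM upper])
    show "eventually (\<lambda>N. LM N - ln (E N) \<le> ln (R N) - ln (E N)) sequentially"
      using eventually_d_large[of 1]
    proof eventually_elim
      case (elim N)
      then show ?case using ln_interaction_bohr_radius_ge(2)[OF q, of "d N" N] by simp
    qed
  qed
qed

lemma interaction_bohr_radius_ln_comparable:
  assumes \<tau>: "\<tau> > 0" and d_equiv: "(\<lambda>N. real (d N)) \<sim>[sequentially] (\<lambda>N. \<tau> * ln (real N))"
  shows "(\<lambda>N. R N) \<sim>[sequentially] (\<lambda>N. exp (1 / (2 * \<tau>)) * E N)"
proof (rule asymp_equiv_lnI[OF eventually_R_pos])
  show "eventually (\<lambda>N. exp (1 / (2 * \<tau>)) * E N > 0) sequentially"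
    using eventually_E_pos by eventually_elim simp
  have "(\<lambda>N. \<tau> * ln N / d N) \<longlonglongrightarrow> 1"
  proof (rule asymp_equivD_strong[OF asymp_equiv_symI[OF d_equiv]])
    show "eventually (\<lambda>N. \<tau> * ln (real N) \<noteq> 0 \<or> real (d N) \<noteq> 0) sequentially"
      using eventually_d_large[of 1] by eventually_elim auto
  qed
  then have "(\<lambda>N. (\<tau> * ln N / d N) / \<tau>) \<longlonglongrightarrow> 1 / \<tau>" using \<tau> by (intro tendsto_intros) auto
  moreover define \<kappa> where "\<kappa> = 1 / \<tau>"
  ultimately have ratio: "(\<lambda>N. ln N / d N) \<longlonglongrightarrow> \<kappa>" using \<tau> by simp
  have "(\<lambda>N. ln (R N) - ln (E N)) \<longlonglongrightarrow> 1 / \<tau> / 2"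
  \<comment> \<open>A sandwich does not suffice: for each fixed m the limit of the lower bound falls
    short by ln (4 q) / m. Each c below the target is therefore treated with its own m.\<close>
  proof (rule order_tendstoI)
    fix c assume "1 / \<tau> / 2 < c"
    then have "eventually (\<lambda>N. LM N + ln N / (2 * d N) + (ln 4 + ln (ln (4 * real q)) / 2) / d N - ln (E N) < c) sequentially"
      unfolding \<kappa>_def[symmetric] by (rule order_tendstoD(2)[OF tendsto_upper[OF ratio]])
    with eventually_le_upper show "eventually (\<lambda>N. ln (R N) - ln (E N) < c) sequentially"
      by eventually_elim linarith
  next
    fix c assume c: "c < 1 / \<tau> / 2"
    have l: "ln (4 * real q) > 0" using q by simp
    \<comment> \<open>m is fixed before N and depends only on the gap between c and the target;
      \<open>eventually_d_large\<close> then supplies m \<le> d for large N.\<close>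
    obtain m :: nat where m: "m \<ge> 1" "ln (4 * real q) / m < 1 / \<tau> / 2 - c"
    proof -
      obtain m :: nat where "ln (4 * real q) / (1 / \<tau> / 2 - c) < m" using reals_Archimedean2 by blast
      moreover have "0 < ln (4 * real q) / (1 / \<tau> / 2 - c)" using l c by simp
      ultimately have "m > 0" by linarith
      with \<open>ln (4 * real q) / (1 / \<tau> / 2 - c) < m\<close> c show ?thesis
        by (intro that[of m]) (auto simp: field_simps)
    qed
    have "(\<lambda>N. (LM N - ln (E N)) + (ln N / d N) / 2 - ln (sidon_const q m) / d N - 5 * m * (ln (d N) / d N)
        - ln (4 * real q) / m) \<longlonglongrightarrow> 0 + \<kappa> / 2 - 0 - real (5 * m) * 0 - ln (4 * real q) / m"
      by (intro tendsto_intros tendsto_LM ratio tendsto_inverse_d tendsto_ln_d_over_d) simp_all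
    then have "eventually (\<lambda>N. c < (LM N - ln (E N)) + (ln N / d N) / 2 - ln (sidon_const q m) / d N
        - 5 * m * (ln (d N) / d N) - ln (4 * real q) / m) sequentially"
      by (rule order_tendstoD) (use m in \<open>simp add: \<kappa>_def\<close>)
    with eventually_d_large[of m] show "eventually (\<lambda>N. c < ln (R N) - ln (E N)) sequentially"
    proof eventually_elim
      case (elim N)
      then show ?case
        using ln_interaction_bohr_radius_ge_sidon[OF q m(1), of "d N" N] by simp
    qed
  qed
  then have "(\<lambda>N. ln (R N) - ln (E N) - 1 / (2 * \<tau>)) \<longlonglongrightarrow> 1 / \<tau> / 2 - 1 / (2 * \<tau>)"
    by (intro tendsto_intros)
  moreover have "eventually (\<lambda>N. ln (R N) - ln (E N) - 1 / (2 * \<tau>)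
      = ln (R N) - ln (exp (1 / (2 * \<tau>)) * E N)) sequentially"
    using eventually_E_pos by eventually_elim (simp only: ln_mult_pos exp_gt_zero ln_exp)
  ultimately show "(\<lambda>N. ln (R N) - ln (exp (1 / (2 * \<tau>)) * E N)) \<longlonglongrightarrow> 0"
    by (simp add: tendsto_cong)
qed

lemma interaction_bohr_radius_ln:
  assumes d_equiv: "(\<lambda>N. real (d N)) \<sim>[sequentially] (\<lambda>N. ln (real N))"
  shows "(\<lambda>N. R N) \<sim>[sequentially] (\<lambda>N. sqrt (ln (real N) / ((real q - 1) * real N)))"
proof -
  have "(\<lambda>N. R N) \<sim>[sequentially] (\<lambda>N. exp (1 / (2 * 1)) * E N)"
    using d_equiv by (intro interaction_bohr_radius_ln_comparable) auto
  \<comment> \<open>For \<tau> = 1 the factor e^(1/2) cancels the e under the square root.\<close>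
  also have "(\<lambda>N. exp (1 / (2 * 1)) * E N) = (\<lambda>N. sqrt (d N / ((real q - 1) * real N)))"
  proof
    fix N
    have "exp (1 / (2 * 1)) = sqrt (exp 1)" by (simp flip: powr_half_sqrt add: powr_def)
    then show "exp (1 / (2 * 1)) * E N = sqrt (d N / ((real q - 1) * real N))"
      by (simp flip: real_sqrt_mult)
  qed
  also have "\<dots> \<sim>[sequentially] (\<lambda>N. sqrt (ln (real N) / ((real q - 1) * real N)))"
  proof (rule asymp_equiv_sqrt_real)
    show "(\<lambda>N. d N / ((real q - 1) * real N)) \<sim>[sequentially] (\<lambda>N. ln (real N) / ((real q - 1) * real N))"
      by (intro asymp_equiv_intros d_equiv)
    show "eventually (\<lambda>N. 0 \<le> ln (real N) / ((real q - 1) * real N)) sequentially"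
      using eventually_ge_at_top[of 1] by eventually_elim (use q in simp)
  qed (use q in simp)
  finally show ?thesis .
qed

end

theorem corollary6p3:
  fixes q :: nat and d :: "nat \<Rightarrow> nat"
  assumes "q \<ge> 2"
    and "\<And>N. N \<ge> 1 \<Longrightarrow> 1 \<le> d N \<and> d N \<le> N"
    and "filterlim d at_top sequentially"
    and "(\<lambda>N. real (d N)) \<in> o[sequentially](\<lambda>N. real N)"
  shows
    "((\<lambda>N. ln (real N)) \<in> o[sequentially](\<lambda>N. real (d N)) \<longrightarrow>
        (\<lambda>N. interaction_bohr_radius q N (d N)) \<sim>[sequentially]
          (\<lambda>N. sqrt (real (d N) / (exp 1 * (real q - 1) * real N)))) \<and>
     (\<forall>\<tau>>0. (\<lambda>N. real (d N)) \<sim>[sequentially] (\<lambda>N. \<tau> * ln (real N)) \<longrightarrow>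
        (\<lambda>N. interaction_bohr_radius q N (d N)) \<sim>[sequentially]
          (\<lambda>N. exp (1 / (2 * \<tau>)) * sqrt (real (d N) / (exp 1 * (real q - 1) * real N)))) \<and>
     ((\<lambda>N. real (d N)) \<sim>[sequentially] (\<lambda>N. ln (real N)) \<longrightarrow>
        (\<lambda>N. interaction_bohr_radius q N (d N)) \<sim>[sequentially]
          (\<lambda>N. sqrt (ln (real N) / ((real q - 1) * real N))))"
  using interaction_bohr_radius_ln_small[OF assms] interaction_bohr_radius_ln_comparable[OF assms]
    interaction_bohr_radius_ln[OF assms]
  by blast

end
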